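(* Let $\Lambda$ be an infinite finitely generated group with a finite generating set and let $(N_k)_{k\in\mathbb{N}}$ be a residual filtration of $\Lambda$. Suppose that the box space $\Box_{(N_k)}\Lambda$ is coarsely equivalent to a sequence $(X,\delta_S^{t_k})_{k\in\mathbb{N}}$, $t_k\in[1,\infty)$, of spaces of a warped system $\mathrm{WSys}(F_S\curvearrowright X)$. Then $\mathrm{WSys}(F_S\curvearrowright X)$ has stable discrete fundamental group if and only if $\Lambda$ is finitely presented. Moreover, if $\Lambda$ is finitely presented then $N_k\cong\pi_{1,\infty}(F_S\curvearrowright X)$ for every $k$ large enough.
   Context: Box spaces. A residual filtration of $\Lambda$ is a nested sequence of finite index normal subgroups $N_{k+1}\lhd N_k\lhd\Lambda$ (each normal in $\Lambda$) with $\bigcap_kN_k=\{e\}$. The box space $\Box_{(N_k)}\Lambda$ is the sequence of Cayley graphs $(\mathrm{Cay}(\Lambda/N_k))_{k}$ with respect to the fixed finite generating set of $\Lambda$. Coarse equivalence. A map $f\colon Z\to W$ of metric spaces is $(L,A)$-coarsely Lipschitz if $d_W(f(z),f(z'))\le L\,d_Z(z,z')+A$; it is an $(L,A)$-quasi-isometry if it is $(L,A)$-coarsely Lipschitz and there is an $(L,A)$-coarsely Lipschitz $\bar f\colon W\to Z$ with $f\circ\bar f$ and $\bar f\circ f$ at distance at most $A$ from the identities. Two sequences $(Z_k)$, $(W_k)$ of metric spaces are coarsely equivalent if there are $L,A$ such that $Z_k$ and $W_k$ are $(L,A)$-quasi-isometric for every $k$. Warped systems. Given a finite set $S$ of homeomorphisms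 of a metric space $(X,d)$, $F_S$ is the free group on $S$, and for $t\ge1$, $\delta_S^t$ is the largest metric on $X$ with $\delta_S^t\le t\cdot d$ and $\delta_S^t(x,s(x))\le1$ for all $x\in X,s\in S$. The warped system $\mathrm{WSys}(F_S\curvearrowright X)$ is the family $\{(X,\delta_S^t)\}_{t\ge1}$ together with $S$. A jumping-path is a sequence of continuous paths $\gamma_0,\dots,\gamma_n$ in $X$ and $\vec s_1,\dots,\vec s_n\in S\cup S^{-1}$ with $\gamma_i(0)=\vec s_i\gamma_{i-1}(1)$; its length at scale $t$ is $n+\sum_i t\|\gamma_i\|$, where $\|\gamma_i\|$ is the length in $(X,d)$. $(X,\delta_S^t)$ is jumping-geodesic if $(X,d)$ is geodesic and any two points $x,y$ are joined by a jumping-path of length exactly $\delta_S^t(x,y)$ at scale $t$. Standing assumption on all warped systems: $(X,d)$ is compact, path-connected, locally path-connected, semi-locally simply connected, every continuous path in $X$ is homotopic (rel endpoints) to one of finite length, and $(X,\delta_S^t)$ is jumping-geodesic for all $t$ large enough. Discrete fundamental group. For a metric space $(Z,\rho)$ and $\theta>0$, a $\theta$-path is a sequence $(z_0,\dots,z_n)$ with $\rho(z_i,z_{i+1})\le\theta$. Lazifications are obtained by repeating values; a $\theta$-grid homotopy between $\theta$-paths of length $n$ with the same endpoints is a $\theta$-Lipschitz map $\{0,\dots,n\}\times\{0,\dots,m\}\to Z$ ($\ell^1$ metric on the source) restricting to the two paths on the bottom and top rows and constant on the left and right sides. $\pi_{1,\theta}(Z)$ is the group of closed $\theta$-paths at a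 base point modulo the equivalence relation generated by lazifications and $\theta$-grid homotopies, with concatenation. Limit group. Fix $x_0\in X$ and, for $s\in S$, a continuous path $\alpha_s$ from $x_0$ to $s x_0$; put $\alpha_{s^{-1}}=s^{-1}(\alpha_s^* )$ ($^*$ denotes reversal) and $\alpha_{\vec s_1\cdots\vec s_n}=\alpha_{\vec s_1}\vec s_1(\alpha_{\vec s_2})\cdots(\vec s_1\cdots\vec s_{n-1})(\alpha_{\vec s_n})$. Let $\phi_S\colon F_S\to\mathrm{Aut}(\pi_1(X,x_0))$, $\phi_S(w)[\gamma]=[\alpha_w w(\gamma)\alpha_w^*]$. For integer $\theta\ge1$ let $K_\theta$ be the set of $([\beta w(\beta^* )\alpha_w^*],w)$ with $w\in F_S$ of reduced length $\le4\theta$ and $\mathrm{Fix}(w)\neq\emptyset$, and $\beta$ a path from $x_0$ to a point of $\mathrm{Fix}(w)$. For all $t$ large enough (depending on $\theta$) $\pi_{1,\theta}(X,\delta_S^t)$ is isomorphic to $(\pi_1(X,x_0)\rtimes_{\phi_S}F_S)/\langle\langle K_\theta\rangle\rangle$; this group is denoted $\pi_{1,\theta}(F_S\curvearrowright X)$. For $\theta<\theta'$ the identity of $X$ induces the natural quotient map $\pi_{1,\theta}(F_S\curvearrowright X)\to\pi_{1,\theta'}(F_S\curvearrowright X)$, and $\pi_{1,\infty}(F_S\curvearrowright X)=\varinjlim_\theta\pi_{1,\theta}(F_S\curvearrowright X)$. The warped system has stable discrete fundamental group if for some $\theta$ the natural surjection $\pi_{1,\theta}(F_S\curvearrowright X)\to\pi_{1,\infty}(F_S\curvearrowright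 X)$ is an isomorphism. *)

theory Defs
  imports "HOL-Analysis.Analysis" "HOL-Algebra.Algebra"
begin

section \<open>Group theory\<close>

subsection \<open>Free groups\<close>

text \<open>
  A letter over \<open>A\<close> is a pair \<open>(a, b)\<close>: \<open>(a, True)\<close> stands for \<open>a\<close> and \<open>(a, False)\<close> for the
  formal inverse of \<open>a\<close>.  The elements of the free group are the reduced words, so that the
  length of the list is the reduced length of the element.
\<close>

type_synonym 'a word = "('a \<times> bool) list"

definition cancelling :: "'a \<times> bool \<Rightarrow> 'a \<times> bool \<Rightarrow> bool" where
  "cancelling l m \<longleftrightarrow> fst l = fst m \<and> snd l \<noteq> snd m"

definition reduced :: "'a word \<Rightarrow> bool" where
  "reduced = successively (\<lambda>l m. \<not> cancelling l m)"

fun push_letter :: "'a \<times> bool \<Rightarrow> 'a word \<Rightarrow> 'a word" where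
  "push_letter l [] = [l]"
| "push_letter l (m # w) = (if cancelling l m then w else l # m # w)"

definition reduce :: "'a word \<Rightarrow> 'a word" where
  "reduce w = foldr push_letter w []"

definition free_group :: "'a set \<Rightarrow> 'a word monoid" where
  "free_group A =
     \<lparr> carrier = {w \<in> lists (A \<times> UNIV). reduced w},
       monoid.mult = (\<lambda>u v. reduce (u @ v)),
       one = [] \<rparr>"

subsection \<open>Normal closures, presentations and semidirect products\<close>

definition normal_closure :: "('a, 'b) monoid_scheme \<Rightarrow> 'a set \<Rightarrow> 'a set" where
  "normal_closure G R = \<Inter> {H. H \<lhd> G \<and> R \<subseteq> H}"

definition finitely_presented :: "('a, 'b) monoid_scheme \<Rightarrow> bool" where
  "finitely_presented G \<longleftrightarrow>
     (\<exists>(n::nat) R. finite R \<and> R \<subseteq> carrier (free_group {..<n}) \<and>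
        G \<cong> free_group {..<n} Mod normal_closure (free_group {..<n}) R)"

definition semidirect_product ::
  "('n, 'b) monoid_scheme \<Rightarrow> ('h, 'c) monoid_scheme \<Rightarrow> ('h \<Rightarrow> 'n \<Rightarrow> 'n) \<Rightarrow> ('n \<times> 'h) monoid" where
  "semidirect_product G H \<phi> =
     \<lparr> carrier = carrier G \<times> carrier H,
       monoid.mult = (\<lambda>(g, h) (g', h'). (g \<otimes>\<^bsub>G\<^esub> \<phi> h g', h \<otimes>\<^bsub>H\<^esub> h')),
       one = (\<one>\<^bsub>G\<^esub>, \<one>\<^bsub>H\<^esub>) \<rparr>"

subsection \<open>Direct limits\<close>

text \<open>
  \<open>f i j\<close> is the bonding homomorphism \<open>G i \<rightarrow> G j\<close>, for \<open>i \<le> j\<close> in the index set \<open>I\<close>.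
\<close>

definition direct_limit_rel ::
  "'i::linorder set \<Rightarrow> ('i \<Rightarrow> 'a monoid) \<Rightarrow> ('i \<Rightarrow> 'i \<Rightarrow> 'a \<Rightarrow> 'a) \<Rightarrow> (('i \<times> 'a) \<times> ('i \<times> 'a)) set" where
  "direct_limit_rel I G f =
     {((i, x), (j, y)). i \<in> I \<and> j \<in> I \<and> x \<in> carrier (G i) \<and> y \<in> carrier (G j) \<and>
        (\<exists>k\<in>I. i \<le> k \<and> j \<le> k \<and> f i k x = f j k y)}"

definition direct_limit_map ::
  "'i::linorder set \<Rightarrow> ('i \<Rightarrow> 'a monoid) \<Rightarrow> ('i \<Rightarrow> 'i \<Rightarrow> 'a \<Rightarrow> 'a) \<Rightarrow> 'i \<Rightarrow> 'a \<Rightarrow> ('i \<times> 'a) set" where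
  "direct_limit_map I G f i x = direct_limit_rel I G f `` {(i, x)}"

definition direct_limit ::
  "'i::linorder set \<Rightarrow> ('i \<Rightarrow> 'a monoid) \<Rightarrow> ('i \<Rightarrow> 'i \<Rightarrow> 'a \<Rightarrow> 'a) \<Rightarrow> ('i \<times> 'a) set monoid" where
  "direct_limit I G f =
     \<lparr> carrier = (SIGMA i:I. carrier (G i)) // direct_limit_rel I G f,
       monoid.mult = (\<lambda>C D. \<Union>(i, x)\<in>C. \<Union>(j, y)\<in>D.
          direct_limit_map I G f (max i j) (f i (max i j) x \<otimes>\<^bsub>G (max i j)\<^esub> f j (max i j) y)),
       one = (\<Union>i\<in>I. direct_limit_map I G f i \<one>\<^bsub>G i\<^esub>) \<rparr>"

section \<open>Coarse geometry of sequences of metric spaces\<close>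

definition coarsely_lipschitz :: "real \<Rightarrow> real \<Rightarrow> 'z metric \<Rightarrow> 'w metric \<Rightarrow> ('z \<Rightarrow> 'w) \<Rightarrow> bool" where
  "coarsely_lipschitz L A Z W f \<longleftrightarrow>
     f \<in> mspace Z \<rightarrow> mspace W \<and>
     (\<forall>z\<in>mspace Z. \<forall>z'\<in>mspace Z. mdist W (f z) (f z') \<le> L * mdist Z z z' + A)"

definition quasi_isometry :: "real \<Rightarrow> real \<Rightarrow> 'z metric \<Rightarrow> 'w metric \<Rightarrow> ('z \<Rightarrow> 'w) \<Rightarrow> bool" where
  "quasi_isometry L A Z W f \<longleftrightarrow>
     coarsely_lipschitz L A Z W f \<and>
     (\<exists>g. coarsely_lipschitz L A W Z g \<and>
        (\<forall>w\<in>mspace W. mdist W (f (g w)) w \<le> A) \<and>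
        (\<forall>z\<in>mspace Z. mdist Z (g (f z)) z \<le> A))"

definition coarsely_equivalent :: "(nat \<Rightarrow> 'z metric) \<Rightarrow> (nat \<Rightarrow> 'w metric) \<Rightarrow> bool" where
  "coarsely_equivalent Z W \<longleftrightarrow> (\<exists>L A. \<forall>k. \<exists>f. quasi_isometry L A (Z k) (W k) f)"

section \<open>Box spaces\<close>

definition cayley_edges :: "('a, 'b) monoid_scheme \<Rightarrow> 'a set \<Rightarrow> ('a \<times> 'a) set" where
  "cayley_edges G A =
     {(x, y). x \<in> carrier G \<and> y \<in> carrier G \<and> (\<exists>a\<in>A. y = x \<otimes>\<^bsub>G\<^esub> a \<or> x = y \<otimes>\<^bsub>G\<^esub> a)}"

definition cayley_dist :: "('a, 'b) monoid_scheme \<Rightarrow> 'a set \<Rightarrow> 'a \<Rightarrow> 'a \<Rightarrow> real" where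
  "cayley_dist G A x y = real (LEAST n. (x, y) \<in> cayley_edges G A ^^ n)"

text \<open>The Cayley graph as a metric space: its vertex set with the graph metric.\<close>

definition cayley_graph :: "('a, 'b) monoid_scheme \<Rightarrow> 'a set \<Rightarrow> 'a metric" where
  "cayley_graph G A = metric (carrier G, cayley_dist G A)"

definition residual_filtration :: "('a, 'b) monoid_scheme \<Rightarrow> (nat \<Rightarrow> 'a set) \<Rightarrow> bool" where
  "residual_filtration G N \<longleftrightarrow>
     (\<forall>k. N k \<lhd> G \<and> finite (carrier (G Mod N k)) \<and> N (Suc k) \<subseteq> N k) \<and>
     (\<Inter>k. N k) = {\<one>\<^bsub>G\<^esub>}"

definition box_space ::
  "('a, 'b) monoid_scheme \<Rightarrow> 'a set \<Rightarrow> (nat \<Rightarrow> 'a set) \<Rightarrow> nat \<Rightarrow> 'a set metric" where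
  "box_space G A N k = cayley_graph (G Mod N k) ((\<lambda>a. N k #>\<^bsub>G\<^esub> a) ` A)"

text \<open>\<^const>\<open>metric\<close> is only meaningful on metrics, so we check that this is one.\<close>

lemma Metric_space_cayley_dist:
  fixes G (structure)
  assumes "group G" and A: "A \<subseteq> carrier G" and gen: "generate G A = carrier G"
  shows "Metric_space (carrier G) (cayley_dist G A)"
proof -
  interpret group G by fact
  let ?E = "cayley_edges G A"
  have sym: "(x, y) \<in> ?E \<longleftrightarrow> (y, x) \<in> ?E" for x y
    by (auto simp: cayley_edges_def)
  have symn: "(x, y) \<in> ?E ^^ n \<Longrightarrow> (y, x) \<in> ?E ^^ n" for x y n
  proof (induction n arbitrary: y)
    case (Suc n)
    then obtain z where "(x, z) \<in> ?E ^^ n" "(z, y) \<in> ?E" by auto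
    then show ?case using Suc.IH sym relpow_Suc_I2 by metis
  qed simp
  have reach: "\<forall>x\<in>carrier G. (x, x \<otimes> g) \<in> ?E\<^sup>*" if "g \<in> generate G A" for g
    using that
  proof (induction rule: generate.induct)
    case (incl h)
    then show ?case using A by (fastforce simp: cayley_edges_def)
  next
    case (inv h)
    have "(x, x \<otimes> inv h) \<in> ?E" if "x \<in> carrier G" for x
      using that inv A by (auto simp: cayley_edges_def m_assoc intro!: bexI[of _ h])
    then show ?case by blast
  next
    case (eng h1 h2)
    have c: "h1 \<in> carrier G" "h2 \<in> carrier G" using eng.hyps gen by auto
    show ?case
    proof
      fix x assume x: "x \<in> carrier G"
      then have "(x, x \<otimes> h1) \<in> ?E\<^sup>*" "(x \<otimes> h1, x \<otimes> h1 \<otimes> h2) \<in> ?E\<^sup>*"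
        using eng.IH c by auto
      then show "(x, x \<otimes> (h1 \<otimes> h2)) \<in> ?E\<^sup>*" using x c by (simp add: m_assoc)
    qed
  qed simp
  have conn: "\<exists>n. (x, y) \<in> ?E ^^ n" if "x \<in> carrier G" "y \<in> carrier G" for x y
  proof -
    have "(x, x \<otimes> (inv x \<otimes> y)) \<in> ?E\<^sup>*" using reach that gen by auto
    then have "(x, y) \<in> ?E\<^sup>*" using that by (simp add: m_assoc[symmetric])
    then show ?thesis by (simp add: rtrancl_power)
  qed
  have least: "(x, y) \<in> ?E ^^ (LEAST n. (x, y) \<in> ?E ^^ n)"
    if "x \<in> carrier G" "y \<in> carrier G" for x y
    using conn[OF that] by (rule LeastI_ex)
  show ?thesis
  proof
    show "0 \<le> cayley_dist G A x y" for x y by (simp add: cayley_dist_def)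
    have "(\<lambda>n. (x, y) \<in> ?E ^^ n) = (\<lambda>n. (y, x) \<in> ?E ^^ n)" for x y
      using symn by blast
    then show "cayley_dist G A x y = cayley_dist G A y x" for x y
      by (simp add: cayley_dist_def)
    show "cayley_dist G A x y = 0 \<longleftrightarrow> x = y" if "x \<in> carrier G" "y \<in> carrier G" for x y
    proof
      assume "cayley_dist G A x y = 0"
      then show "x = y" using least[OF that] by (simp add: cayley_dist_def)
    next
      assume "x = y"
      then have "(x, y) \<in> ?E ^^ 0" by simp
      then have "(LEAST n. (x, y) \<in> ?E ^^ n) \<le> 0" by (rule Least_le)
      then show "cayley_dist G A x y = 0" by (simp add: cayley_dist_def)
    qed
    show "cayley_dist G A x z \<le> cayley_dist G A x y + cayley_dist G A y z"
      if "x \<in> carrier G" "y \<in> carrier G" "z \<in> carrier G" for x y z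
    proof -
      have "(x, z) \<in> ?E ^^ ((LEAST n. (x, y) \<in> ?E ^^ n) + (LEAST n. (y, z) \<in> ?E ^^ n))"
        using least that by (auto simp: relpow_add)
      from Least_le[of "\<lambda>n. (x, z) \<in> ?E ^^ n", OF this] show ?thesis
        by (simp add: cayley_dist_def flip: of_nat_add)
    qed
  qed
qed

section \<open>Warped systems\<close>

definition warped_dist :: "('x::metric_space \<Rightarrow> 'x) set \<Rightarrow> real \<Rightarrow> 'x \<Rightarrow> 'x \<Rightarrow> real" where
  "warped_dist S t =
     (GREATEST \<rho>. Metric_space UNIV \<rho> \<and> (\<forall>x y. \<rho> x y \<le> t * dist x y) \<and>
        (\<forall>x. \<forall>s\<in>S. \<rho> x (s x) \<le> 1))"

definition warped_space :: "('x::metric_space \<Rightarrow> 'x) set \<Rightarrow> real \<Rightarrow> 'x metric" where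
  "warped_space S t = metric (UNIV, warped_dist S t)"

text \<open>The greatest metric with these bounds exists: it is the pointwise supremum of all of them.\<close>

lemma warped_dist_greatest:
  fixes S :: "('x::metric_space \<Rightarrow> 'x) set"
  assumes "t > 0"
  defines "P \<equiv> \<lambda>\<rho>. Metric_space UNIV \<rho> \<and> (\<forall>x y. \<rho> x y \<le> t * dist x y) \<and>
        (\<forall>x. \<forall>s\<in>S. \<rho> x (s x) \<le> 1)"
  shows "P (warped_dist S t)" and "P \<rho> \<Longrightarrow> \<rho> x y \<le> warped_dist S t x y"
proof -
  define D where "D = (\<lambda>x y. SUP \<rho>\<in>{\<rho>. P \<rho>}. \<rho> x y)"
  have "Metric_space UNIV (\<lambda>x y::'x. min 1 (t * dist x y))"
  proof
    fix x y z :: 'x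
    have "t * dist x z \<le> t * dist x y + t * dist y z"
      using dist_triangle[of x z y] assms(1) by (simp flip: distrib_left)
    moreover have "0 \<le> t * dist x y" "0 \<le> t * dist y z" using assms(1) by auto
    ultimately show "min 1 (t * dist x z) \<le> min 1 (t * dist x y) + min 1 (t * dist y z)"
      by linarith
  next
    fix x y :: 'x
    show "(min 1 (t * dist x y) = 0) = (x = y)" using assms(1) by (auto simp: min_def)
  qed (use assms(1) in \<open>auto simp: dist_commute\<close>)
  then have P0: "P (\<lambda>x y. min 1 (t * dist x y))" by (auto simp: P_def)
  have bdd: "bdd_above ((\<lambda>\<rho>. \<rho> x y) ` {\<rho>. P \<rho>})" for x y
    by (rule bdd_aboveI[of _ "t * dist x y"]) (auto simp: P_def)
  have ub: "\<rho> x y \<le> D x y" if "P \<rho>" for \<rho> x y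
    unfolding D_def using that by (intro cSUP_upper bdd) auto
  have lub: "D x y \<le> c" if "\<And>\<rho>. P \<rho> \<Longrightarrow> \<rho> x y \<le> c" for x y c
    unfolding D_def using that P0 by (intro cSUP_least) auto
  have "Metric_space UNIV D"
  proof
    fix x y z :: 'x
    show "0 \<le> D x y" using ub[OF P0, of x y] assms(1) by (smt (verit) mult_nonneg_nonneg zero_le_dist)
    have com: "\<rho> x y = \<rho> y x" if "P \<rho>" for \<rho> and x y
      using that by (auto simp: P_def Metric_space_def)
    show "D x y = D y x"
      unfolding D_def using com by (intro SUP_cong) auto
    have "D x x \<le> 0" by (rule lub) (metis P_def Metric_space.zero UNIV_I order.refl)
    moreover have "0 < D x y" if "x \<noteq> y" using ub[OF P0, of x y] that assms(1)
      by (smt (verit) mult_pos_pos zero_less_dist_iff)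
    ultimately show "D x y = 0 \<longleftrightarrow> x = y"
      using ub[OF P0, of x x] by fastforce
    show "D x z \<le> D x y + D y z"
    proof (rule lub)
      fix \<rho> assume "P \<rho>"
      then have "\<rho> x z \<le> \<rho> x y + \<rho> y z" by (auto simp: P_def Metric_space_def)
      then show "\<rho> x z \<le> D x y + D y z" using ub[OF \<open>P \<rho>\<close>, of x y] ub[OF \<open>P \<rho>\<close>, of y z] by linarith
    qed
  qed
  then have PD: "P D"
    unfolding P_def by (auto intro!: lub simp: P_def)
  have "warped_dist S t = D"
    unfolding warped_dist_def P_def[symmetric]
    by (rule Greatest_equality[of P D]) (auto simp: PD le_fun_def ub)
  then show "P (warped_dist S t)" "P \<rho> \<Longrightarrow> \<rho> x y \<le> warped_dist S t x y"
    using PD ub by auto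
qed

definition path_length :: "(real \<Rightarrow> 'x::metric_space) \<Rightarrow> ennreal" where
  "path_length \<gamma> =
     (SUP (n, u) \<in> {(n::nat, u::nat \<Rightarrow> real). mono u \<and> range u \<subseteq> {0..1}}.
        \<Sum>i<n. ennreal (dist (\<gamma> (u i)) (\<gamma> (u (Suc i)))))"

definition jumping_path ::
  "('x::metric_space \<Rightarrow> 'x) set \<Rightarrow> nat \<Rightarrow> (nat \<Rightarrow> real \<Rightarrow> 'x) \<Rightarrow> (nat \<Rightarrow> 'x \<Rightarrow> 'x) \<Rightarrow> bool" where
  "jumping_path S n \<gamma> \<sigma> \<longleftrightarrow>
     (\<forall>i\<in>{0..n}. path (\<gamma> i)) \<and>
     (\<forall>i\<in>{1..n}. \<sigma> i \<in> S \<union> inv_into UNIV ` S \<and> pathstart (\<gamma> i) = \<sigma> i (pathfinish (\<gamma> (i - 1))))"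

definition jumping_length :: "real \<Rightarrow> nat \<Rightarrow> (nat \<Rightarrow> real \<Rightarrow> 'x::metric_space) \<Rightarrow> ennreal" where
  "jumping_length t n \<gamma> = of_nat n + (\<Sum>i=0..n. ennreal t * path_length (\<gamma> i))"

definition geodesic_space :: "'x::metric_space itself \<Rightarrow> bool" where
  "geodesic_space _ \<longleftrightarrow>
     (\<forall>x y::'x. \<exists>c. c 0 = x \<and> c (dist x y) = y \<and>
        (\<forall>u\<in>{0..dist x y}. \<forall>v\<in>{0..dist x y}. dist (c u) (c v) = \<bar>u - v\<bar>))"

definition jumping_geodesic :: "('x::metric_space \<Rightarrow> 'x) set \<Rightarrow> real \<Rightarrow> bool" where
  "jumping_geodesic S t \<longleftrightarrow>
     geodesic_space TYPE('x) \<and>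
     (\<forall>x y. \<exists>n \<gamma> \<sigma>. jumping_path S n \<gamma> \<sigma> \<and> pathstart (\<gamma> 0) = x \<and> pathfinish (\<gamma> n) = y \<and>
        jumping_length t n \<gamma> = ennreal (warped_dist S t x y))"

definition semilocally_simply_connected :: "'x::topological_space itself \<Rightarrow> bool" where
  "semilocally_simply_connected _ \<longleftrightarrow>
     (\<forall>x::'x. \<exists>U. open U \<and> x \<in> U \<and>
        (\<forall>\<gamma>. path \<gamma> \<and> path_image \<gamma> \<subseteq> U \<and> pathstart \<gamma> = x \<and> pathfinish \<gamma> = x \<longrightarrow>
           homotopic_paths UNIV \<gamma> (\<lambda>_. x)))"

text \<open>The space \<open>X\<close> is the whole type \<open>'x\<close>.\<close>

definition warped_system :: "('x::metric_space \<Rightarrow> 'x) set \<Rightarrow> bool" where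
  "warped_system S \<longleftrightarrow>
     finite S \<and> (\<forall>s\<in>S. homeomorphic_map euclidean euclidean s) \<and>
     compact (UNIV :: 'x set) \<and> path_connected (UNIV :: 'x set) \<and>
     locally path_connected (UNIV :: 'x set) \<and> semilocally_simply_connected TYPE('x) \<and>
     (\<forall>\<gamma> :: real \<Rightarrow> 'x. path \<gamma> \<longrightarrow> (\<exists>\<gamma>'. homotopic_paths UNIV \<gamma> \<gamma>' \<and> path_length \<gamma>' < \<infinity>)) \<and>
     (\<exists>T. \<forall>t\<ge>T. jumping_geodesic S t)"

section \<open>Discrete fundamental groups of warped systems\<close>

definition path_class :: "(real \<Rightarrow> 'x::topological_space) \<Rightarrow> (real \<Rightarrow> 'x) set" where
  "path_class \<gamma> = {\<gamma>'. homotopic_paths UNIV \<gamma> \<gamma>'}"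

definition loops_at :: "'x::topological_space \<Rightarrow> (real \<Rightarrow> 'x) set" where
  "loops_at x0 = {\<gamma>. path \<gamma> \<and> pathstart \<gamma> = x0 \<and> pathfinish \<gamma> = x0}"

definition fundamental_group :: "'x::topological_space \<Rightarrow> (real \<Rightarrow> 'x) set monoid" where
  "fundamental_group x0 =
     \<lparr> carrier = path_class ` loops_at x0,
       monoid.mult = (\<lambda>C D. \<Union>\<gamma>\<in>C. \<Union>\<delta>\<in>D. path_class (\<gamma> +++ \<delta>)),
       one = path_class (\<lambda>_. x0) \<rparr>"

fun letter_act :: "('x \<Rightarrow> 'x) \<times> bool \<Rightarrow> 'x \<Rightarrow> 'x" where
  "letter_act (s, b) = (if b then s else inv_into UNIV s)"

fun word_act :: "('x \<Rightarrow> 'x) word \<Rightarrow> 'x \<Rightarrow> 'x" where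
  "word_act [] = id"
| "word_act (l # w) = letter_act l \<circ> word_act w"

definition Fix :: "('x \<Rightarrow> 'x) word \<Rightarrow> 'x set" where
  "Fix w = {x. word_act w x = x}"

text \<open>
  The paths \<open>\<alpha>\<^sub>w\<close> from \<open>x\<^sub>0\<close> to \<open>w x\<^sub>0\<close>; the trailing constant path does not affect homotopy
  classes, which are all that is used below.
\<close>

fun letter_path ::
  "(('x::topological_space \<Rightarrow> 'x) \<Rightarrow> real \<Rightarrow> 'x) \<Rightarrow> ('x \<Rightarrow> 'x) \<times> bool \<Rightarrow> real \<Rightarrow> 'x" where
  "letter_path \<alpha> (s, b) = (if b then \<alpha> s else inv_into UNIV s \<circ> reversepath (\<alpha> s))"

fun word_path ::
  "'x::topological_space \<Rightarrow> (('x \<Rightarrow> 'x) \<Rightarrow> real \<Rightarrow> 'x) \<Rightarrow> ('x \<Rightarrow> 'x) word \<Rightarrow> real \<Rightarrow> 'x" where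
  "word_path x0 \<alpha> [] = (\<lambda>_. x0)"
| "word_path x0 \<alpha> (l # w) = letter_path \<alpha> l +++ (letter_act l \<circ> word_path x0 \<alpha> w)"

definition word_aut ::
  "'x::topological_space \<Rightarrow> (('x \<Rightarrow> 'x) \<Rightarrow> real \<Rightarrow> 'x) \<Rightarrow> ('x \<Rightarrow> 'x) word \<Rightarrow>
   (real \<Rightarrow> 'x) set \<Rightarrow> (real \<Rightarrow> 'x) set" where
  "word_aut x0 \<alpha> w C =
     (\<Union>\<gamma>\<in>C. path_class (word_path x0 \<alpha> w +++ ((word_act w \<circ> \<gamma>) +++ reversepath (word_path x0 \<alpha> w))))"

definition pi1_semidirect ::
  "('x::topological_space \<Rightarrow> 'x) set \<Rightarrow> 'x \<Rightarrow> (('x \<Rightarrow> 'x) \<Rightarrow> real \<Rightarrow> 'x) \<Rightarrow>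
   ((real \<Rightarrow> 'x) set \<times> ('x \<Rightarrow> 'x) word) monoid" where
  "pi1_semidirect S x0 \<alpha> = semidirect_product (fundamental_group x0) (free_group S) (word_aut x0 \<alpha>)"

definition fix_relators ::
  "('x::topological_space \<Rightarrow> 'x) set \<Rightarrow> 'x \<Rightarrow> (('x \<Rightarrow> 'x) \<Rightarrow> real \<Rightarrow> 'x) \<Rightarrow> nat \<Rightarrow>
   ((real \<Rightarrow> 'x) set \<times> ('x \<Rightarrow> 'x) word) set" where
  "fix_relators S x0 \<alpha> \<theta> =
     {(path_class (\<beta> +++ ((word_act w \<circ> reversepath \<beta>) +++ reversepath (word_path x0 \<alpha> w))), w) | w \<beta>.
        w \<in> carrier (free_group S) \<and> length w \<le> 4 * \<theta> \<and> Fix w \<noteq> {} \<and>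
        path \<beta> \<and> pathstart \<beta> = x0 \<and> pathfinish \<beta> \<in> Fix w}"

definition fix_kernel ::
  "('x::topological_space \<Rightarrow> 'x) set \<Rightarrow> 'x \<Rightarrow> (('x \<Rightarrow> 'x) \<Rightarrow> real \<Rightarrow> 'x) \<Rightarrow> nat \<Rightarrow>
   ((real \<Rightarrow> 'x) set \<times> ('x \<Rightarrow> 'x) word) set" where
  "fix_kernel S x0 \<alpha> \<theta> = normal_closure (pi1_semidirect S x0 \<alpha>) (fix_relators S x0 \<alpha> \<theta>)"

text \<open>
  \<open>warped_pi1 S x0 \<alpha> \<theta>\<close> is \<open>\<pi>\<^sub>1\<^sub>,\<^sub>\<theta>\<close> of the warped system.  That it is isomorphic to the \<open>\<theta>\<close>-discrete
  fundamental group of \<open>warped_space S t\<close> for all large \<open>t\<close> is a theorem, not part of the definition.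
\<close>

definition warped_pi1 ::
  "('x::topological_space \<Rightarrow> 'x) set \<Rightarrow> 'x \<Rightarrow> (('x \<Rightarrow> 'x) \<Rightarrow> real \<Rightarrow> 'x) \<Rightarrow> nat \<Rightarrow>
   ((real \<Rightarrow> 'x) set \<times> ('x \<Rightarrow> 'x) word) set monoid" where
  "warped_pi1 S x0 \<alpha> \<theta> = pi1_semidirect S x0 \<alpha> Mod fix_kernel S x0 \<alpha> \<theta>"

text \<open>The quotient map sends a coset \<open>K #> x\<close> to \<open>K' <#> (K #> x) = K' #> x\<close>, where \<open>K \<subseteq> K'\<close>.\<close>

definition warped_pi1_map ::
  "('x::topological_space \<Rightarrow> 'x) set \<Rightarrow> 'x \<Rightarrow> (('x \<Rightarrow> 'x) \<Rightarrow> real \<Rightarrow> 'x) \<Rightarrow> nat \<Rightarrow> nat \<Rightarrow>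
   ((real \<Rightarrow> 'x) set \<times> ('x \<Rightarrow> 'x) word) set \<Rightarrow> ((real \<Rightarrow> 'x) set \<times> ('x \<Rightarrow> 'x) word) set" where
  "warped_pi1_map S x0 \<alpha> \<theta> \<theta>' C = fix_kernel S x0 \<alpha> \<theta>' <#>\<^bsub>pi1_semidirect S x0 \<alpha>\<^esub> C"

definition warped_pi1_infinity ::
  "('x::topological_space \<Rightarrow> 'x) set \<Rightarrow> 'x \<Rightarrow> (('x \<Rightarrow> 'x) \<Rightarrow> real \<Rightarrow> 'x) \<Rightarrow>
   (nat \<times> ((real \<Rightarrow> 'x) set \<times> ('x \<Rightarrow> 'x) word) set) set monoid" where
  "warped_pi1_infinity S x0 \<alpha> = direct_limit {1..} (warped_pi1 S x0 \<alpha>) (warped_pi1_map S x0 \<alpha>)"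

definition stable_discrete_pi1 ::
  "('x::topological_space \<Rightarrow> 'x) set \<Rightarrow> 'x \<Rightarrow> (('x \<Rightarrow> 'x) \<Rightarrow> real \<Rightarrow> 'x) \<Rightarrow> bool" where
  "stable_discrete_pi1 S x0 \<alpha> \<longleftrightarrow>
     (\<exists>\<theta>\<ge>1. direct_limit_map {1..} (warped_pi1 S x0 \<alpha>) (warped_pi1_map S x0 \<alpha>) \<theta>
               \<in> iso (warped_pi1 S x0 \<alpha> \<theta>) (warped_pi1_infinity S x0 \<alpha>))"

end

theory Submission
  imports Defs
begin

text \<open>
  The semidirect product \<open>\<Gamma> = \<pi>\<^sub>1(X) \<rtimes> F\<^sub>S\<close> is the vertex group of the groupoid whose morphisms
  from \<open>x\<close> to \<open>y\<close> are pairs of a word \<open>w\<close> and a path from \<open>x\<close> to \<open>w y\<close>. A chain of boundedly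
  many unit steps of \<open>(X, \<delta>\<^sub>S\<^sup>t)\<close> represents such a morphism; if it is closed and \<open>t\<close> is large,
  then its word displaces the base point very little, so by compactness it fixes a nearby
  point, and the morphism is one of the relators in \<open>K\<^sub>\<theta>\<close>.

  Let \<open>F\<close> be the free group on the generators of \<open>\<Lambda>\<close>, and \<open>R\<^sub>r\<close> the normal closure of the words
  of length at most \<open>r\<close> that are trivial in \<open>\<Lambda>\<close>. Closed words of bounded length in \<open>\<Lambda> / N\<^sub>k\<close>
  are trivial in \<open>\<Lambda>\<close> for large \<open>k\<close>. Sending the edges of the Cayley graph to chains therefore
  gives a homomorphism \<open>\<Phi>\<^sub>k\<close> from the preimage of \<open>N\<^sub>k\<close> in \<open>F\<close> to \<open>\<Gamma>\<close> that maps \<open>R\<^sub>r\<close> into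
  \<open>K\<^sub>\<theta>\<close>. In the other direction, the words joining the images of nearby points of \<open>X\<close> form a
  local cocycle with values in \<open>F / R\<^sub>\<rho>\<close>, and its monodromy is a homomorphism \<open>\<Psi>\<close> from \<open>\<Gamma>\<close> to
  \<open>F / R\<^sub>\<rho>\<close> that kills \<open>K\<^sub>\<theta>\<close> and inverts \<open>\<Phi>\<^sub>k\<close> up to conjugation. The constants depend on each
  other but not on \<open>k\<close>, so \<open>K\<^sub>\<theta>\<close> is eventually constant if and only if \<open>R\<^sub>r\<close> is, that is, if
  and only if \<open>\<Lambda>\<close> is finitely presented, and then \<open>\<Phi>\<^sub>k\<close> induces an isomorphism from \<open>N\<^sub>k\<close> to \<open>\<Gamma>
  / K\<^sub>\<theta>\<close>.
\<close>

section \<open>Groups\<close>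

subsection \<open>Words and free groups\<close>

text \<open>The quasi-isometries are neither continuous nor equivariant and change with k, so they
  do not induce homomorphisms directly. Both homomorphisms are therefore assembled from bounded
  pieces: a generator becomes a chain of \<open>M\<close> steps, a small step or a jump becomes a
  word of length at most \<open>M\<close>. Such a recipe is well defined as soon as the circuits of
  a few bounded sizes are trivial in the target. On the side of the words this is residuality: for
  large k a short circuit of \<Lambda> / N_k is already closed in \<Lambda>. On the side of X it
  requires t_k to tend to infinity. This follows because \<Lambda> is infinite: the diameters of the
  quotients grow beyond all bounds, while \<delta>^t is at most t times the metric of the compact
  space X. Stability and finite presentability do not mention k. So k only has to be large for the
  constants, or even for the single word, under consideration, and it disappears from each
  conclusion.\<close>

fun letter_inv :: "'a \<times> bool \<Rightarrow> 'a \<times> bool" where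
  "letter_inv (a, b) = (a, \<not> b)"

definition word_inv :: "'a word \<Rightarrow> 'a word" where
  "word_inv w = rev (map letter_inv w)"

lemma word_inv_Nil [simp]: "word_inv [] = []"
  by (simp add: word_inv_def)

lemma word_inv_Cons [simp]: "word_inv (l # w) = word_inv w @ [letter_inv l]"
  by (simp add: word_inv_def)

lemma length_word_inv [simp]: "length (word_inv w) = length w"
  by (simp add: word_inv_def)

lemma letter_inv_mem [simp]: "letter_inv l \<in> A \<times> UNIV \<longleftrightarrow> l \<in> A \<times> UNIV"
  by (cases l) auto

lemma word_inv_lists [simp]: "word_inv w \<in> lists (A \<times> UNIV) \<longleftrightarrow> w \<in> lists (A \<times> UNIV)"
  by (induction w) auto

lemma cancelling_iff: "cancelling l m \<longleftrightarrow> m = letter_inv l"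
  by (cases l; cases m) (auto simp: cancelling_def)

lemma letter_inv_letter_inv [simp]: "letter_inv (letter_inv l) = l"
  by (cases l) auto

lemma word_inv_append [simp]: "word_inv (u @ v) = word_inv v @ word_inv u"
  by (simp add: word_inv_def)

lemma word_inv_word_inv [simp]: "word_inv (word_inv w) = w"
  by (induction w) auto

lemma reduce_Nil [simp]: "reduce [] = []"
  by (simp add: reduce_def)

lemma reduce_Cons: "reduce (l # w) = push_letter l (reduce w)"
  by (simp add: reduce_def)

lemma reduced_Nil [simp]: "reduced []"
  by (simp add: reduced_def)

lemma reduced_ConsD: "reduced (l # w) \<Longrightarrow> reduced w"
  by (cases w) (auto simp: reduced_def)

lemma reduced_push_letter: "reduced w \<Longrightarrow> reduced (push_letter l w)"
  by (cases w) (auto simp: reduced_def dest: reduced_ConsD[unfolded reduced_def])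

lemma reduced_reduce [simp]: "reduced (reduce w)"
  by (induction w) (auto simp: reduce_Cons reduced_push_letter)

lemma reduce_id: "reduced w \<Longrightarrow> reduce w = w"
proof (induction w)
  case (Cons l w)
  then have "reduce w = w" by (auto dest: reduced_ConsD)
  then show ?case using Cons.prems by (cases w) (auto simp: reduce_Cons reduced_def)
qed simp

text \<open>On reduced words the letters act by mutually inverse permutations. This is the classical
  way to get associativity of the free group: \<open>reduce\<close> evaluates a word in this action,
  so reducing a prefix first changes nothing (\<open>reduce_append_left\<close>).\<close>

lemma push_letter_inverse:
  assumes "cancelling l m" "reduced w"
  shows "push_letter l (push_letter m w) = w"
proof (cases w)
  case (Cons k v)
  show ?thesis
  proof (cases "cancelling m k")
    case True
    then have k: "k = l" using assms(1) by (simp add: cancelling_iff)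
    show ?thesis using assms(2) True k Cons by (cases v) (auto simp: reduced_def)
  qed (use assms(1) Cons in auto)
qed (use assms(1) in simp)

lemma foldr_push_letter_reduced: "reduced w \<Longrightarrow> reduced (foldr push_letter u w)"
  by (induction u) (auto simp: reduced_push_letter)

lemma foldr_push_letter_push:
  assumes "reduced w"
  shows "foldr push_letter (push_letter l u) w = push_letter l (foldr push_letter u w)"
  using push_letter_inverse[OF _ foldr_push_letter_reduced[OF assms]] by (cases u) auto

lemma foldr_push_letter_reduce:
  "reduced w \<Longrightarrow> foldr push_letter (reduce u) w = foldr push_letter u w"
  by (induction u) (auto simp: reduce_Cons foldr_push_letter_push)

lemma reduce_append: "reduce (u @ v) = foldr push_letter u (reduce v)"
  by (simp add: reduce_def)

lemma reduce_append_left [simp]: "reduce (reduce u @ v) = reduce (u @ v)"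
  by (simp add: reduce_append foldr_push_letter_reduce)

lemma reduce_reduce [simp]: "reduce (reduce w) = reduce w"
  by (simp add: reduce_id)

lemma reduce_append_right [simp]: "reduce (u @ reduce v) = reduce (u @ v)"
  by (simp add: reduce_append)

lemma length_push_letter: "length (push_letter l w) \<le> Suc (length w)"
  by (cases w) auto

lemma length_reduce: "length (reduce w) \<le> length w"
proof (induction w)
  case (Cons l w)
  then show ?case using length_push_letter[of l "reduce w"] by (simp add: reduce_Cons)
qed simp

lemma push_letter_lists: "l \<in> B \<Longrightarrow> w \<in> lists B \<Longrightarrow> push_letter l w \<in> lists B"
  by (cases w) auto

lemma reduce_lists: "w \<in> lists B \<Longrightarrow> reduce w \<in> lists B"
  by (induction w) (auto simp: reduce_Cons push_letter_lists)

lemma reduce_word_inv [simp]: "reduce (w @ word_inv w) = []"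
proof (induction w)
  case (Cons l w)
  have "reduce ((w @ word_inv w) @ [letter_inv l]) = [letter_inv l]"
    unfolding reduce_append_left[symmetric, of "w @ word_inv w"] Cons.IH by (simp add: reduce_def)
  then show ?case by (simp add: reduce_Cons cancelling_iff)
qed simp

lemma reduce_word_inv' [simp]: "reduce (word_inv w @ w) = []"
  using reduce_word_inv[of "word_inv w"] by simp

text \<open>The common tool for every quantity that must not see reduction: actions, path classes,
  values in a group, transports. \<open>f\<close> may take values in any type; the second premise
  says that \<open>f (l # u)\<close> depends only on \<open>l\<close> and \<open>f u\<close>, so
  cancellations deep inside a word are covered.\<close>

lemma reduce_invariant:
  assumes "\<And>l w. l \<in> A \<times> UNIV \<Longrightarrow> w \<in> lists (A \<times> UNIV) \<Longrightarrow> f (l # letter_inv l # w) = f w"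
    and "\<And>l u v. l \<in> A \<times> UNIV \<Longrightarrow> u \<in> lists (A \<times> UNIV) \<Longrightarrow> v \<in> lists (A \<times> UNIV) \<Longrightarrow>
            f u = f v \<Longrightarrow> f (l # u) = f (l # v)"
    and "w \<in> lists (A \<times> UNIV)"
  shows "f (reduce w) = f w"
  using assms(3)
proof (induction w)
  case (Cons l w)
  have push: "f (push_letter l u) = f (l # u)" if "u \<in> lists (A \<times> UNIV)" for u
    using that Cons.hyps assms(1) by (cases u) (auto simp: cancelling_iff)
  show ?case
    unfolding reduce_Cons
    using Cons push[of "reduce w"] assms(2)[of l "reduce w" w] by (simp add: reduce_lists)
qed simp

lemma carrier_free_group: "carrier (free_group A) = {w \<in> lists (A \<times> UNIV). reduced w}"
  and mult_free_group [simp]: "u \<otimes>\<^bsub>free_group A\<^esub> v = reduce (u @ v)"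
  and one_free_group [simp]: "\<one>\<^bsub>free_group A\<^esub> = []"
  by (auto simp: free_group_def)

lemma reduce_in_free_group [simp]:
  "w \<in> lists (A \<times> UNIV) \<Longrightarrow> reduce w \<in> carrier (free_group A)"
  by (simp add: carrier_free_group reduce_lists)

lemma group_free_group: "group (free_group A)"
proof (rule groupI)
  fix w assume w: "w \<in> carrier (free_group A)"
  then have "reduce (word_inv w) \<in> carrier (free_group A)"
    by (simp add: carrier_free_group reduce_lists)
  then show "\<exists>y\<in>carrier (free_group A). y \<otimes>\<^bsub>free_group A\<^esub> w = \<one>\<^bsub>free_group A\<^esub>"
    by (intro bexI[of _ "reduce (word_inv w)"]) auto
qed (auto simp: carrier_free_group reduce_lists reduce_id)

lemma inv_free_group:
  "w \<in> carrier (free_group A) \<Longrightarrow> inv\<^bsub>free_group A\<^esub> w = reduce (word_inv w)"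
  by (rule group.inv_equality[OF group_free_group])
     (auto simp: carrier_free_group reduce_lists)

subsection \<open>Homomorphisms out of free groups\<close>

fun letter_val :: "('g, 'b) monoid_scheme \<Rightarrow> ('a \<Rightarrow> 'g) \<Rightarrow> 'a \<times> bool \<Rightarrow> 'g" where
  "letter_val G c (a, b) = (if b then c a else inv\<^bsub>G\<^esub> c a)"

definition word_val :: "('g, 'b) monoid_scheme \<Rightarrow> ('a \<Rightarrow> 'g) \<Rightarrow> 'a word \<Rightarrow> 'g" where
  "word_val G c w = foldr (\<lambda>l g. letter_val G c l \<otimes>\<^bsub>G\<^esub> g) w \<one>\<^bsub>G\<^esub>"

lemma word_val_Nil [simp]: "word_val G c [] = \<one>\<^bsub>G\<^esub>"
  and word_val_Cons [simp]: "word_val G c (l # w) = letter_val G c l \<otimes>\<^bsub>G\<^esub> word_val G c w"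
  by (simp_all add: word_val_def)

locale free_eval = group G for G (structure) +
  fixes A :: "'x set" and c :: "'x \<Rightarrow> 'a"
  assumes gens: "c \<in> A \<rightarrow> carrier G"
begin

lemma letter_val_closed [simp]: "l \<in> A \<times> UNIV \<Longrightarrow> letter_val G c l \<in> carrier G"
  using gens by (cases l) auto

lemma letter_val_inv: "l \<in> A \<times> UNIV \<Longrightarrow> letter_val G c (letter_inv l) = inv letter_val G c l"
  using gens by (cases l) (auto simp: Pi_iff)

lemma word_val_closed [simp]: "w \<in> lists (A \<times> UNIV) \<Longrightarrow> word_val G c w \<in> carrier G"
  by (induction w) (auto simp del: letter_val.simps)

lemma word_val_append:
  "u \<in> lists (A \<times> UNIV) \<Longrightarrow> v \<in> lists (A \<times> UNIV) \<Longrightarrow>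
   word_val G c (u @ v) = word_val G c u \<otimes> word_val G c v"
  by (induction u) (simp_all del: letter_val.simps add: m_assoc)

lemma word_val_reduce: "w \<in> lists (A \<times> UNIV) \<Longrightarrow> word_val G c (reduce w) = word_val G c w"
proof (rule reduce_invariant[where A = A])
  fix l :: "'x \<times> bool" and w :: "('x \<times> bool) list" assume "l \<in> A \<times> UNIV" "w \<in> lists (A \<times> UNIV)"
  then show "word_val G c (l # letter_inv l # w) = word_val G c w"
    by (simp add: letter_val_inv flip: m_assoc)
qed auto

lemma word_val_inv:
  "w \<in> lists (A \<times> UNIV) \<Longrightarrow> word_val G c (word_inv w) = inv word_val G c w"
  by (rule inv_equality[symmetric])
     (simp_all flip: word_val_append word_val_reduce[of "word_inv w @ w"])

lemma word_val_hom: "word_val G c \<in> hom (free_group A) G"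
  by (auto simp: hom_def carrier_free_group word_val_reduce word_val_append)

end

lemma hom_free_group_eq:
  assumes G: "group G" and h: "h \<in> hom (free_group A) G" and w: "w \<in> carrier (free_group A)"
  shows "h w = word_val G (\<lambda>a. h [(a, True)]) w"
proof -
  interpret group G by fact
  interpret F: group "free_group A" by (rule group_free_group)
  interpret h: group_hom "free_group A" G h
    by unfold_locales (fact h)
  have letter: "h [l] = letter_val G (\<lambda>a. h [(a, True)]) l" if "l \<in> A \<times> UNIV" for l
  proof (cases l)
    case (Pair a b)
    have a: "[(a, True)] \<in> carrier (free_group A)" using that Pair
      by (auto simp: carrier_free_group reduced_def)
    show ?thesis
    proof (cases b)
      case False
      have "inv\<^bsub>free_group A\<^esub> [(a, True)] = [(a, False)]"
        using inv_free_group[OF a] by (simp add: reduce_def)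
      then show ?thesis using Pair False h.hom_inv[OF a] by simp
    qed (use Pair in simp)
  qed
  have "reduced w" "w \<in> lists (A \<times> UNIV)" using w by (auto simp: carrier_free_group)
  then show ?thesis
  proof (induction w)
    case (Cons l w)
    then have red: "reduced w" by (auto dest: reduced_ConsD)
    have "[l] \<otimes>\<^bsub>free_group A\<^esub> w = l # w"
      using reduce_id[OF Cons.prems(1)] by simp
    moreover have "[l] \<in> carrier (free_group A)" "w \<in> carrier (free_group A)"
      using Cons.prems red by (auto simp: carrier_free_group reduced_def)
    ultimately have "h (l # w) = h [l] \<otimes>\<^bsub>G\<^esub> h w" by (metis h.hom_mult)
    then show ?case using Cons red letter by simp
  qed (use h.hom_one in simp)
qed

subsection \<open>Normal closures and quotients\<close>

lemma normal_closure_normal: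
  assumes "group G" "R \<subseteq> carrier G"
  shows "normal_closure G R \<lhd> G"
proof -
  interpret group G by fact
  \<comment> \<open>The family of normal subgroups containing \<open>R\<close> has a member, so its
    intersection is a subgroup and not the whole type.\<close>
  have G: "carrier G \<lhd> G" by (auto simp: normal_inv_iff subgroup_self)
  let ?F = "{H. H \<lhd> G \<and> R \<subseteq> H}"
  have "subgroup (\<Inter> ?F) G"
    using G assms(2) by (intro subgroups_Inter) (auto dest: normal_imp_subgroup)
  then show ?thesis
    unfolding normal_closure_def
  proof (subst normal_inv_iff, intro conjI ballI)
    show "x \<otimes>\<^bsub>G\<^esub> h \<otimes>\<^bsub>G\<^esub> inv\<^bsub>G\<^esub> x \<in> \<Inter> ?F" if "x \<in> carrier G" "h \<in> \<Inter> ?F" for x h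
    proof
      fix H assume H: "H \<in> ?F"
      then have "h \<in> H" using that(2) by blast
      then show "x \<otimes>\<^bsub>G\<^esub> h \<otimes>\<^bsub>G\<^esub> inv\<^bsub>G\<^esub> x \<in> H" using H that(1) by (simp add: normal_inv_iff)
    qed
  qed
qed

lemma normal_closure_incl: "R \<subseteq> normal_closure G R"
  by (auto simp: normal_closure_def)

lemma normal_closure_least: "H \<lhd> G \<Longrightarrow> R \<subseteq> H \<Longrightarrow> normal_closure G R \<subseteq> H"
  by (auto simp: normal_closure_def)

lemma normal_closure_mono: "R \<subseteq> R' \<Longrightarrow> normal_closure G R \<subseteq> normal_closure G R'"
  by (auto simp: normal_closure_def)

lemma (in group) inv_mult_cancel [simp]:
  assumes "x \<in> carrier G" "y \<in> carrier G"
  shows "inv x \<otimes> (x \<otimes> y) = y" "x \<otimes> (inv x \<otimes> y) = y"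
  using assms by (simp_all flip: m_assoc)

context normal begin

lemma rcos_eq_iff:
  assumes "x \<in> carrier G" "y \<in> carrier G"
  shows "H #> x = H #> y \<longleftrightarrow> x \<otimes> inv y \<in> H"
proof
  assume "H #> x = H #> y"
  then have "x \<in> H #> y" using rcos_self[OF assms(1) subgroup_axioms] by simp
  then show "x \<otimes> inv y \<in> H" using rcos_module_imp[OF is_group assms(2)] by simp
next
  assume "x \<otimes> inv y \<in> H"
  then have "x \<in> H #> y" using rcos_module_rev[OF is_group assms(2,1)] by simp
  then show "H #> x = H #> y" using repr_independence[OF _ assms(2) subgroup_axioms] by simp
qed

lemma rcos_eq_self_iff: "x \<in> carrier G \<Longrightarrow> H #> x = H \<longleftrightarrow> x \<in> H"
  using rcos_eq_iff[of x "\<one>"] by (simp add: subset)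

lemma rcosets_subset: "v \<in> rcosets H \<Longrightarrow> v \<subseteq> carrier G"
  by (rule rcosets_carrier[OF is_group])

lemma rcosets_act [simp]: "v \<in> rcosets H \<Longrightarrow> g \<in> carrier G \<Longrightarrow> v #> g \<in> rcosets H"
  using subset by (auto simp: RCOSETS_def coset_mult_assoc)

lemma rcosets_act_mult:
  "v \<in> rcosets H \<Longrightarrow> g \<in> carrier G \<Longrightarrow> h \<in> carrier G \<Longrightarrow> v #> g #> h = v #> (g \<otimes> h)"
  using rcosets_subset by (simp add: coset_mult_assoc)

lemma rcosets_act_one [simp]: "v \<in> rcosets H \<Longrightarrow> v #> \<one> = v"
  using rcosets_subset by simp

text \<open>The stabilizer of a coset is a conjugate of \<open>H\<close>, hence \<open>H\<close>
  itself. So whether a word closes up in the Cayley graph of the quotient does not depend on the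
  vertex where it starts.\<close>

lemma rcosets_stabilizer:
  assumes "v \<in> rcosets H" "g \<in> carrier G"
  shows "v #> g = v \<longleftrightarrow> g \<in> H"
proof -
  obtain h where h: "h \<in> carrier G" "v = H #> h" using assms(1) by (auto simp: RCOSETS_def)
  have "v #> g = v \<longleftrightarrow> H #> (h \<otimes> g) = H #> h" using h assms subset by (simp add: coset_mult_assoc)
  also have "\<dots> \<longleftrightarrow> h \<otimes> g \<otimes> inv h \<in> H" using h assms by (simp add: rcos_eq_iff)
  also have "\<dots> \<longleftrightarrow> g \<in> H"
  proof
    assume "h \<otimes> g \<otimes> inv h \<in> H"
    then have "inv h \<otimes> (h \<otimes> g \<otimes> inv h) \<otimes> h \<in> H" using h by (intro inv_op_closed1)
    then show "g \<in> H" using h assms by (simp add: m_assoc)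
  qed (use h inv_op_closed2 in simp)
  finally show ?thesis .
qed

end

section \<open>Path classes\<close>

abbreviation htp :: "(real \<Rightarrow> 'x::topological_space) \<Rightarrow> (real \<Rightarrow> 'x) \<Rightarrow> bool" where
  "htp \<equiv> homotopic_paths UNIV"

text \<open>The unit and inverse laws for paths are reparametrizations, and two paths in the unit
  interval with the same ends are homotopic since the interval is convex.\<close>

lemma homotopic_paths_compose_unit_interval:
  assumes p: "path p"
    and "path a" "path b" "path_image a \<subseteq> {0..1}" "path_image b \<subseteq> {0..1::real}"
    and "pathstart a = pathstart b" "pathfinish a = pathfinish b"
  shows "htp (p \<circ> a) (p \<circ> b)"
proof (rule homotopic_paths_continuous_image)
  have "simply_connected {0..1::real}" by (rule convex_imp_simply_connected) simp
  then show "homotopic_paths {0..1} a b"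
    using assms unfolding simply_connected_eq_homotopic_paths by metis
qed (use p in \<open>auto simp: path_def\<close>)

lemma htp_join_const:
  assumes "path p" "x = pathfinish p"
  shows "htp (p +++ (\<lambda>_. x)) p"
proof -
  have eq: "p +++ (\<lambda>_. x) = p \<circ> (linepath 0 1 +++ linepath 1 1)"
    using assms(2) by (auto simp: joinpaths_def linepath_def pathfinish_def fun_eq_iff)
  have "htp (p \<circ> (linepath 0 1 +++ linepath 1 1)) (p \<circ> linepath 0 1)"
    by (rule homotopic_paths_compose_unit_interval)
       (auto simp: assms path_image_join path_image_linepath closed_segment_eq_real_ivl)
  then show ?thesis by (simp add: eq linepath_def comp_def)
qed

lemma htp_const_join:
  assumes "path p" "x = pathstart p"
  shows "htp ((\<lambda>_. x) +++ p) p"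
proof -
  have eq: "(\<lambda>_. x) +++ p = p \<circ> (linepath 0 0 +++ linepath 0 1)"
    using assms(2) by (auto simp: joinpaths_def linepath_def pathstart_def fun_eq_iff)
  have "htp (p \<circ> (linepath 0 0 +++ linepath 0 1)) (p \<circ> linepath 0 1)"
    by (rule homotopic_paths_compose_unit_interval)
       (auto simp: assms path_image_join path_image_linepath closed_segment_eq_real_ivl)
  then show ?thesis by (simp add: eq linepath_def comp_def)
qed

lemma htp_join_reversepath:
  assumes "path p" "x = pathstart p"
  shows "htp (p +++ reversepath p) (\<lambda>_. x)"
proof -
  have eq: "p +++ reversepath p = p \<circ> (linepath 0 1 +++ linepath 1 0)"
    using assms(2) by (auto simp: joinpaths_def linepath_def reversepath_def fun_eq_iff)
  have "htp (p \<circ> (linepath 0 1 +++ linepath 1 0)) (p \<circ> linepath 0 0)"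
    by (rule homotopic_paths_compose_unit_interval)
       (auto simp: assms path_image_join path_image_linepath closed_segment_eq_real_ivl)
  then show ?thesis using assms(2) by (simp add: eq linepath_def comp_def pathstart_def)
qed

lemma path_const [simp]: "path (\<lambda>_. x)"
  by (simp add: path_def)

lemma pathstart_const [simp]: "pathstart (\<lambda>_. x) = x"
  and pathfinish_const [simp]: "pathfinish (\<lambda>_. x) = x"
  by (simp_all add: pathstart_def pathfinish_def)

lemma reversepath_const [simp]: "reversepath (\<lambda>_. x) = (\<lambda>_. x)"
  by (simp add: reversepath_def)

lemma comp_const [simp]: "h \<circ> (\<lambda>_. x) = (\<lambda>_. h x)"
  by auto

lemma mem_path_class: "\<delta> \<in> path_class \<gamma> \<longleftrightarrow> htp \<gamma> \<delta>"
  by (simp add: path_class_def)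

lemma path_class_eq: "htp \<gamma> \<delta> \<Longrightarrow> path_class \<gamma> = path_class \<delta>"
  unfolding path_class_def using homotopic_paths_sym homotopic_paths_trans by blast

lemma path_class_eq_iff: "path \<gamma> \<Longrightarrow> path_class \<gamma> = path_class \<delta> \<longleftrightarrow> htp \<gamma> \<delta>"
  by (metis homotopic_paths_refl mem_path_class path_class_eq subset_UNIV homotopic_paths_sym)

text \<open>Requiring the endpoints to match inside the definition makes the concatenation of
  arbitrary sets of paths associative, so that \<^const>\<open>path_class\<close> expressions can be normalized by
  rewriting.\<close>

definition class_join :: "(real \<Rightarrow> 'x::metric_space) set \<Rightarrow> (real \<Rightarrow> 'x) set \<Rightarrow> (real \<Rightarrow> 'x) set"
    (infixr "\<odot>" 75) where
  "C \<odot> D = (\<Union>\<gamma>\<in>C. \<Union>\<delta>\<in>{\<delta> \<in> D. pathfinish \<gamma> = pathstart \<delta>}. path_class (\<gamma> +++ \<delta>))"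

lemma mem_class_join:
  "\<eta> \<in> C \<odot> D \<longleftrightarrow> (\<exists>\<gamma>\<in>C. \<exists>\<delta>\<in>D. pathfinish \<gamma> = pathstart \<delta> \<and> htp (\<gamma> +++ \<delta>) \<eta>)"
  by (auto simp: class_join_def mem_path_class)

lemma class_joinI:
  "\<gamma> \<in> C \<Longrightarrow> \<delta> \<in> D \<Longrightarrow> pathfinish \<gamma> = pathstart \<delta> \<Longrightarrow> htp (\<gamma> +++ \<delta>) \<eta> \<Longrightarrow> \<eta> \<in> C \<odot> D"
  by (auto simp: mem_class_join)

lemma htp_ends:
  assumes "htp \<gamma> \<delta>"
  shows "path \<gamma>" "path \<delta>" "pathstart \<gamma> = pathstart \<delta>" "pathfinish \<gamma> = pathfinish \<delta>"
  using assms homotopic_paths_imp_path homotopic_paths_imp_pathstart homotopic_paths_imp_pathfinish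
  by auto

lemma htp_assoc:
  "path p \<Longrightarrow> path q \<Longrightarrow> path r \<Longrightarrow> pathfinish p = pathstart q \<Longrightarrow> pathfinish q = pathstart r \<Longrightarrow>
   htp (p +++ (q +++ r)) ((p +++ q) +++ r)"
  by (rule homotopic_paths_assoc) auto

lemma class_join_assoc [simp]: "(C \<odot> D) \<odot> E = C \<odot> (D \<odot> E)"
proof (intro Set.set_eqI iffI)
  fix \<eta> assume "\<eta> \<in> (C \<odot> D) \<odot> E"
  then obtain \<gamma> \<delta> \<zeta> \<epsilon> where *: "\<gamma> \<in> C" "\<delta> \<in> D" "pathfinish \<gamma> = pathstart \<delta>" "htp (\<gamma> +++ \<delta>) \<zeta>"
    "\<epsilon> \<in> E" "pathfinish \<zeta> = pathstart \<epsilon>" "htp (\<zeta> +++ \<epsilon>) \<eta>"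
    by (auto simp: mem_class_join)
  then have p: "path \<gamma>" "path \<delta>" "path \<epsilon>" "pathfinish \<delta> = pathstart \<epsilon>"
    using htp_ends[OF *(4)] htp_ends[OF *(7)] by auto
  have "htp ((\<gamma> +++ \<delta>) +++ \<epsilon>) (\<zeta> +++ \<epsilon>)"
    using * p by (intro homotopic_paths_join) auto
  then have "htp (\<gamma> +++ (\<delta> +++ \<epsilon>)) \<eta>"
    using htp_assoc[of \<gamma> \<delta> \<epsilon>] p * homotopic_paths_trans by meson
  moreover have "\<delta> +++ \<epsilon> \<in> D \<odot> E"
    using * p by - (rule class_joinI[of \<delta> _ \<epsilon>], auto)
  ultimately show "\<eta> \<in> C \<odot> (D \<odot> E)"
    using * by - (rule class_joinI[of \<gamma> _ "\<delta> +++ \<epsilon>"], auto)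
next
  fix \<eta> assume "\<eta> \<in> C \<odot> (D \<odot> E)"
  then obtain \<gamma> \<delta> \<zeta> \<epsilon> where *: "\<gamma> \<in> C" "\<delta> \<in> D" "\<epsilon> \<in> E" "pathfinish \<delta> = pathstart \<epsilon>" "htp (\<delta> +++ \<epsilon>) \<zeta>"
    "pathfinish \<gamma> = pathstart \<zeta>" "htp (\<gamma> +++ \<zeta>) \<eta>"
    by (auto simp: mem_class_join)
  then have p: "path \<gamma>" "path \<delta>" "path \<epsilon>" "pathfinish \<gamma> = pathstart \<delta>"
    using htp_ends[OF *(5)] htp_ends[OF *(7)] by auto
  have "htp (\<gamma> +++ (\<delta> +++ \<epsilon>)) (\<gamma> +++ \<zeta>)"
    using * p by (intro homotopic_paths_join) auto
  then have "htp ((\<gamma> +++ \<delta>) +++ \<epsilon>) \<eta>"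
    using homotopic_paths_sym[OF htp_assoc[of \<gamma> \<delta> \<epsilon>]] p * homotopic_paths_trans by meson
  moreover have "\<gamma> +++ \<delta> \<in> C \<odot> D"
    using * p by - (rule class_joinI[of \<gamma> _ \<delta>], auto)
  ultimately show "\<eta> \<in> (C \<odot> D) \<odot> E"
    using * by - (rule class_joinI[of "\<gamma> +++ \<delta>" _ \<epsilon>], auto)
qed

lemma path_class_join:
  fixes \<gamma> \<delta> :: "real \<Rightarrow> 'x::metric_space"
  assumes "path \<gamma>" "path \<delta>" "pathfinish \<gamma> = pathstart \<delta>"
  shows "path_class (\<gamma> +++ \<delta>) = path_class \<gamma> \<odot> path_class \<delta>"
proof (intro Set.set_eqI iffI)
  fix \<eta> assume "\<eta> \<in> path_class (\<gamma> +++ \<delta>)"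
  then show "\<eta> \<in> path_class \<gamma> \<odot> path_class \<delta>"
    using assms by (intro class_joinI[of \<gamma> _ \<delta>]) (auto simp: mem_path_class)
next
  fix \<eta> assume "\<eta> \<in> path_class \<gamma> \<odot> path_class \<delta>"
  then show "\<eta> \<in> path_class (\<gamma> +++ \<delta>)"
    using assms(3) by (auto simp: mem_class_join mem_path_class)
       (meson homotopic_paths_join homotopic_paths_trans)
qed

lemma class_const_right: "path p \<Longrightarrow> x = pathfinish p \<Longrightarrow> path_class p \<odot> path_class (\<lambda>_. x) = path_class p"
  by (metis htp_join_const path_class_eq path_class_join path_const pathstart_const)

lemma class_const_left: "path p \<Longrightarrow> x = pathstart p \<Longrightarrow> path_class (\<lambda>_. x) \<odot> path_class p = path_class p"
  by (metis htp_const_join path_class_eq path_class_join path_const pathfinish_const)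

text \<open>The variants with a trailing \<open>C\<close> are for rewriting:
  \<open>class_join_assoc\<close> nests products to the right, so a unit or an inverse pair is
  usually followed by further factors.\<close>

lemma class_const_left':
  "path p \<Longrightarrow> x = pathstart p \<Longrightarrow> path_class (\<lambda>_. x) \<odot> (path_class p \<odot> C) = path_class p \<odot> C"
  by (metis class_const_left class_join_assoc)

lemma class_const_right':
  "path p \<Longrightarrow> x = pathfinish p \<Longrightarrow> path_class p \<odot> (path_class (\<lambda>_. x) \<odot> C) = path_class p \<odot> C"
  by (metis class_const_right class_join_assoc)

lemma class_rinv:
  fixes p :: "real \<Rightarrow> 'x::metric_space"
  assumes "path p" shows "path_class p \<odot> path_class (reversepath p) = path_class (\<lambda>_. pathstart p)"
proof -
  have "path_class p \<odot> path_class (reversepath p) = path_class (p +++ reversepath p)"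
    using assms by (intro path_class_join[symmetric]) auto
  then show ?thesis using path_class_eq[OF htp_join_reversepath[OF assms refl]] by simp
qed

lemma class_linv:
  fixes p :: "real \<Rightarrow> 'x::metric_space"
  assumes "path p" shows "path_class (reversepath p) \<odot> path_class p = path_class (\<lambda>_. pathfinish p)"
  using class_rinv[of "reversepath p"] assms by simp

lemma class_rcancel:
  fixes p :: "real \<Rightarrow> 'x::metric_space"
  assumes "path p" "path q" "pathstart p = pathstart q"
  shows "path_class p \<odot> (path_class (reversepath p) \<odot> path_class q) = path_class q"
    and "path_class p \<odot> (path_class (reversepath p) \<odot> (path_class q \<odot> C)) = path_class q \<odot> C"
proof -
  show *: "path_class p \<odot> (path_class (reversepath p) \<odot> path_class q) = path_class q"
    using assms by (simp add: class_rinv class_const_left flip: class_join_assoc del: class_join_assoc)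
  show "path_class p \<odot> (path_class (reversepath p) \<odot> (path_class q \<odot> C)) = path_class q \<odot> C"
    by (subst (2) *[symmetric]) simp
qed

lemma class_lcancel:
  fixes p :: "real \<Rightarrow> 'x::metric_space"
  assumes "path p" "path q" "pathfinish p = pathstart q"
  shows "path_class (reversepath p) \<odot> (path_class p \<odot> path_class q) = path_class q"
    and "path_class (reversepath p) \<odot> (path_class p \<odot> (path_class q \<odot> C)) = path_class q \<odot> C"
  using class_rcancel[of "reversepath p" q] assms by auto

lemmas class_simps = path_class_join path_compose_join path_compose_reversepath
  class_const_left class_const_left' class_const_right class_const_right' class_rinv class_linv
  class_rcancel class_lcancel pathstart_compose pathfinish_compose reversepath_joinpaths

lemma path_class_compose_cong:
  fixes p :: "real \<Rightarrow> 'x::metric_space"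
  assumes "path_class p = path_class q" "path p" "continuous_on UNIV h"
  shows "path_class (h \<circ> p) = path_class (h \<circ> q)"
  using assms by (auto simp: path_class_eq_iff intro!: path_class_eq homotopic_paths_continuous_image)

lemma path_class_reverse_cong:
  assumes "path_class p = path_class q" "path p"
  shows "path_class (reversepath p) = path_class (reversepath q)"
  using assms by (auto simp: path_class_eq_iff intro!: path_class_eq simp: homotopic_paths_reversepath)

section \<open>The group of a warped system\<close>

locale warped =
  fixes S :: "('x::metric_space \<Rightarrow> 'x) set" and x0 :: 'x and \<alpha> :: "('x \<Rightarrow> 'x) \<Rightarrow> real \<Rightarrow> 'x"
  assumes ws: "warped_system S"
    and alpha: "\<And>s. s \<in> S \<Longrightarrow> path (\<alpha> s) \<and> pathstart (\<alpha> s) = x0 \<and> pathfinish (\<alpha> s) = s x0"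
begin

abbreviation words :: "('x \<Rightarrow> 'x) word set" where "words \<equiv> lists (S \<times> UNIV)"

abbreviation wp :: "('x \<Rightarrow> 'x) word \<Rightarrow> real \<Rightarrow> 'x" where "wp \<equiv> word_path x0 \<alpha>"

section \<open>The action of words on X and the paths from the base point to its images\<close>

lemma generator_homeomorphism:
  assumes "s \<in> S"
  shows "bij s" "continuous_on UNIV s" "continuous_on UNIV (inv_into UNIV s)"
proof -
  have "homeomorphic_map euclidean euclidean s"
    using ws assms by (auto simp: warped_system_def)
  then obtain g where g: "homeomorphic_maps euclidean euclidean s g"
    by (auto simp: homeomorphic_map_maps)
  then have "\<And>x. g (s x) = x" "\<And>y. s (g y) = y" "continuous_on UNIV s" "continuous_on UNIV g"
    by (auto simp: homeomorphic_maps_def)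
  moreover from this have "inv_into UNIV s = g" by (metis inv_equality)
  ultimately show "bij s" "continuous_on UNIV s" "continuous_on UNIV (inv_into UNIV s)"
    by (auto intro: o_bij[of g] simp: fun_eq_iff)
qed

lemma continuous_letter_act: "l \<in> S \<times> UNIV \<Longrightarrow> continuous_on UNIV (letter_act l)"
  using generator_homeomorphism by (cases l) auto

lemma continuous_word_act: "w \<in> words \<Longrightarrow> continuous_on UNIV (word_act w)"
proof (induction w)
  case (Cons l w)
  then have "continuous_on UNIV (word_act w)" "continuous_on UNIV (letter_act l)"
    by (simp_all add: continuous_letter_act)
  then show ?case
    unfolding word_act.simps by (intro continuous_on_compose) (auto intro: continuous_on_subset)
qed (simp add: id_def)

lemma letter_act_inv:
  "l \<in> S \<times> UNIV \<Longrightarrow> letter_act l (letter_act (letter_inv l) x) = x"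
  using generator_homeomorphism
  by (cases l) (auto simp: bij_is_surj surj_f_inv_f bij_is_inj)

lemma letter_act_inv':
  "l \<in> S \<times> UNIV \<Longrightarrow> letter_act (letter_inv l) (letter_act l x) = x"
  using letter_act_inv[of "letter_inv l"] by simp

lemma word_act_append: "word_act (u @ v) = word_act u \<circ> word_act v"
  by (induction u) auto

lemma word_act_reduce: "w \<in> words \<Longrightarrow> word_act (reduce w) = word_act w"
  by (rule reduce_invariant[where A = S])
     (auto simp: letter_act_inv fun_eq_iff simp del: letter_act.simps)

lemma word_act_inv: "w \<in> words \<Longrightarrow> word_act w (word_act (word_inv w) x) = x"
  using word_act_reduce[of "w @ word_inv w"] by (simp add: word_act_append fun_eq_iff)

lemma word_act_inv': "w \<in> words \<Longrightarrow> word_act (word_inv w) (word_act w x) = x"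
  using word_act_inv[of "word_inv w"] by simp

text \<open>The last identity is an equality of paths, not only of classes, because the path of an
  inverse letter is defined as a translate of the reversed path. It makes a cancelling pair of
  letters contribute a detour that is run back and forth.\<close>

lemma letter_path:
  assumes "l \<in> S \<times> UNIV"
  shows "path (letter_path \<alpha> l)" "pathstart (letter_path \<alpha> l) = x0"
    "pathfinish (letter_path \<alpha> l) = letter_act l x0"
    "letter_act l \<circ> letter_path \<alpha> (letter_inv l) = reversepath (letter_path \<alpha> l)"
proof -
  obtain s b where l: "l = (s, b)" "s \<in> S" using assms by (cases l) auto
  note s = generator_homeomorphism[OF l(2)] and a = alpha[OF l(2)]
  have "path (inv_into UNIV s \<circ> reversepath (\<alpha> s))"
    using s a by (intro path_continuous_image) (auto intro: continuous_on_subset)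
  moreover have "inv_into UNIV s (s x) = x" "s (inv_into UNIV s x) = x" for x
    using s(1) by (simp_all add: bij_is_inj bij_is_surj surj_f_inv_f)
  ultimately show "path (letter_path \<alpha> l)" "pathstart (letter_path \<alpha> l) = x0"
    "pathfinish (letter_path \<alpha> l) = letter_act l x0"
    "letter_act l \<circ> letter_path \<alpha> (letter_inv l) = reversepath (letter_path \<alpha> l)"
    using a l(1) by (auto simp: pathstart_def pathfinish_def fun_eq_iff reversepath_def)
qed

lemma path_letter_act: "l \<in> S \<times> UNIV \<Longrightarrow> path p \<Longrightarrow> path (letter_act l \<circ> p)"
  by (intro path_continuous_image continuous_on_subset[OF continuous_letter_act]) auto

lemma path_word_act: "w \<in> words \<Longrightarrow> path p \<Longrightarrow> path (word_act w \<circ> p)"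
  by (intro path_continuous_image continuous_on_subset[OF continuous_word_act]) auto

lemma word_path:
  assumes "w \<in> words"
  shows "path (wp w)" "pathstart (wp w) = x0" "pathfinish (wp w) = word_act w x0"
proof -
  have "path (wp w) \<and> pathstart (wp w) = x0 \<and> pathfinish (wp w) = word_act w x0"
    using assms
  proof (induction w)
    case (Cons l w)
    then show ?case
      by (auto simp: letter_path pathstart_compose pathfinish_compose path_letter_act
          simp del: letter_path.simps letter_act.simps)
  qed auto
  then show "path (wp w)" "pathstart (wp w) = x0" "pathfinish (wp w) = word_act w x0" by auto
qed

lemma word_path_append:
  "u \<in> words \<Longrightarrow> v \<in> words \<Longrightarrow> path_class (wp (u @ v)) = path_class (wp u) \<odot> path_class (word_act u \<circ> wp v)"
proof (induction u)
  case Nil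
  then show ?case using word_path by (simp add: class_const_left)
next
  case (Cons l u)
  then have l: "l \<in> S \<times> UNIV" and u: "u \<in> words" and uv: "u @ v \<in> words" by auto
  have *: "htp (wp (u @ v)) (wp u +++ (word_act u \<circ> wp v))"
  proof (subst path_class_eq_iff[symmetric])
    show "path_class (wp (u @ v)) = path_class (wp u +++ (word_act u \<circ> wp v))"
      using Cons.IH[OF u Cons.prems(2)] word_path[OF u] word_path[OF Cons.prems(2)]
        path_word_act[OF u, of "wp v"]
      by (subst path_class_join) (simp_all only: pathstart_compose)
  qed (use word_path uv in simp)
  have "path_class (letter_act l \<circ> wp (u @ v)) = path_class (letter_act l \<circ> (wp u +++ (word_act u \<circ> wp v)))"
    using continuous_letter_act[OF l]
    by (intro path_class_eq homotopic_paths_continuous_image[OF *]) auto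
  then show ?case
    using l u uv Cons.prems letter_path word_path path_word_act path_letter_act
    by (simp add: class_simps comp_assoc del: letter_path.simps letter_act.simps; simp add: comp_def)
qed

text \<open>A cancelling pair inserts the path of a letter followed by its own reverse, which is
  null-homotopic. So the class of \<open>wp w\<close> belongs to the element of the free
  group.\<close>

lemma word_path_reduce:
  assumes "w \<in> words"
  shows "path_class (wp (reduce w)) = path_class (wp w)"
proof -
  let ?f = "\<lambda>w. if w \<in> words then path_class (wp w) else {}"
  have "?f (reduce w) = ?f w"
  proof (rule reduce_invariant[where A = S])
    fix l :: "('x \<Rightarrow> 'x) \<times> bool" and w assume l: "l \<in> S \<times> UNIV" and w: "w \<in> words"
    have "letter_act l \<circ> (letter_act (letter_inv l) \<circ> wp w) = wp w"
      using letter_act_inv[OF l] by (auto simp: fun_eq_iff)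
    then show "?f (l # letter_inv l # w) = ?f w"
      using l w letter_path[OF l] letter_path(1)[of "letter_inv l"] letter_path(2,3)[of "letter_inv l"]
        word_path[OF w] path_letter_act
      by (simp add: class_simps letter_act_inv letter_path(4)[OF l]
            del: letter_path.simps letter_act.simps letter_inv.simps)
  next
    fix l :: "('x \<Rightarrow> 'x) \<times> bool" and u v assume *: "l \<in> S \<times> UNIV" "u \<in> words" "v \<in> words" "?f u = ?f v"
    then have "path_class (letter_act l \<circ> wp u) = path_class (letter_act l \<circ> wp v)"
      by (intro path_class_compose_cong) (auto intro: word_path continuous_letter_act)
    then show "?f (l # u) = ?f (l # v)"
      using * letter_path word_path path_letter_act
      by (simp add: class_simps del: letter_path.simps letter_act.simps)
  qed (use assms in auto)
  then show ?thesis using assms by (simp add: reduce_lists)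
qed


text \<open>Modulo homotopy and reduction, the pairs \<open>(\<gamma>, w)\<close> with \<open>\<gamma>\<close> a path from \<open>x\<close> to \<open>w y\<close> are
  the morphisms from \<open>x\<close> to \<open>y\<close> of a groupoid with composition \<open>(\<gamma>, w) (\<delta>, v) = (\<gamma> \<cdot> w \<delta>, w
  v)\<close>. Its vertex group at \<open>x\<^sub>0\<close> is the semidirect product, via \<open>(\<gamma>, w) \<mapsto> ([\<gamma> \<alpha>\<^sub>w\<^sup>*], w)\<close>.\<close>

definition mor :: "'x \<Rightarrow> ('x \<Rightarrow> 'x) word \<Rightarrow> 'x \<Rightarrow> (real \<Rightarrow> 'x) \<Rightarrow> bool" where
  "mor x w y \<gamma> \<longleftrightarrow> path \<gamma> \<and> pathstart \<gamma> = x \<and> pathfinish \<gamma> = word_act w y \<and> w \<in> words"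

definition vertex_elem :: "(real \<Rightarrow> 'x) \<Rightarrow> ('x \<Rightarrow> 'x) word \<Rightarrow> (real \<Rightarrow> 'x) set \<times> ('x \<Rightarrow> 'x) word" where
  "vertex_elem \<gamma> w = (path_class \<gamma> \<odot> path_class (reversepath (wp w)), reduce w)"

abbreviation \<Gamma> where "\<Gamma> \<equiv> pi1_semidirect S x0 \<alpha>"

lemma morD: "mor x w y \<gamma> \<Longrightarrow> path \<gamma>" "mor x w y \<gamma> \<Longrightarrow> pathstart \<gamma> = x"
  "mor x w y \<gamma> \<Longrightarrow> pathfinish \<gamma> = word_act w y" "mor x w y \<gamma> \<Longrightarrow> w \<in> words"
  by (auto simp: mor_def)

lemma mor_comp: "mor x w y \<gamma> \<Longrightarrow> mor y v z \<delta> \<Longrightarrow> mor x (w @ v) z (\<gamma> +++ (word_act w \<circ> \<delta>))"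
  by (simp add: mor_def path_word_act pathstart_compose pathfinish_compose word_act_append)

text \<open>The tail \<open>reversepath (wp w)\<close> can be cancelled again, because its class is
  determined by \<open>reduce w\<close>. Hence nothing beyond homotopy and reduction is
  lost.\<close>

lemma vertex_elem_eq_iff:
  assumes "mor x0 w x0 \<gamma>" "mor x0 v x0 \<delta>"
  shows "vertex_elem \<gamma> w = vertex_elem \<delta> v \<longleftrightarrow> path_class \<gamma> = path_class \<delta> \<and> reduce w = reduce v"
proof -
  note m = morD[OF assms(1)] morD[OF assms(2)]
  have eq: "path_class (wp w) = path_class (wp v)"
    "path_class (reversepath (wp w)) = path_class (reversepath (wp v))" if "reduce w = reduce v"
  proof -
    show *: "path_class (wp w) = path_class (wp v)"
      using that word_path_reduce[OF m(4)] word_path_reduce[OF m(8)] by simp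
    show "path_class (reversepath (wp w)) = path_class (reversepath (wp v))"
      using path_class_reverse_cong[OF *] m word_path by auto
  qed
  show ?thesis
  proof
    assume *: "vertex_elem \<gamma> w = vertex_elem \<delta> v"
    then have red: "reduce w = reduce v" by (simp add: vertex_elem_def)
    from * have "(path_class \<gamma> \<odot> path_class (reversepath (wp w))) \<odot> path_class (wp w) =
      (path_class \<delta> \<odot> path_class (reversepath (wp v))) \<odot> path_class (wp v)"
      using eq(1)[OF red] by (simp add: vertex_elem_def del: class_join_assoc)
    then show "path_class \<gamma> = path_class \<delta> \<and> reduce w = reduce v"
      using m word_path red by (simp add: class_simps)
  qed (use eq in \<open>simp add: vertex_elem_def\<close>)
qed

section \<open>The semidirect product as a vertex group\<close>

lemma carrier_fundamental_group:
  "C \<in> carrier (fundamental_group x0) \<longleftrightarrow>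
   (\<exists>\<gamma>. C = path_class \<gamma> \<and> path \<gamma> \<and> pathstart \<gamma> = x0 \<and> pathfinish \<gamma> = x0)"
  by (auto simp: fundamental_group_def loops_at_def)

lemma carrier_pi1_semidirect:
  "carrier \<Gamma> = {(C, w). C \<in> carrier (fundamental_group x0) \<and> w \<in> carrier (free_group S)}"
  by (auto simp: pi1_semidirect_def semidirect_product_def)

lemma vertex_elem_in_carrier: 
  assumes "mor x0 w x0 \<gamma>" shows "vertex_elem \<gamma> w \<in> carrier \<Gamma>"
proof -
  have "path_class \<gamma> \<odot> path_class (reversepath (wp w)) = path_class (\<gamma> +++ reversepath (wp w))"
    using assms word_path[of w] by (simp add: mor_def class_simps)
  then show ?thesis
    using assms word_path[of w]
    by (auto simp: mor_def carrier_pi1_semidirect carrier_fundamental_group vertex_elem_def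
        intro!: exI[of _ "\<gamma> +++ reversepath (wp w)"])
qed

text \<open>A loop with a word \<open>w\<close> comes from the loop prolonged by
  \<open>wp w\<close>, whose tail then cancels.\<close>

lemma vertex_elem_surj:
  assumes "g \<in> carrier \<Gamma>"
  obtains \<gamma> w where "mor x0 w x0 \<gamma>" "g = vertex_elem \<gamma> w"
proof -
  obtain \<gamma> w where g: "g = (path_class \<gamma>, w)" "path \<gamma>" "pathstart \<gamma> = x0" "pathfinish \<gamma> = x0"
    "w \<in> carrier (free_group S)"
    using assms by (auto simp: carrier_pi1_semidirect carrier_fundamental_group)
  then have w: "w \<in> words" "reduce w = w" by (auto simp: carrier_free_group reduce_id)
  have "path_class (\<gamma> +++ wp w) \<odot> path_class (reversepath (wp w)) = path_class \<gamma>"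
    using g w word_path[of w] by (simp add: class_simps)
  then show ?thesis
    using g w word_path[of w]
    by (intro that[of w "\<gamma> +++ wp w"]) (auto simp: mor_def vertex_elem_def)
qed

text \<open>The product in \<open>fundamental_group\<close> joins arbitrary representatives,
  \<open>class_join\<close> only composable ones. For loops at \<open>x0\<close> every pair is
  composable, since homotopic paths share their ends.\<close>

lemma fundamental_group_mult:
  assumes "path \<gamma>" "pathstart \<gamma> = x0" "pathfinish \<gamma> = x0" "path \<delta>" "pathstart \<delta> = x0" "pathfinish \<delta> = x0"
  shows "path_class \<gamma> \<otimes>\<^bsub>fundamental_group x0\<^esub> path_class \<delta> = path_class \<gamma> \<odot> path_class \<delta>"
proof -
  have "path_class \<gamma> \<otimes>\<^bsub>fundamental_group x0\<^esub> path_class \<delta> =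
    (\<Union>\<gamma>'\<in>path_class \<gamma>. \<Union>\<delta>'\<in>path_class \<delta>. path_class (\<gamma>' +++ \<delta>'))"
    by (simp add: fundamental_group_def)
  also have "\<dots> = path_class \<gamma> \<odot> path_class \<delta>"
  proof -
    have "{\<delta>' \<in> path_class \<delta>. pathfinish \<gamma>' = pathstart \<delta>'} = path_class \<delta>" if "\<gamma>' \<in> path_class \<gamma>" for \<gamma>'
    proof -
      have 1: "pathfinish \<gamma>' = x0" using that assms(3) htp_ends(4)[of \<gamma> \<gamma>'] by (simp add: mem_path_class)
      have 2: "pathstart \<delta>' = x0" if "\<delta>' \<in> path_class \<delta>" for \<delta>'
        using that assms(5) htp_ends(3)[of \<delta> \<delta>'] by (simp add: mem_path_class)
      show ?thesis by (intro subset_antisym subsetI) (simp_all add: 1 2)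
    qed
    note * = this
    show ?thesis
      unfolding class_join_def by (rule SUP_cong[OF refl], subst *) (assumption, rule refl)
  qed
  finally show ?thesis .
qed

lemma word_aut_class:
  assumes w: "w \<in> words" and "path \<gamma>" "pathstart \<gamma> = x0" "pathfinish \<gamma> = x0"
  shows "word_aut x0 \<alpha> w (path_class \<gamma>) =
    path_class (wp w) \<odot> path_class (word_act w \<circ> \<gamma>) \<odot> path_class (reversepath (wp w))"
proof -
  have "path_class (wp w +++ ((word_act w \<circ> \<gamma>') +++ reversepath (wp w))) =
    path_class (wp w) \<odot> path_class (word_act w \<circ> \<gamma>) \<odot> path_class (reversepath (wp w))" (is "?A \<gamma>' = ?B")
    if "htp \<gamma> \<gamma>'" for \<gamma>'
  proof -
    have "path_class (word_act w \<circ> \<gamma>') = path_class (word_act w \<circ> \<gamma>)"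
      using that assms path_class_eq[OF that] htp_ends[OF that]
      by (intro path_class_compose_cong continuous_word_act) auto
    then show ?thesis
      using word_path[OF w] assms htp_ends[OF that] path_word_act[OF w]
      by (simp add: class_simps)
  qed
  moreover have "\<gamma> \<in> path_class \<gamma>" using assms by (simp add: mem_path_class)
  ultimately show ?thesis
    unfolding word_aut_def by (intro SUP_eq_const) (blast, simp add: mem_path_class)
qed

text \<open>The leading \<open>wp w\<close> produced by \<open>word_aut\<close> cancels against the
  tail of the first factor, which leaves \<gamma> followed by the translate of \<delta>. By
  \<open>word_path_append\<close> the remaining tails combine to the tail of
  \<open>w @ v\<close>.\<close>

lemma vertex_elem_mult:
  assumes "mor x0 w x0 \<gamma>" "mor x0 v x0 \<delta>"
  shows "vertex_elem \<gamma> w \<otimes>\<^bsub>\<Gamma>\<^esub> vertex_elem \<delta> v = vertex_elem (\<gamma> +++ (word_act w \<circ> \<delta>)) (w @ v)"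
proof -
  note m = morD[OF assms(1)] morD[OF assms(2)]
  note w = word_path[OF m(4)] and v = word_path[OF m(8)]
  have rw: "reduce w \<in> words" by (simp add: reduce_lists m)
  note rwp = word_path[OF rw]
  define \<gamma>' where "\<gamma>' = \<gamma> +++ reversepath (wp w)"
  define \<delta>' where "\<delta>' = \<delta> +++ reversepath (wp v)"
  have \<gamma>': "path \<gamma>'" "pathstart \<gamma>' = x0" "pathfinish \<gamma>' = x0" "vertex_elem \<gamma> w = (path_class \<gamma>', reduce w)"
    using m w by (simp_all add: \<gamma>'_def vertex_elem_def class_simps)
  have \<delta>': "path \<delta>'" "pathstart \<delta>' = x0" "pathfinish \<delta>' = x0" "vertex_elem \<delta> v = (path_class \<delta>', reduce v)"
    using m v by (simp_all add: \<delta>'_def vertex_elem_def class_simps)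
  have red: "path_class (wp (reduce w)) = path_class (wp w)"
    "path_class (reversepath (wp (reduce w))) = path_class (reversepath (wp w))"
    "word_act (reduce w) = word_act w"
    using word_path_reduce[OF m(4)] path_class_reverse_cong[OF word_path_reduce[OF m(4)]] rwp
      word_act_reduce[OF m(4)] by auto
  let ?\<epsilon> = "wp w +++ (word_act w \<circ> \<delta>') +++ reversepath (wp w)"
  have aut: "word_aut x0 \<alpha> (reduce w) (path_class \<delta>') = path_class ?\<epsilon>"
    using word_aut_class[OF rw \<delta>'(1-3)] red w \<delta>' path_word_act[OF m(4)]
    by (simp add: class_simps)
  have "vertex_elem \<gamma> w \<otimes>\<^bsub>\<Gamma>\<^esub> vertex_elem \<delta> v = (path_class \<gamma>' \<odot> path_class ?\<epsilon>, reduce (w @ v))"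
    unfolding \<gamma>'(4) \<delta>'(4)
    using \<gamma>' \<delta>' w m path_word_act[OF m(4)]
    by (simp add: pi1_semidirect_def semidirect_product_def aut fundamental_group_mult
        pathstart_compose pathfinish_compose)
  moreover have "path_class (reversepath (wp (w @ v))) =
    path_class (word_act w \<circ> reversepath (wp v)) \<odot> path_class (reversepath (wp w))"
  proof -
    have "path_class (wp (w @ v)) = path_class (wp w +++ (word_act w \<circ> wp v))"
      using m w v path_word_act[OF m(4)] by (simp add: word_path_append class_simps)
    from path_class_reverse_cong[OF this] show ?thesis
      using m w v path_word_act[OF m(4)] word_path[of "w @ v"] by (simp add: class_simps)
  qed
  ultimately show ?thesis
    unfolding vertex_elem_def
    using \<gamma>' \<delta>' w v m path_word_act[OF m(4)] unfolding \<gamma>'_def \<delta>'_def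
    by (simp add: class_simps)
qed

lemma one_pi1_semidirect: "\<one>\<^bsub>\<Gamma>\<^esub> = vertex_elem (\<lambda>_. x0) []"
  by (simp add: pi1_semidirect_def semidirect_product_def vertex_elem_def fundamental_group_def class_simps)

lemma mor_const [simp]: "mor x [] x (\<lambda>_. x)"
  by (simp add: mor_def)

lemma mor_inv: "mor x w y \<gamma> \<Longrightarrow> mor y (word_inv w) x (word_act (word_inv w) \<circ> reversepath \<gamma>)"
  by (simp add: mor_def path_word_act pathstart_compose pathfinish_compose word_act_inv')

text \<open>The axioms are checked on groupoid representatives, where they reduce to the laws of
  paths and words.\<close>

lemma group_pi1_semidirect: "group \<Gamma>"
proof (rule groupI)
  fix g h assume "g \<in> carrier \<Gamma>" "h \<in> carrier \<Gamma>"
  then show "g \<otimes>\<^bsub>\<Gamma>\<^esub> h \<in> carrier \<Gamma>"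
    by (elim vertex_elem_surj) (auto simp: vertex_elem_mult intro: vertex_elem_in_carrier mor_comp)
next
  show "\<one>\<^bsub>\<Gamma>\<^esub> \<in> carrier \<Gamma>" by (simp add: one_pi1_semidirect vertex_elem_in_carrier)
next
  fix g h k assume "g \<in> carrier \<Gamma>" "h \<in> carrier \<Gamma>" "k \<in> carrier \<Gamma>"
  then obtain \<gamma> u \<delta> v \<epsilon> w where *: "mor x0 u x0 \<gamma>" "mor x0 v x0 \<delta>" "mor x0 w x0 \<epsilon>"
    and [simp]: "g = vertex_elem \<gamma> u" "h = vertex_elem \<delta> v" "k = vertex_elem \<epsilon> w"
    by (elim vertex_elem_surj) blast
  have "path_class ((\<gamma> +++ (word_act u \<circ> \<delta>)) +++ (word_act (u @ v) \<circ> \<epsilon>)) =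
    path_class (\<gamma> +++ (word_act u \<circ> (\<delta> +++ (word_act v \<circ> \<epsilon>))))"
    using morD[OF *(1)] morD[OF *(2)] morD[OF *(3)] path_word_act
    by (simp add: class_simps word_act_append comp_assoc)
  then show "g \<otimes>\<^bsub>\<Gamma>\<^esub> h \<otimes>\<^bsub>\<Gamma>\<^esub> k = g \<otimes>\<^bsub>\<Gamma>\<^esub> (h \<otimes>\<^bsub>\<Gamma>\<^esub> k)"
    using * mor_comp[OF *(1,2)] mor_comp[OF *(2,3)]
      mor_comp[OF mor_comp[OF *(1,2)] *(3)] mor_comp[OF *(1) mor_comp[OF *(2,3)]]
    by (simp add: vertex_elem_mult vertex_elem_eq_iff)
next
  fix g assume "g \<in> carrier \<Gamma>"
  then obtain \<gamma> w where *: "mor x0 w x0 \<gamma>" and [simp]: "g = vertex_elem \<gamma> w" by (elim vertex_elem_surj)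
  note m = morD[OF *]
  have "path_class ((\<lambda>_. x0) +++ (word_act [] \<circ> \<gamma>)) = path_class \<gamma>"
    using m by (simp add: class_simps)
  then show "\<one>\<^bsub>\<Gamma>\<^esub> \<otimes>\<^bsub>\<Gamma>\<^esub> g = g"
    using * mor_comp[OF mor_const *] by (simp add: one_pi1_semidirect vertex_elem_mult vertex_elem_eq_iff)
  let ?\<delta> = "word_act (word_inv w) \<circ> reversepath \<gamma>"
  have \<delta>: "mor x0 (word_inv w) x0 ?\<delta>" by (rule mor_inv) fact
  have "path_class (?\<delta> +++ (word_act (word_inv w) \<circ> \<gamma>))
    = path_class (word_act (word_inv w) \<circ> (reversepath \<gamma> +++ \<gamma>))"
    by (simp add: path_compose_join)
  also have "\<dots> = path_class (word_act (word_inv w) \<circ> (\<lambda>_. word_act w x0))"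
    using m by (intro path_class_compose_cong continuous_word_act) (auto simp: class_simps)
  also have "\<dots> = path_class (\<lambda>_. x0)" by (simp add: word_act_inv' m)
  finally have "vertex_elem ?\<delta> (word_inv w) \<otimes>\<^bsub>\<Gamma>\<^esub> g = \<one>\<^bsub>\<Gamma>\<^esub>"
    using * \<delta> mor_comp[OF \<delta> *] by (simp add: one_pi1_semidirect vertex_elem_mult vertex_elem_eq_iff)
  then show "\<exists>h\<in>carrier \<Gamma>. h \<otimes>\<^bsub>\<Gamma>\<^esub> g = \<one>\<^bsub>\<Gamma>\<^esub>"
    using vertex_elem_in_carrier[OF \<delta>] by blast
qed

end

context warped begin

interpretation G: group \<Gamma> by (rule group_pi1_semidirect)

text \<open>A choice of paths from \<open>x\<^sub>0\<close> turns the groupoid into the group \<open>\<Gamma>\<close>.\<close>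

definition base_path :: "'x \<Rightarrow> real \<Rightarrow> 'x" where
  "base_path x = (if x = x0 then (\<lambda>_. x0) else SOME p. path p \<and> pathstart p = x0 \<and> pathfinish p = x)"

lemma base_path:
  "path (base_path x)" "pathstart (base_path x) = x0" "pathfinish (base_path x) = x"
proof -
  have "\<exists>p. path p \<and> pathstart p = x0 \<and> pathfinish p = x"
    using ws by (auto simp: warped_system_def path_connected_def)
  from someI_ex[OF this]
  show "path (base_path x)" "pathstart (base_path x) = x0" "pathfinish (base_path x) = x"
    by (auto simp: base_path_def)
qed

definition elem :: "(real \<Rightarrow> 'x) \<Rightarrow> ('x \<Rightarrow> 'x) word \<Rightarrow> 'x \<Rightarrow> (real \<Rightarrow> 'x) set \<times> ('x \<Rightarrow> 'x) word" where
  "elem \<gamma> w y =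
     vertex_elem (base_path (pathstart \<gamma>) +++ (\<gamma> +++ (word_act w \<circ> reversepath (base_path y)))) w"

lemma mor_elem:
  "mor x w y \<gamma> \<Longrightarrow>
   mor x0 w x0 (base_path (pathstart \<gamma>) +++ (\<gamma> +++ (word_act w \<circ> reversepath (base_path y))))"
  using base_path path_word_act by (simp add: mor_def pathstart_compose pathfinish_compose)

lemma elem_closed [simp]: "mor x w y \<gamma> \<Longrightarrow> elem \<gamma> w y \<in> carrier \<Gamma>"
  unfolding elem_def by (intro vertex_elem_in_carrier mor_elem)

text \<open>The base path to the middle object \<open>y\<close> is run back at the end of the first
  factor and forth at the start of the second, both times translated by \<open>w\<close>. So
  \<open>elem\<close> is a functor from the groupoid to the group.\<close>

lemma elem_mult:
  assumes "mor x w y \<gamma>" "mor y v z \<delta>"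
  shows "elem \<gamma> w y \<otimes>\<^bsub>\<Gamma>\<^esub> elem \<delta> v z = elem (\<gamma> +++ (word_act w \<circ> \<delta>)) (w @ v) z"
proof -
  note m = morD[OF assms(1)] morD[OF assms(2)] 
  note c = mor_comp[OF assms]
  have [simp]: "pathstart (\<gamma> +++ (word_act w \<circ> \<delta>)) = pathstart \<gamma>" by simp
  note E = mor_elem[OF assms(1)] mor_elem[OF assms(2)]
  show ?thesis
    unfolding elem_def vertex_elem_mult[OF E]
    using m base_path path_word_act
    by (subst vertex_elem_eq_iff[OF mor_comp[OF E] mor_elem[OF c]])
       (simp add: class_simps word_act_append comp_assoc)
qed

lemma elem_const [simp]: "elem (\<lambda>_. x) [] x = \<one>\<^bsub>\<Gamma>\<^esub>"
proof -
  have E: "mor x0 [] x0 (base_path x +++ ((\<lambda>_. x) +++ (word_act [] \<circ> reversepath (base_path x))))"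
    using mor_elem[OF mor_const[of x]] by simp
  show ?thesis
    unfolding elem_def one_pi1_semidirect using E base_path
    by (simp add: vertex_elem_eq_iff) (simp add: class_simps)
qed

lemma elem_cong:
  assumes "mor x w y \<gamma>" "mor x v y \<delta>" "path_class \<gamma> = path_class \<delta>" "reduce w = reduce v"
  shows "elem \<gamma> w y = elem \<delta> v y"
proof -
  note m = morD[OF assms(1)] morD[OF assms(2)]
  have "word_act w = word_act v" using assms word_act_reduce m by metis
  then show ?thesis
    unfolding elem_def using m assms base_path path_word_act
    by (subst vertex_elem_eq_iff[OF mor_elem[OF assms(1)] mor_elem[OF assms(2)]])
       (simp add: class_simps)
qed

lemma elem_inv:
  assumes "mor x w y \<gamma>"
  shows "inv\<^bsub>\<Gamma>\<^esub> elem \<gamma> w y = elem (word_act (word_inv w) \<circ> reversepath \<gamma>) (word_inv w) x"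
proof (rule G.inv_equality)
  note m = morD[OF assms]
  note i = mor_inv[OF assms]
  let ?\<delta> = "word_act (word_inv w) \<circ> reversepath \<gamma>"
  have "path_class (?\<delta> +++ (word_act (word_inv w) \<circ> \<gamma>))
    = path_class (word_act (word_inv w) \<circ> (reversepath \<gamma> +++ \<gamma>))"
    by (simp add: path_compose_join)
  also have "\<dots> = path_class (word_act (word_inv w) \<circ> (\<lambda>_. word_act w y))"
    using m by (intro path_class_compose_cong continuous_word_act) (auto simp: class_simps)
  also have "\<dots> = path_class (\<lambda>_. y)" by (simp add: word_act_inv' m)
  finally have "elem (?\<delta> +++ (word_act (word_inv w) \<circ> \<gamma>)) (word_inv w @ w) y = elem (\<lambda>_. y) [] y"
    using mor_comp[OF i assms] by (intro elem_cong[of y]) auto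
  then show "elem ?\<delta> (word_inv w) x \<otimes>\<^bsub>\<Gamma>\<^esub> elem \<gamma> w y = \<one>\<^bsub>\<Gamma>\<^esub>"
    by (simp add: elem_mult[OF i assms])
qed (use mor_inv[OF assms] assms in auto)

text \<open>This is why \<open>base_path x0\<close> is defined to be constant instead of being
  chosen.\<close>

lemma elem_base:
  assumes "mor x0 w x0 \<gamma>" shows "elem \<gamma> w x0 = vertex_elem \<gamma> w"
proof -
  have "base_path x0 = (\<lambda>_. x0)" by (simp add: base_path_def)
  then show ?thesis
    unfolding elem_def using morD[OF assms] mor_elem[OF assms] assms
    by (subst vertex_elem_eq_iff) (auto simp: class_simps)
qed

text \<open>Note the direction: \<open>jump_elem l y\<close> is a morphism from \<open>l y\<close> to \<open>y\<close>.\<close>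

definition path_elem :: "(real \<Rightarrow> 'x) \<Rightarrow> (real \<Rightarrow> 'x) set \<times> ('x \<Rightarrow> 'x) word" where
  "path_elem \<gamma> = elem \<gamma> [] (pathfinish \<gamma>)"

definition jump_elem :: "('x \<Rightarrow> 'x) \<times> bool \<Rightarrow> 'x \<Rightarrow> (real \<Rightarrow> 'x) set \<times> ('x \<Rightarrow> 'x) word" where
  "jump_elem l y = elem (\<lambda>_. letter_act l y) [l] y"

lemma mor_path: "path \<gamma> \<Longrightarrow> mor (pathstart \<gamma>) [] (pathfinish \<gamma>) \<gamma>"
  by (simp add: mor_def)

lemma mor_jump: "l \<in> S \<times> UNIV \<Longrightarrow> mor (letter_act l y) [l] y (\<lambda>_. letter_act l y)"
  by (simp add: mor_def)

lemma path_elem_closed [simp]: "path \<gamma> \<Longrightarrow> path_elem \<gamma> \<in> carrier \<Gamma>"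
  unfolding path_elem_def by (rule elem_closed[OF mor_path])

lemma jump_elem_closed [simp]: "l \<in> S \<times> UNIV \<Longrightarrow> jump_elem l y \<in> carrier \<Gamma>"
  unfolding jump_elem_def by (rule elem_closed[OF mor_jump])

lemma path_elem_join:
  "path \<gamma> \<Longrightarrow> path \<delta> \<Longrightarrow> pathfinish \<gamma> = pathstart \<delta> \<Longrightarrow>
   path_elem (\<gamma> +++ \<delta>) = path_elem \<gamma> \<otimes>\<^bsub>\<Gamma>\<^esub> path_elem \<delta>"
  unfolding path_elem_def using elem_mult[of "pathstart \<gamma>" "[]" "pathfinish \<gamma>" \<gamma> "[]" "pathfinish \<delta>" \<delta>]
  by (simp add: mor_def)

lemma path_elem_const [simp]: "path_elem (\<lambda>_. x) = \<one>\<^bsub>\<Gamma>\<^esub>"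
  by (simp add: path_elem_def)

lemma path_elem_htp: "htp \<gamma> \<delta> \<Longrightarrow> path_elem \<gamma> = path_elem \<delta>"
  unfolding path_elem_def using htp_ends[of \<gamma> \<delta>] path_class_eq[of \<gamma> \<delta>]
  by (auto intro!: elem_cong[of "pathstart \<gamma>"] simp: mor_def)

lemma path_elem_reversepath: "path \<gamma> \<Longrightarrow> path_elem (reversepath \<gamma>) = inv\<^bsub>\<Gamma>\<^esub> path_elem \<gamma>"
  using elem_inv[OF mor_path, of \<gamma>] by (simp add: path_elem_def)

lemma jump_elem_inv:
  assumes "l \<in> S \<times> UNIV"
  shows "inv\<^bsub>\<Gamma>\<^esub> jump_elem l y = jump_elem (letter_inv l) (letter_act l y)"
  using elem_inv[OF mor_jump[OF assms, of y]] assms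
  by (simp add: jump_elem_def letter_act_inv' del: letter_act.simps)

lemma path_elem_mult_elem:
  assumes "path \<sigma>" "pathfinish \<sigma> = x" "mor x w y \<gamma>"
  shows "path_elem \<sigma> \<otimes>\<^bsub>\<Gamma>\<^esub> elem \<gamma> w y = elem (\<sigma> +++ \<gamma>) w y"
  using elem_mult[of "pathstart \<sigma>" "[]" x \<sigma> w y \<gamma>] assms
  by (simp add: path_elem_def mor_def)

lemma jump_elem_mult_elem:
  assumes l: "l \<in> S \<times> UNIV" and "mor x w y \<gamma>"
  shows "jump_elem l x \<otimes>\<^bsub>\<Gamma>\<^esub> elem \<gamma> w y = elem (letter_act l \<circ> \<gamma>) (l # w) y"
proof -
  note c = mor_comp[OF mor_jump[OF l, of x] assms(2)] and m = morD[OF assms(2)]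
  have "mor (letter_act l x) (l # w) y (letter_act l \<circ> \<gamma>)"
    using m l by (simp add: mor_def path_letter_act pathstart_compose pathfinish_compose)
  moreover have "path_class ((\<lambda>_. letter_act l x) +++ (word_act [l] \<circ> \<gamma>)) = path_class (letter_act l \<circ> \<gamma>)"
    using m l path_letter_act by (simp add: class_simps del: letter_act.simps)
  ultimately show ?thesis
    unfolding jump_elem_def elem_mult[OF mor_jump[OF l] assms(2)]
    using c by (intro elem_cong[of "letter_act l x"]) auto
qed

text \<open>The continuous motion is split off in one piece, then one jump. The remaining morphism
  has a constant path, so an induction on the word meets only jumps from there on.\<close>

lemma elem_Cons:
  assumes l: "l \<in> S \<times> UNIV" and "mor x (l # w) y \<gamma>"
  shows "elem \<gamma> (l # w) y = path_elem \<gamma> \<otimes>\<^bsub>\<Gamma>\<^esub> (jump_elem l (word_act w y) \<otimes>\<^bsub>\<Gamma>\<^esub> elem (\<lambda>_. word_act w y) w y)"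
proof -
  have m: "mor (word_act w y) w y (\<lambda>_. word_act w y)" using assms by (simp add: mor_def)
  have "mor (letter_act l (word_act w y)) (l # w) y (\<lambda>_. letter_act l (word_act w y))"
    using assms by (simp add: mor_def)
  then show ?thesis
    using morD[OF assms(2)] assms(2)
    by (simp add: jump_elem_mult_elem[OF l m] path_elem_mult_elem del: letter_act.simps)
       (auto intro!: elem_cong[of x] simp: class_simps mor_def)
qed

lemma elem_Nil: "mor x [] y \<gamma> \<Longrightarrow> elem \<gamma> [] y = path_elem \<gamma>"
  by (simp add: path_elem_def mor_def)

end

section \<open>Homomorphisms out of the group of a warped system\<close>

text \<open>The groupoid is generated by paths and jumps, and these axioms are its relations:
  \<open>D\<close> is a functor on homotopy classes of paths, opposite jumps cancel
  (\<open>j_inv\<close>), and a path can be slid across a jump (\<open>j_D\<close>). As in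
  \<open>jump_elem\<close>, \<open>j l y\<close> belongs to the morphism from the image of
  \<open>y\<close> under \<open>l\<close> to \<open>y\<close>.\<close>

locale warped_target = warped + H: group H for H (structure) +
  fixes D :: "(real \<Rightarrow> 'a) \<Rightarrow> 'b" and j :: "('a \<Rightarrow> 'a) \<times> bool \<Rightarrow> 'a \<Rightarrow> 'b"
  assumes D_closed [simp]: "path \<gamma> \<Longrightarrow> D \<gamma> \<in> carrier H"
    and D_htp: "htp \<gamma> \<delta> \<Longrightarrow> D \<gamma> = D \<delta>"
    and D_join: "path \<gamma> \<Longrightarrow> path \<delta> \<Longrightarrow> pathfinish \<gamma> = pathstart \<delta> \<Longrightarrow> D (\<gamma> +++ \<delta>) = D \<gamma> \<otimes> D \<delta>"
    and j_closed [simp]: "l \<in> S \<times> UNIV \<Longrightarrow> j l x \<in> carrier H"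
    and j_inv: "l \<in> S \<times> UNIV \<Longrightarrow> j l (letter_act (letter_inv l) x) \<otimes> j (letter_inv l) x = \<one>"
    and j_D: "l \<in> S \<times> UNIV \<Longrightarrow> path \<gamma> \<Longrightarrow>
      D (letter_act l \<circ> \<gamma>) \<otimes> j l (pathfinish \<gamma>) = j l (pathstart \<gamma>) \<otimes> D \<gamma>"
begin

interpretation G: group \<Gamma> by (rule group_pi1_semidirect)

fun jw :: "('a \<Rightarrow> 'a) word \<Rightarrow> 'a \<Rightarrow> 'b" where
  "jw [] y = \<one>"
| "jw (l # w) y = j l (word_act w y) \<otimes> jw w y"

lemma jw_closed [simp]: "w \<in> words \<Longrightarrow> jw w y \<in> carrier H"
  by (induction w) auto

lemma jw_append: "u \<in> words \<Longrightarrow> v \<in> words \<Longrightarrow> jw (u @ v) y = jw u (word_act v y) \<otimes> jw v y"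
  by (induction u) (auto simp: H.m_assoc word_act_append)

lemma jw_reduce: "w \<in> words \<Longrightarrow> jw (reduce w) y = jw w y"
proof -
  assume w: "w \<in> words"
  \<comment> \<open>The action is carried along in the pair: prepending a letter to \<open>w\<close>
    involves the point \<open>word_act w y\<close> and not only the value of
    \<open>jw\<close>.\<close>
  let ?f = "\<lambda>w. if w \<in> words then (jw w y, word_act w y) else undefined"
  have "?f (reduce w) = ?f w"
  proof (rule reduce_invariant[where A = S])
    fix l :: "('a \<Rightarrow> 'a) \<times> bool" and w assume "l \<in> S \<times> UNIV" "w \<in> words"
    then show "?f (l # letter_inv l # w) = ?f w"
      by (simp add: letter_act_inv j_inv flip: H.m_assoc del: letter_act.simps letter_inv.simps)
  qed (use w in auto)
  then show ?thesis using w by (simp add: reduce_lists)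
qed

lemma D_const [simp]: "D (\<lambda>_. x) = \<one>"
proof -
  have "D (\<lambda>_. x) = D (\<lambda>_. x) \<otimes> D (\<lambda>_. x)"
    using D_join[of "\<lambda>_. x" "\<lambda>_. x"] D_htp[OF htp_const_join[of "\<lambda>_. x" x]] by simp
  then show ?thesis by (metis D_closed H.l_cancel_one' path_const)
qed

lemma D_reversepath: "path \<gamma> \<Longrightarrow> D (reversepath \<gamma>) = inv D \<gamma>"
proof -
  assume p: "path \<gamma>"
  have "D (reversepath \<gamma>) \<otimes> D \<gamma> = \<one>"
    using D_join[of "reversepath \<gamma>" \<gamma>] p D_htp[OF htp_join_reversepath[of "reversepath \<gamma>" "pathfinish \<gamma>"]]
    by simp
  then show ?thesis using p H.inv_equality by simp
qed

lemma jw_D: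
  "w \<in> words \<Longrightarrow> path \<gamma> \<Longrightarrow>
   D (word_act w \<circ> \<gamma>) \<otimes> jw w (pathfinish \<gamma>) = jw w (pathstart \<gamma>) \<otimes> D \<gamma>"
proof (induction w)
  case (Cons l w)
  then have l: "l \<in> S \<times> UNIV" and w: "w \<in> words" by auto
  note p = path_word_act[OF w Cons.prems(2)]
  have "D (word_act (l # w) \<circ> \<gamma>) \<otimes> jw (l # w) (pathfinish \<gamma>) =
    (D (letter_act l \<circ> (word_act w \<circ> \<gamma>)) \<otimes> j l (pathfinish (word_act w \<circ> \<gamma>))) \<otimes> jw w (pathfinish \<gamma>)"
    using l w p path_letter_act[OF l p]
    by (simp add: H.m_assoc comp_assoc pathfinish_compose)
  also have "\<dots> = j l (word_act w (pathstart \<gamma>)) \<otimes> (D (word_act w \<circ> \<gamma>) \<otimes> jw w (pathfinish \<gamma>))"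
    unfolding j_D[OF l p] using l w p by (simp add: H.m_assoc pathstart_compose)
  also have "\<dots> = jw (l # w) (pathstart \<gamma>) \<otimes> D \<gamma>"
    unfolding Cons.IH[OF w Cons.prems(2)] using Cons.prems(2) l w by (simp add: H.m_assoc)
  finally show ?case .
qed auto

text \<open>The preimage under \<^term>\<open>vertex_elem\<close> is only determined up to homotopy and reduction.\<close>

definition lift :: "(real \<Rightarrow> 'a) set \<times> ('a \<Rightarrow> 'a) word \<Rightarrow> 'b" where
  "lift g = (let (\<gamma>, w) = SOME (\<gamma>, w). mor x0 w x0 \<gamma> \<and> g = vertex_elem \<gamma> w in D \<gamma> \<otimes> jw w x0)"

lemma lift_vertex_elem:
  assumes "mor x0 w x0 \<gamma>"
  shows "lift (vertex_elem \<gamma> w) = D \<gamma> \<otimes> jw w x0"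
proof -
  let ?P = "\<lambda>(\<delta>, v). mor x0 v x0 \<delta> \<and> vertex_elem \<gamma> w = vertex_elem \<delta> v"
  obtain \<delta> v where dv: "(SOME p. ?P p) = (\<delta>, v)" by (cases "SOME p. ?P p")
  have "?P (SOME p. ?P p)" using assms by (intro someI[of ?P "(\<gamma>, w)"]) auto
  then have m: "mor x0 v x0 \<delta>" "vertex_elem \<gamma> w = vertex_elem \<delta> v" unfolding dv by auto
  then have "path_class \<gamma> = path_class \<delta>" "reduce w = reduce v"
    using assms by (auto simp: vertex_elem_eq_iff)
  then have "D \<gamma> = D \<delta>" "jw w x0 = jw v x0"
    using D_htp[of \<gamma> \<delta>] jw_reduce[of w x0] jw_reduce[of v x0] morD[OF assms] morD[OF m(1)]
    by (simp_all add: path_class_eq_iff)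
  then show ?thesis unfolding lift_def dv by simp
qed

lemma lift_hom: "lift \<in> hom \<Gamma> H"
proof (rule homI)
  fix g assume "g \<in> carrier \<Gamma>"
  then obtain \<gamma> w where "mor x0 w x0 \<gamma>" "g = vertex_elem \<gamma> w" by (rule vertex_elem_surj)
  then show "lift g \<in> carrier H" by (auto simp: lift_vertex_elem mor_def)
next
  fix g h assume "g \<in> carrier \<Gamma>" "h \<in> carrier \<Gamma>"
  then obtain \<gamma> u \<delta> v where *: "mor x0 u x0 \<gamma>" "mor x0 v x0 \<delta>"
    and [simp]: "g = vertex_elem \<gamma> u" "h = vertex_elem \<delta> v"
    by (elim vertex_elem_surj) blast
  note m = morD[OF *(1)] morD[OF *(2)]
  have "lift (g \<otimes>\<^bsub>\<Gamma>\<^esub> h) = D \<gamma> \<otimes> (D (word_act u \<circ> \<delta>) \<otimes> jw u (pathfinish \<delta>)) \<otimes> jw v x0"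
    using m * path_word_act[OF m(4), of \<delta>]
    by (simp add: vertex_elem_mult lift_vertex_elem[OF mor_comp[OF *]] D_join pathstart_compose
        jw_append H.m_assoc)
  also have "\<dots> = (D \<gamma> \<otimes> jw u x0) \<otimes> (D \<delta> \<otimes> jw v x0)"
    unfolding jw_D[OF m(4,5)] using m by (simp add: H.m_assoc)
  finally show "lift (g \<otimes>\<^bsub>\<Gamma>\<^esub> h) = lift g \<otimes> lift h" using * by (simp add: lift_vertex_elem)
qed

text \<open>\<open>lift\<close> is the functor given by \<open>D\<close> and \<open>j\<close>,
  corrected by the values of the base paths at both ends. The word is slid across the returning base
  path by \<open>jw_D\<close>.\<close>

lemma lift_elem:
  assumes "mor x w y \<gamma>"
  shows "lift (elem \<gamma> w y) = D (base_path x) \<otimes> (D \<gamma> \<otimes> (jw w y \<otimes> inv D (base_path y)))"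
proof -
  note m = morD[OF assms]
  have p: "path (word_act w \<circ> reversepath (base_path y))"
    using base_path m by (simp add: path_word_act)
  have "lift (elem \<gamma> w y) = D (base_path x) \<otimes> (D \<gamma> \<otimes> (D (word_act w \<circ> reversepath (base_path y)) \<otimes>
      jw w (pathfinish (reversepath (base_path y)))))"
    unfolding elem_def lift_vertex_elem[OF mor_elem[OF assms]]
    using m p base_path by (simp add: D_join pathstart_compose H.m_assoc)
  also have "D (word_act w \<circ> reversepath (base_path y)) \<otimes> jw w (pathfinish (reversepath (base_path y))) =
      jw w y \<otimes> inv D (base_path y)"
    using m base_path by (subst jw_D) (simp_all add: D_reversepath)
  finally show ?thesis .
qed

lemma lift_path_elem:
  "path \<gamma> \<Longrightarrow> lift (path_elem \<gamma>) = D (base_path (pathstart \<gamma>)) \<otimes> (D \<gamma> \<otimes> inv D (base_path (pathfinish \<gamma>)))"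
  unfolding path_elem_def using base_path by (subst lift_elem[OF mor_path]) auto

lemma lift_jump_elem:
  "l \<in> S \<times> UNIV \<Longrightarrow>
   lift (jump_elem l y) = D (base_path (letter_act l y)) \<otimes> (j l y \<otimes> inv D (base_path y))"
  unfolding jump_elem_def using base_path by (subst lift_elem[OF mor_jump]) auto

end

section \<open>Discrete chains in warped spaces\<close>

lemma dist_le_path_length: "ennreal (dist (pathstart \<gamma>) (pathfinish \<gamma>)) \<le> path_length \<gamma>"
proof -
  let ?u = "\<lambda>i::nat. if i = 0 then 0 else 1 :: real"
  have "ennreal (dist (pathstart \<gamma>) (pathfinish \<gamma>)) = (\<Sum>i<1. ennreal (dist (\<gamma> (?u i)) (\<gamma> (?u (Suc i)))))"
    by (simp add: pathstart_def pathfinish_def)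
  also have "\<dots> \<le> path_length \<gamma>"
    unfolding path_length_def
    by (rule SUP_upper2[of "(1, ?u)"]) (auto simp: mono_def)
  finally show ?thesis .
qed

lemma geodesic_path:
  fixes x y :: "'x::metric_space"
  assumes "geodesic_space TYPE('x)"
  obtains p where "path p" "pathstart p = x" "pathfinish p = y"
    "\<And>a b. a \<in> path_image p \<Longrightarrow> b \<in> path_image p \<Longrightarrow> dist a b \<le> dist x y"
proof -
  obtain c where c: "c 0 = x" "c (dist x y) = y"
    "\<And>u v. u \<in> {0..dist x y} \<Longrightarrow> v \<in> {0..dist x y} \<Longrightarrow> dist (c u) (c v) = \<bar>u - v\<bar>"
    using assms unfolding geodesic_space_def by meson
  let ?d = "dist x y"
  have in_d: "u * ?d \<in> {0..?d}" if "u \<in> {0..1}" for u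
    using that by (auto intro: mult_left_le_one_le)
  have eq: "dist (c (u * ?d)) (c (v * ?d)) = \<bar>u - v\<bar> * ?d" if "u \<in> {0..1}" "v \<in> {0..1}" for u v
    using c(3)[OF in_d in_d, OF that] by (simp add: abs_mult flip: left_diff_distrib)
  show thesis
  proof
    show "path (\<lambda>u. c (u * ?d))"
      unfolding path_def
    proof (rule lipschitz_on_continuous_on)
      show "?d-lipschitz_on {0..1} (\<lambda>u. c (u * ?d))"
        by (rule lipschitz_onI) (auto simp: eq dist_real_def)
    qed
    fix a b assume "a \<in> path_image (\<lambda>u. c (u * ?d))" "b \<in> path_image (\<lambda>u. c (u * ?d))"
    then obtain u v where *: "u \<in> {0..1}" "v \<in> {0..1}" and "a = c (u * ?d)" "b = c (v * ?d)"
      by (auto simp: path_image_def)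
    moreover have "\<bar>u - v\<bar> * ?d \<le> ?d"
      using * by (intro mult_left_le_one_le) auto
    ultimately show "dist a b \<le> ?d" by (simp add: eq)
  qed (simp_all add: pathstart_def pathfinish_def c)
qed

lemma geodesic_division:
  fixes x y :: "'x::metric_space"
  assumes "geodesic_space TYPE('x)" "dist x y \<le> real (Suc n) * r" "0 \<le> r"
  obtains z where "dist x z \<le> r" "dist z y \<le> real n * r"
proof -
  obtain c where c: "c 0 = x" "c (dist x y) = y"
    "\<And>u v. u \<in> {0..dist x y} \<Longrightarrow> v \<in> {0..dist x y} \<Longrightarrow> dist (c u) (c v) = \<bar>u - v\<bar>"
    using assms(1) unfolding geodesic_space_def by meson
  \<comment> \<open>The cut is capped at the end point, since \<open>x\<close> and \<open>y\<close>
    may be closer than \<open>r\<close>.\<close>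
  let ?u = "min r (dist x y)"
  have u: "?u \<in> {0..dist x y}" "0 \<in> {0..dist x y}" "dist x y \<in> {0..dist x y}"
    using assms(3) by auto
  have "dist x (c ?u) \<le> r" using c(3)[OF u(2,1)] c(1) assms(3) by (simp add: abs_if)
  moreover have "dist (c ?u) y \<le> real n * r"
    using c(3)[OF u(1,3)] c(2) assms(2,3) by (auto simp: min_def abs_if algebra_simps)
  ultimately show thesis using that by blast
qed

context warped begin

interpretation G: group \<Gamma> by (rule group_pi1_semidirect)

text \<open>The diameter is bounded, not the length. So arbitrary continuous paths can be cut into
  small ones, and all pairs of points on a small path are close, as evaluating a cocycle along it
  requires.\<close>

definition small_path :: "real \<Rightarrow> (real \<Rightarrow> 'x) \<Rightarrow> bool" where
  "small_path t \<gamma> \<longleftrightarrow> path \<gamma> \<and> (\<forall>p\<in>path_image \<gamma>. \<forall>q\<in>path_image \<gamma>. dist p q \<le> 1 / t)"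

text \<open>Each of the \<open>m\<close> steps has length at most one for \<open>\<delta>\<^sub>S\<^sup>t\<close>, and \<open>g\<close> is the morphism
  represented by the whole chain.\<close>

inductive chain :: "real \<Rightarrow> nat \<Rightarrow> 'x \<Rightarrow> 'x \<Rightarrow> (real \<Rightarrow> 'x) set \<times> ('x \<Rightarrow> 'x) word \<Rightarrow> bool" for t where
  chain_nil: "chain t 0 x x \<one>\<^bsub>\<Gamma>\<^esub>"
| chain_path: "small_path t \<gamma> \<Longrightarrow> chain t m (pathfinish \<gamma>) z g \<Longrightarrow>
    chain t (Suc m) (pathstart \<gamma>) z (path_elem \<gamma> \<otimes>\<^bsub>\<Gamma>\<^esub> g)"
| chain_jump: "l \<in> S \<times> UNIV \<Longrightarrow> chain t m y z g \<Longrightarrow>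
    chain t (Suc m) (letter_act l y) z (jump_elem l y \<otimes>\<^bsub>\<Gamma>\<^esub> g)"

lemma small_pathD: "small_path t \<gamma> \<Longrightarrow> path \<gamma>"
  by (simp add: small_path_def)

lemma chain_closed: "chain t m x y g \<Longrightarrow> g \<in> carrier \<Gamma>"
  by (induction rule: chain.induct) (auto dest: small_pathD simp del: one_pi1_semidirect)

lemma chain_append:
  assumes "chain t m x y g" "chain t n y z h"
  shows "chain t (m + n) x z (g \<otimes>\<^bsub>\<Gamma>\<^esub> h)"
  using assms
proof (induction rule: chain.induct)
  case (chain_path \<gamma> m z g)
  then show ?case using chain.chain_path[of t \<gamma> "m + n" _ "g \<otimes>\<^bsub>\<Gamma>\<^esub> h"]
    by (simp add: G.m_assoc small_pathD chain_closed)
next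
  case (chain_jump l m y z g)
  then show ?case using chain.chain_jump[of l t "m + n" _ _ "g \<otimes>\<^bsub>\<Gamma>\<^esub> h"]
    by (simp add: G.m_assoc chain_closed)
qed (simp add: chain_closed)

lemma chain_single_path: "small_path t \<gamma> \<Longrightarrow> chain t 1 (pathstart \<gamma>) (pathfinish \<gamma>) (path_elem \<gamma>)"
  using chain_path[OF _ chain_nil] by (fastforce dest: small_pathD)

lemma chain_single_jump: "l \<in> S \<times> UNIV \<Longrightarrow> chain t 1 (letter_act l y) y (jump_elem l y)"
  using chain_jump[OF _ chain_nil, of l t y] by simp

lemma small_path_reversepath: "small_path t \<gamma> \<Longrightarrow> small_path t (reversepath \<gamma>)"
  by (simp add: small_path_def)

lemma chain_reverse:
  "chain t m x y g \<Longrightarrow> chain t m y x (inv\<^bsub>\<Gamma>\<^esub> g)"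
proof (induction rule: chain.induct)
  case (chain_path \<gamma> m z g)
  have "chain t 1 (pathfinish \<gamma>) (pathstart \<gamma>) (inv\<^bsub>\<Gamma>\<^esub> path_elem \<gamma>)"
    using chain_single_path[OF small_path_reversepath[OF chain_path(1)]] chain_path(1)
    by (simp add: path_elem_reversepath small_pathD)
  from chain_append[OF chain_path(3) this] show ?case
    using chain_path by (simp add: G.inv_mult_group small_pathD chain_closed)
next
  case (chain_jump l m y z g)
  have "chain t 1 y (letter_act l y) (inv\<^bsub>\<Gamma>\<^esub> jump_elem l y)"
    using chain_single_jump[of "letter_inv l" t "letter_act l y"] chain_jump(1)
    by (simp add: jump_elem_inv letter_act_inv' del: letter_act.simps)
  from chain_append[OF chain_jump(3) this] show ?case
    using chain_jump by (simp add: G.inv_mult_group chain_closed)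
qed (use chain_nil in simp)

text \<open>Constant paths are steps with trivial element, so the exact step count of a chain can
  serve as an upper bound.\<close>

lemma chain_pad:
  assumes "chain t m x y g" "m \<le> n" "0 < t"
  shows "chain t n x y g"
  using assms(2)
proof (induction n rule: dec_induct)
  case (step n)
  have "small_path t (\<lambda>_. x)" using assms(3) by (auto simp: small_path_def path_image_def)
  from chain_path[OF this, of n y g] show ?case using step(3) chain_closed[OF step(3)] by simp
qed (fact assms(1))

lemma geodesic: "geodesic_space TYPE('x)"
  using ws by (auto simp: warped_system_def jumping_geodesic_def)

lemma chain_of_dist_le:
  assumes "dist x y \<le> real n / t" "0 < t"
  shows "\<exists>g. chain t n x y g"
  using assms(1)
proof (induction n arbitrary: x)
  case 0
  then show ?case using chain_nil[of t x] by (intro exI[of _ "\<one>\<^bsub>\<Gamma>\<^esub>"]) simp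
next
  case (Suc n)
  obtain z where z: "dist x z \<le> 1 / t" "dist z y \<le> real n * (1 / t)"
    using Suc.prems assms(2) by (rule_tac geodesic_division[OF geodesic, of x y n "1/t"]) auto
  obtain g where g: "chain t n z y g" using Suc.IH[of z] z by auto
  obtain p where "path p" "pathstart p = x" "pathfinish p = z"
    "\<And>a b. a \<in> path_image p \<Longrightarrow> b \<in> path_image p \<Longrightarrow> dist a b \<le> dist x z"
    by (rule geodesic_path[OF geodesic, of x z]) blast
  then have "small_path t p" "pathstart p = x" "pathfinish p = z"
    using z(1) by (fastforce simp: small_path_def)+
  then show ?case using chain_path[of t p n y g] g by (intro exI[of _ "path_elem p \<otimes>\<^bsub>\<Gamma>\<^esub> g"]) simp
qed

lemma generator_letter:
  assumes "\<sigma> \<in> S \<union> inv_into UNIV ` S"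
  obtains l where "l \<in> S \<times> UNIV" "\<sigma> = letter_act l"
proof -
  from assms consider "\<sigma> \<in> S" | s where "s \<in> S" "\<sigma> = inv_into UNIV s" by auto
  then show thesis
  proof cases
    case 1
    then show thesis by (intro that[of "(\<sigma>, True)"]) auto
  next
    case (2 s)
    then show thesis by (intro that[of "(s, False)"]) auto
  qed
qed

text \<open>A jumping path of length at most \<open>C\<close> has at most \<open>C\<close> jumps,
  hence at most \<open>C + 1\<close> continuous pieces. The ends of a piece are at distance at most
  \<open>C / t\<close>, so \<open>C\<close> geodesic steps replace it. The piece itself is
  discarded; only the existence of some element is claimed.\<close>

lemma chain_of_warped_dist_le:
  assumes "jumping_geodesic S t" "0 < t" "warped_dist S t x y \<le> real C"
  shows "\<exists>g. chain t (C + (C + 1) * C) x y g"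
proof -
  obtain n \<gamma> \<sigma> where j: "jumping_path S n \<gamma> \<sigma>" "pathstart (\<gamma> 0) = x" "pathfinish (\<gamma> n) = y"
    "jumping_length t n \<gamma> = ennreal (warped_dist S t x y)"
    using assms(1) unfolding jumping_geodesic_def by meson
  have len: "jumping_length t n \<gamma> \<le> ennreal (real C)"
    unfolding j(4) using assms(3) by (rule ennreal_leI)
  have "ennreal (real n) \<le> ennreal (real C)"
    using order_trans[OF _ len, of "of_nat n"]
      by (simp add: jumping_length_def ennreal_of_nat_eq_real_of_nat)
  then have n: "n \<le> C" by simp
  have seg: "dist (pathstart (\<gamma> i)) (pathfinish (\<gamma> i)) \<le> real C / t" if "i \<le> n" for i
  proof -
    let ?d = "dist (pathstart (\<gamma> i)) (pathfinish (\<gamma> i))"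
    have "ennreal (t * ?d) = ennreal t * ennreal ?d" using assms(2) by (simp add: ennreal_mult)
    also have "\<dots> \<le> ennreal t * path_length (\<gamma> i)" by (intro mult_left_mono dist_le_path_length) simp
    also have "\<dots> \<le> (\<Sum>i=0..n. ennreal t * path_length (\<gamma> i))"
      using that by (intro member_le_sum) auto
    also have "\<dots> \<le> ennreal (real C)"
      using len unfolding jumping_length_def by (rule order_trans[rotated]) simp
    finally have "t * ?d \<le> real C" by simp
    then show ?thesis using assms(2) by (simp add: field_simps)
  qed
  have "\<exists>g. chain t (i + (i + 1) * C) x (pathfinish (\<gamma> i)) g" if "i \<le> n" for i
    using that
  proof (induction i)
    case 0
    then show ?case using chain_of_dist_le[OF seg assms(2), of 0] j(2) by simp
  next
    case (Suc i)
    then obtain g where g: "chain t (i + (i + 1) * C) x (pathfinish (\<gamma> i)) g" by auto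
    have "\<sigma> (Suc i) \<in> S \<union> inv_into UNIV ` S" "pathstart (\<gamma> (Suc i)) = \<sigma> (Suc i) (pathfinish (\<gamma> i))"
      using j(1) Suc.prems by (auto simp: jumping_path_def)
    then obtain l where l: "l \<in> S \<times> UNIV" "pathstart (\<gamma> (Suc i)) = letter_act l (pathfinish (\<gamma> i))"
      by (metis generator_letter)
    obtain h where h: "chain t C (pathstart (\<gamma> (Suc i))) (pathfinish (\<gamma> (Suc i))) h"
      using chain_of_dist_le[OF seg assms(2)] Suc.prems by blast
    \<comment> \<open>The jump is run from the point to its image, against the direction of
      \<open>jump_elem\<close>, hence the reversal.\<close>
    from chain_append[OF g chain_append[OF chain_reverse[OF chain_single_jump[OF l(1)]] h[unfolded l(2)]]]
    show ?case
      by (intro exI[of _ "g \<otimes>\<^bsub>\<Gamma>\<^esub> (inv\<^bsub>\<Gamma>\<^esub> jump_elem l (pathfinish (\<gamma> i)) \<otimes>\<^bsub>\<Gamma>\<^esub> h)"])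
         (simp add: algebra_simps)
  qed
  from this[of n] obtain g where "chain t (n + (n + 1) * C) x y g" using j(3) by auto
  moreover have "n + (n + 1) * C \<le> C + (C + 1) * C" using n by (intro add_mono mult_right_mono) auto
  ultimately show ?thesis using chain_pad assms(2) by blast
qed

section \<open>Representing every element of the group by a chain\<close>

lemma path_elem_subdivide:
  assumes "path \<gamma>" "a \<in> {0..1}" "b \<in> {0..1}" "c \<in> {0..1}"
  shows "path_elem (\<gamma> \<circ> linepath a c) = path_elem (\<gamma> \<circ> linepath a b) \<otimes>\<^bsub>\<Gamma>\<^esub> path_elem (\<gamma> \<circ> linepath b c)"
proof -
  have seg: "closed_segment u v \<subseteq> {0..1}" if "u \<in> {0..1}" "v \<in> {0..1}" for u v :: real
    using that by (auto simp: closed_segment_eq_real_ivl)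
  have p: "path (\<gamma> \<circ> linepath u v)" if "u \<in> {0..1}" "v \<in> {0..1}" for u v
    using assms(1) seg[OF that] by (intro path_continuous_image) (auto simp: path_def intro:
      continuous_on_subset)
  have "htp (\<gamma> \<circ> (linepath a b +++ linepath b c)) (\<gamma> \<circ> linepath a c)"
    using assms seg by (intro homotopic_paths_compose_unit_interval) (auto simp: path_image_join
      path_image_linepath)
  from path_elem_htp[OF this] show ?thesis
    using assms p by (simp add: path_compose_join path_elem_join pathstart_compose pathfinish_compose)
qed

text \<open>In contrast to \<open>chain_of_dist_le\<close> the homotopy class has to be kept, so the
  path is cut up rather than replaced. Being reachable by a chain passes between nearby parameters,
  and the unit interval is connected; the number of steps stays unspecified.\<close>

lemma chain_of_path:
  assumes \<gamma>: "path \<gamma>" and t: "0 < t"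
  shows "\<exists>m. chain t m (pathstart \<gamma>) (pathfinish \<gamma>) (path_elem \<gamma>)"
proof -
  let ?P = "\<lambda>s. \<exists>m. chain t m (\<gamma> 0) (\<gamma> s) (path_elem (\<gamma> \<circ> linepath 0 s))"
  have zero_in_unit: "0 \<in> {0..1::real}" by simp
  have "?P 1"
  proof (rule connected_induction_simple[of "{0..1}" 0 1 ?P])
    have "\<gamma> \<circ> linepath 0 0 = (\<lambda>_. \<gamma> 0)" by (auto simp: linepath_def)
    then show "?P 0" using chain_nil by auto
  next
    fix a :: real assume a: "a \<in> {0..1}"
    obtain d where d: "d > 0" "\<And>b. b \<in> {0..1} \<Longrightarrow> dist b a < d \<Longrightarrow> dist (\<gamma> b) (\<gamma> a) < 1 / (2 * t)"
      using \<gamma> a t unfolding path_def continuous_on_iff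
        by (metis zero_less_divide_1_iff zero_less_mult_iff zero_less_numeral)
    let ?T = "{0..1} \<inter> ball a d"
    have step: "?P c" if b: "b \<in> ?T" and c: "c \<in> ?T" and P: "?P b" for b c
    proof -
      have seg: "closed_segment b c \<subseteq> ?T"
        using b c by (intro closed_segment_subset) (auto intro: convex_Int)
      have im: "path_image (\<gamma> \<circ> linepath b c) = \<gamma> ` closed_segment b c"
        by (simp add: path_image_compose path_image_linepath)
      have close: "dist (\<gamma> u) (\<gamma> v) \<le> 1 / t" if "u \<in> ?T" "v \<in> ?T" for u v
      proof -
        have "dist (\<gamma> u) (\<gamma> a) < 1 / (2 * t)" "dist (\<gamma> v) (\<gamma> a) < 1 / (2 * t)"
          using that d(2)[of u] d(2)[of v] by (auto simp: dist_commute[of a])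
        moreover have "1 / t = 1 / (2 * t) + 1 / (2 * t)" by simp
        ultimately show ?thesis using dist_triangle2[of "\<gamma> u" "\<gamma> v" "\<gamma> a"] by linarith
      qed
      have "path (\<gamma> \<circ> linepath b c)"
        using seg \<gamma> by (intro path_continuous_image) (auto simp: path_def intro: continuous_on_subset)
      then have "small_path t (\<gamma> \<circ> linepath b c)"
        unfolding small_path_def im using seg close by blast
      from chain_single_path[OF this]
      have "chain t 1 (\<gamma> b) (\<gamma> c) (path_elem (\<gamma> \<circ> linepath b c))"
        by (simp add: pathstart_compose pathfinish_compose)
      with P obtain m where "chain t (m + 1) (\<gamma> 0) (\<gamma> c)
          (path_elem (\<gamma> \<circ> linepath 0 b) \<otimes>\<^bsub>\<Gamma>\<^esub> path_elem (\<gamma> \<circ> linepath b c))"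
        using chain_append by blast
      moreover have "b \<in> {0..1}" "c \<in> {0..1}" using b c by auto
      ultimately show ?thesis
        unfolding path_elem_subdivide[OF \<gamma> zero_in_unit \<open>b \<in> {0..1}\<close> \<open>c \<in> {0..1}\<close>] by blast
    qed
    show "\<exists>T. openin (top_of_set {0..1}) T \<and> a \<in> T \<and> (\<forall>x\<in>T. \<forall>y\<in>T. ?P x \<longrightarrow> ?P y)"
    proof (rule exI[of _ ?T], intro conjI ballI impI)
      show "openin (top_of_set {0..1}) ?T" by (rule openin_open_Int) simp
      show "a \<in> ?T" using a d(1) by simp
    qed (rule step)
  qed auto
  moreover have "\<gamma> \<circ> linepath 0 1 = \<gamma>" by (auto simp: linepath_def)
  ultimately show ?thesis by (simp add: pathstart_def pathfinish_def)
qed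

lemma chain_of_elem:
  assumes "0 < t" "mor x w y \<gamma>"
  shows "\<exists>m. chain t m x y (elem \<gamma> w y)"
  using assms(2)
proof (induction w arbitrary: x \<gamma>)
  case Nil
  then show ?case using chain_of_path[OF _ assms(1), of \<gamma>] by (auto simp: elem_Nil mor_def)
next
  case (Cons l w)
  then have l: "l \<in> S \<times> UNIV" and w: "w \<in> words" by (auto simp: mor_def)
  obtain m1 where 1: "chain t m1 x (letter_act l (word_act w y)) (path_elem \<gamma>)"
    using chain_of_path[OF _ assms(1), of \<gamma>] Cons.prems by (auto simp: mor_def simp del: letter_act.simps)
  have "mor (word_act w y) w y (\<lambda>_. word_act w y)" using w by (simp add: mor_def)
  from Cons.IH[OF this] obtain m2 where
    2: "chain t m2 (word_act w y) y (elem (\<lambda>_. word_act w y) w y)" by blast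
  show ?case
    unfolding elem_Cons[OF l Cons.prems]
    using chain_append[OF 1 chain_jump[OF l 2]] by blast
qed

lemma chain_surj:
  assumes "0 < t" "g \<in> carrier \<Gamma>"
  obtains m where "chain t m x0 x0 g"
proof -
  obtain \<gamma> w where "mor x0 w x0 \<gamma>" "g = vertex_elem \<gamma> w" using vertex_elem_surj[OF assms(2)] by blast
  then show thesis using chain_of_elem[OF assms(1), of x0 w x0 \<gamma>] that by (auto simp: elem_base)
qed

subsection \<open>Chains at large scales\<close>

lemma finite_words: "finite {w \<in> words. length w \<le> m}"
proof -
  have "finite (S \<times> (UNIV :: bool set))" using ws by (simp add: warped_system_def)
  from finite_lists_length_le[OF this, of m] show ?thesis
    by (rule rev_finite_subset) auto
qed

lemma compact_space: "compact (UNIV :: 'x set)"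
  using ws by (simp add: warped_system_def)

lemma uniform_word_act:
  assumes "\<epsilon> > 0"
  shows "\<exists>\<delta>>0. \<forall>w\<in>words. length w \<le> m \<longrightarrow> (\<forall>x y. dist x y \<le> \<delta> \<longrightarrow> dist (word_act w x) (word_act w y) \<le> \<epsilon>)"
proof -
  have "\<exists>\<delta>>0. \<forall>w\<in>F. \<forall>x y. dist x y \<le> \<delta> \<longrightarrow> dist (word_act w x) (word_act w y) \<le> \<epsilon>"
    if "finite F" "F \<subseteq> words" for F
    using that
  proof (induction F rule: finite_induct)
    case empty
    then show ?case by (intro exI[of _ 1]) auto
  next
    case (insert w F)
    then obtain \<delta> where \<delta>: "\<delta> > 0" "\<forall>w\<in>F. \<forall>x y. dist x y \<le> \<delta> \<longrightarrow> dist (word_act w x) (word_act w y) \<le> \<epsilon>"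
      by auto
    have "uniformly_continuous_on UNIV (word_act w)"
      using insert by (intro compact_uniformly_continuous continuous_word_act compact_space) auto
    then obtain d where d: "d > 0" "\<And>x y. dist x y < d \<Longrightarrow> dist (word_act w x) (word_act w y) < \<epsilon>"
      unfolding uniformly_continuous_on_def using assms by (metis UNIV_I dist_commute)
    show ?case
    proof (intro exI conjI ballI allI impI)
      show "min (d / 2) \<delta> > 0" using d \<delta> by simp
      fix v and x y :: 'x assume "v \<in> insert w F" "dist x y \<le> min (d / 2) \<delta>"
      then show "dist (word_act v x) (word_act v y) \<le> \<epsilon>"
        using d(1) d(2)[of x y] \<delta>(2) by (cases "v = w") auto
    qed
  qed
  from this[OF finite_words[of m]] show ?thesis unfolding mem_Collect_eq by blast
qed

text \<open>Off the \<epsilon>-neighbourhood of \<open>Fix w\<close>, on a compact set, the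
  displacement is continuous and positive, so it has a positive minimum. If \<open>w\<close> has no
  fixed point this set is the whole space, and the conclusion excludes small displacements
  altogether. Only finitely many words have length at most \<open>m\<close>.\<close>

lemma fixed_point_near:
  assumes "\<epsilon> > 0"
  shows "\<exists>\<delta>>0. \<forall>w\<in>words. length w \<le> m \<longrightarrow> (\<forall>x. dist x (word_act w x) \<le> \<delta> \<longrightarrow> (\<exists>y\<in>Fix w. dist x y \<le> \<epsilon>))"
proof -
  have one: "\<exists>\<delta>>0. \<forall>x. dist x (word_act w x) \<le> \<delta> \<longrightarrow> (\<exists>y\<in>Fix w. dist x y \<le> \<epsilon>)" if w: "w \<in> words" for w
  proof -
    let ?K = "- (\<Union>y\<in>Fix w. ball y \<epsilon>)"
    have K: "compact ?K"
      using compact_space by (metis closed_Compl compact_Int_closed inf_top_left open_UN open_ball)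
    have c: "continuous_on ?K (\<lambda>x. dist x (word_act w x))"
      by (intro continuous_intros continuous_on_subset[OF continuous_word_act[OF w]]) auto
    show ?thesis
    proof (cases "?K = {}")
      case True
      have "\<exists>y\<in>Fix w. dist x y \<le> \<epsilon>" for x
      proof -
        have "x \<notin> ?K" unfolding True by simp
        then show ?thesis by (auto simp: dist_commute[of x] intro: less_imp_le)
      qed
      then show ?thesis by (intro exI[of _ 1]) auto
    next
      case False
      obtain z where z: "z \<in> ?K" "\<And>x. x \<in> ?K \<Longrightarrow> dist z (word_act w z) \<le> dist x (word_act w x)"
        using continuous_attains_inf[OF K False c] by blast
      have "z \<noteq> word_act w z"
      proof
        assume "z = word_act w z"
        then have "z \<in> Fix w" by (simp add: Fix_def)
        then show False using z(1) assms by (auto dest: bspec[of _ _ z])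
      qed
      then have pos: "dist z (word_act w z) > 0" by simp
      have "\<exists>y\<in>Fix w. dist x y \<le> \<epsilon>" if "dist x (word_act w x) \<le> dist z (word_act w z) / 2" for x
      proof -
        have "x \<notin> ?K" using z(2)[of x] that pos by auto
        then show ?thesis by (auto simp: dist_commute[of x] intro: less_imp_le)
      qed
      then show ?thesis using pos by (intro exI[of _ "dist z (word_act w z) / 2"]) auto
    qed
  qed
  have "\<exists>\<delta>>0. \<forall>w\<in>F. \<forall>x. dist x (word_act w x) \<le> \<delta> \<longrightarrow> (\<exists>y\<in>Fix w. dist x y \<le> \<epsilon>)"
    if "finite F" "F \<subseteq> words" for F
    using that
  proof (induction F rule: finite_induct)
    case empty
    then show ?case by (intro exI[of _ 1]) auto
  next
    case (insert w F)
    then obtain \<delta> d where "\<delta> > 0" "\<forall>w\<in>F. \<forall>x. dist x (word_act w x) \<le> \<delta> \<longrightarrow> (\<exists>y\<in>Fix w. dist x y \<le> \<epsilon>)"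
      "d > 0" "\<forall>x. dist x (word_act w x) \<le> d \<longrightarrow> (\<exists>y\<in>Fix w. dist x y \<le> \<epsilon>)"
      using one[of w] by auto
    then show ?case by (intro exI[of _ "min d \<delta>"]) auto
  qed
  from this[OF finite_words[of m]] show ?thesis unfolding mem_Collect_eq by blast
qed

text \<open>Semi-local simple connectivity speaks of loops at the centre \<open>x\<close> of a ball.
  A Lebesgue number puts both paths into one such ball, and a geodesic from \<open>x\<close> to
  their common start turns them into a loop there; by its diameter bound the geodesic stays in the
  ball.\<close>

lemma small_paths_homotopic:
  "\<exists>\<epsilon>>0. \<forall>(z::'x) p q. path p \<and> path q \<and> pathstart p = pathstart q \<and> pathfinish p = pathfinish q \<and>
     path_image p \<subseteq> cball z \<epsilon> \<and> path_image q \<subseteq> cball z \<epsilon> \<longrightarrow> htp p q"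
proof -
  have "\<forall>x::'x. \<exists>r>0. \<forall>\<gamma>. path \<gamma> \<and> path_image \<gamma> \<subseteq> ball x r \<and> pathstart \<gamma> = x \<and> pathfinish \<gamma> = x
    \<longrightarrow> htp \<gamma> (\<lambda>_. x)"
  proof
    fix x :: 'x
    obtain U where U: "open U" "x \<in> U"
      "\<And>\<gamma>. path \<gamma> \<Longrightarrow> path_image \<gamma> \<subseteq> U \<Longrightarrow> pathstart \<gamma> = x \<Longrightarrow> pathfinish \<gamma> = x \<Longrightarrow> htp \<gamma> (\<lambda>_. x)"
      using ws unfolding warped_system_def semilocally_simply_connected_def by metis
    then obtain r where "r > 0" "ball x r \<subseteq> U" by (meson openE)
    then show "\<exists>r>0. \<forall>\<gamma>. path \<gamma> \<and> path_image \<gamma> \<subseteq> ball x r \<and> pathstart \<gamma> = x \<and> pathfinish \<gamma> = x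
      \<longrightarrow> htp \<gamma> (\<lambda>_. x)"
      using U(3) by (metis order_trans)
  qed
  then obtain r where r: "\<And>x::'x. r x > 0"
    "\<And>x \<gamma>. path \<gamma> \<Longrightarrow> path_image \<gamma> \<subseteq> ball x (r x) \<Longrightarrow> pathstart \<gamma> = x \<Longrightarrow> pathfinish \<gamma> = x \<Longrightarrow> htp \<gamma> (\<lambda>_. x)"
    by metis
  have "\<And>G. G \<in> range (\<lambda>x. ball x (r x)) \<Longrightarrow> open G" by auto
  moreover have "UNIV \<subseteq> \<Union> (range (\<lambda>x. ball x (r x)))" using r(1) by auto
  ultimately obtain e where e: "0 < e" "\<And>x::'x. \<exists>G\<in>range (\<lambda>x. ball x (r x)). ball x e \<subseteq> G"
    using Heine_Borel_lemma[OF compact_space] by (metis UNIV_I)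
  show ?thesis
  proof (intro exI conjI allI impI)
    show "e / 2 > 0" using e by simp
    fix z :: 'x and p q
    assume pq: "path p \<and> path q \<and> pathstart p = pathstart q \<and> pathfinish p = pathfinish q \<and>
     path_image p \<subseteq> cball z (e / 2) \<and> path_image q \<subseteq> cball z (e / 2)"
    obtain x where "ball z e \<subseteq> ball x (r x)" using e(2) by auto
    moreover have "cball z (e / 2) \<subseteq> ball z e" using e(1) by auto
    ultimately have im: "path_image p \<subseteq> ball x (r x)" "path_image q \<subseteq> ball x (r x)" using pq by auto
    obtain \<beta> where \<beta>: "path \<beta>" "pathstart \<beta> = x" "pathfinish \<beta> = pathstart p"
      "\<And>a b. a \<in> path_image \<beta> \<Longrightarrow> b \<in> path_image \<beta> \<Longrightarrow> dist a b \<le> dist x (pathstart p)"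
      by (rule geodesic_path[OF geodesic]) blast
    have "pathstart p \<in> ball x (r x)" using im by auto
    moreover have "x \<in> path_image \<beta>" using \<beta>(2) by auto
    ultimately have \<beta>im: "path_image \<beta> \<subseteq> ball x (r x)" using \<beta>(4) by fastforce
    let ?l = "\<beta> +++ ((p +++ reversepath q) +++ reversepath \<beta>)"
    have "htp ?l (\<lambda>_. x)"
      using pq \<beta> im \<beta>im by (intro r(2)) (auto simp: path_image_join)
    from path_class_eq[OF this]
    have "path_class \<beta> \<odot> (path_class p \<odot> (path_class (reversepath q) \<odot> path_class (reversepath \<beta>)))
      = path_class (\<lambda>_. x)"
      using pq \<beta> by (simp add: class_simps)
    then have "path_class (reversepath \<beta>) \<odot> ((path_class \<beta> \<odot> (path_class p \<odot> (path_class
      (reversepath q) \<odot> path_class (reversepath \<beta>)))) \<odot> (path_class \<beta> \<odot> path_class q))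
      = path_class (reversepath \<beta>) \<odot> (path_class (\<lambda>_. x) \<odot> (path_class \<beta> \<odot> path_class q))"
      by (simp del: class_join_assoc)
    then have "path_class p = path_class q"
      using pq \<beta> by (simp add: class_simps)
    then show "htp p q" using pq path_class_eq_iff by auto
  qed
qed

text \<open>The points of a chain may jump far away, but the path of the composed morphism does not:
  later pieces are carried back by the letters already read. Uniform continuity of the letters
  controls their size, at the cost of a smaller \<epsilon> for the rest of the chain.\<close>

lemma chain_displacement:
  assumes "\<epsilon> > 0"
  shows "\<exists>T>0. \<forall>t\<ge>T. \<forall>x y g. chain t m x y g \<longrightarrow>
    (\<exists>\<gamma> w. mor x w y \<gamma> \<and> length w \<le> m \<and> g = elem \<gamma> w y \<and> path_image \<gamma> \<subseteq> cball x \<epsilon>)"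
  using assms
proof (induction m arbitrary: \<epsilon>)
  case 0
  have "\<exists>\<gamma> w. mor x w y \<gamma> \<and> length w \<le> 0 \<and> g = elem \<gamma> w y \<and> path_image \<gamma> \<subseteq> cball x \<epsilon>"
    if "chain t 0 x y g" for t x y g
    using that 0 by cases (auto intro!: exI[of _ "\<lambda>_. x"] exI[of _ "[]"] simp: path_image_def)
  then show ?case by (intro exI[of _ 1]) auto
next
  case (Suc m)
  obtain \<delta> where \<delta>: "\<delta> > 0" "\<And>w x y. w \<in> words \<Longrightarrow> length w \<le> 1 \<Longrightarrow> dist x y \<le> \<delta>
    \<Longrightarrow> dist (word_act w x) (word_act w y) \<le> \<epsilon>"
    using uniform_word_act[OF Suc.prems, of 1] by auto
  \<comment> \<open>A path within \<eta> of its start stays within \<epsilon> after a letter acts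
    (first bound), and also when a path of diameter at most \<epsilon> / 2 is put in front of it
    (second bound).\<close>
  define \<eta> where "\<eta> = min \<delta> (\<epsilon> / 2)"
  have \<eta>: "\<eta> > 0" "\<eta> \<le> \<delta>" "\<eta> \<le> \<epsilon> / 2" using \<delta> Suc.prems by (auto simp: \<eta>_def)
  obtain T where T: "T > 0" "\<And>t x y g. t \<ge> T \<Longrightarrow> chain t m x y g \<Longrightarrow>
    \<exists>\<gamma> w. mor x w y \<gamma> \<and> length w \<le> m \<and> g = elem \<gamma> w y \<and> path_image \<gamma> \<subseteq> cball x \<eta>"
    using Suc.IH[OF \<eta>(1)] by metis
  show ?case
  proof (rule exI[of _ "max T (2 / \<epsilon>)"], intro conjI allI impI)
    show "max T (2 / \<epsilon>) > 0" using T by simp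
    fix t x y g assume t: "max T (2 / \<epsilon>) \<le> t" and ch: "chain t (Suc m) x y g"
    then have t': "t \<ge> T" "1 / t \<le> \<epsilon> / 2" "t > 0"
      using Suc.prems T(1) by (auto simp: field_simps)
    show "\<exists>\<gamma> w. mor x w y \<gamma> \<and> length w \<le> Suc m \<and> g = elem \<gamma> w y \<and> path_image \<gamma> \<subseteq> cball x \<epsilon>"
      using ch
    proof cases
      case (chain_path \<sigma> h)
      then have \<sigma>: "path \<sigma>" by (simp add: small_pathD)
      obtain \<gamma> w where \<gamma>: "mor (pathfinish \<sigma>) w y \<gamma>" "length w \<le> m" "h = elem \<gamma> w y"
        "path_image \<gamma> \<subseteq> cball (pathfinish \<sigma>) \<eta>"
        using T(2)[OF t'(1)] chain_path by blast
      have d: "dist (pathstart \<sigma>) p \<le> \<epsilon> / 2" if "p \<in> path_image \<sigma>" for p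
        using chain_path(3) that t'(2) pathstart_in_path_image[of \<sigma>]
        unfolding small_path_def by (meson order_trans)
      have "dist (pathstart \<sigma>) p \<le> \<epsilon>" if "p \<in> path_image \<gamma>" for p
      proof -
        have "dist (pathfinish \<sigma>) p \<le> \<epsilon> / 2" using that \<gamma>(4) \<eta> by fastforce
        then show ?thesis using d[OF pathfinish_in_path_image] dist_triangle[of "pathstart \<sigma>" p
          "pathfinish \<sigma>"] by simp
      qed
      then have "path_image (\<sigma> +++ \<gamma>) \<subseteq> cball x \<epsilon>"
        using d Suc.prems chain_path(1) \<gamma>(1) by (fastforce simp: path_image_join mor_def)
      moreover have "mor x w y (\<sigma> +++ \<gamma>)" using \<gamma>(1) \<sigma> chain_path(1) by (simp add: mor_def)
      ultimately show ?thesis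
        using \<gamma> chain_path path_elem_mult_elem[OF \<sigma> refl \<gamma>(1)]
        by (intro exI[of _ "\<sigma> +++ \<gamma>"] exI[of _ w]) auto
    next
      case (chain_jump l z h)
      obtain \<gamma> w where \<gamma>: "mor z w y \<gamma>" "length w \<le> m" "h = elem \<gamma> w y" "path_image \<gamma> \<subseteq> cball z \<eta>"
        using T(2)[OF t'(1)] chain_jump by blast
      have "dist (letter_act l z) (letter_act l p) \<le> \<epsilon>" if "p \<in> path_image \<gamma>" for p
      proof -
        have "dist z p \<le> \<delta>" using that \<gamma>(4) \<eta> by fastforce
        then show ?thesis using \<delta>(2)[of "[l]" z p] chain_jump(3) by (simp del: letter_act.simps)
      qed
      then have "path_image (letter_act l \<circ> \<gamma>) \<subseteq> cball x \<epsilon>"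
        using chain_jump(1) by (auto simp: path_image_compose simp del: letter_act.simps)
      moreover have "mor x (l # w) y (letter_act l \<circ> \<gamma>)"
        using \<gamma>(1) chain_jump by (simp add: mor_def path_letter_act pathstart_compose pathfinish_compose)
      ultimately show ?thesis
        using \<gamma> chain_jump jump_elem_mult_elem[OF chain_jump(3) \<gamma>(1)]
        by (intro exI[of _ "letter_act l \<circ> \<gamma>"] exI[of _ "l # w"]) auto
    qed
  qed
qed

lemma mor_fix_loop:
  assumes "path \<beta>" "pathfinish \<beta> \<in> Fix w" "w \<in> words"
  shows "mor (pathstart \<beta>) w (pathstart \<beta>) (\<beta> +++ (word_act w \<circ> reversepath \<beta>))"
  using assms path_word_act by (simp add: mor_def pathstart_compose pathfinish_compose Fix_def)

text \<open>In groupoid form a relator is the pure jump \<open>w\<close> at one of its fixed points,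
  conjugated by a path \<open>\<beta>\<close> from the base point.\<close>

lemma fix_relators_eq:
  "fix_relators S x0 \<alpha> \<theta> = {vertex_elem (\<beta> +++ (word_act w \<circ> reversepath \<beta>)) w | w \<beta>.
     w \<in> carrier (free_group S) \<and> length w \<le> 4 * \<theta> \<and> path \<beta> \<and> pathstart \<beta> = x0 \<and> pathfinish \<beta> \<in> Fix w}"
proof -
  have eq: "(path_class (\<beta> +++ ((word_act w \<circ> reversepath \<beta>) +++ reversepath (word_path x0 \<alpha> w))), w) =
      vertex_elem (\<beta> +++ (word_act w \<circ> reversepath \<beta>)) w"
    if "w \<in> carrier (free_group S)" "path \<beta>" "pathstart \<beta> = x0" "pathfinish \<beta> \<in> Fix w" for w \<beta>
  proof -
    have w: "w \<in> words" "reduce w = w" using that by (auto simp: carrier_free_group reduce_id)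
    show ?thesis
      using that path_word_act w word_path[OF w(1)] by (simp add: vertex_elem_def class_simps Fix_def)
  qed
  show ?thesis
    unfolding fix_relators_def
  proof (intro Collect_cong iffI; elim exE conjE)
    fix g w \<beta>
    assume "g = (path_class (\<beta> +++ ((word_act w \<circ> reversepath \<beta>) +++ reversepath (wp w))), w)"
      "w \<in> carrier (free_group S)" "length w \<le> 4 * \<theta>" "path \<beta>" "pathstart \<beta> = x0" "pathfinish \<beta> \<in> Fix w"
    then show "\<exists>w \<beta>. g = vertex_elem (\<beta> +++ (word_act w \<circ> reversepath \<beta>)) w \<and>
       w \<in> carrier (free_group S) \<and> length w \<le> 4 * \<theta> \<and> path \<beta> \<and> pathstart \<beta> = x0 \<and> pathfinish \<beta> \<in> Fix w"
      by (intro exI[of _ w] exI[of _ \<beta>]) (simp add: eq)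
  next
    fix g w \<beta>
    assume "g = vertex_elem (\<beta> +++ (word_act w \<circ> reversepath \<beta>)) w"
      "w \<in> carrier (free_group S)" "length w \<le> 4 * \<theta>" "path \<beta>" "pathstart \<beta> = x0" "pathfinish \<beta> \<in> Fix w"
    then show "\<exists>w \<beta>. g = (path_class (\<beta> +++ ((word_act w \<circ> reversepath \<beta>) +++ reversepath (wp w))), w) \<and>
       w \<in> carrier (free_group S) \<and> length w \<le> 4 * \<theta> \<and> Fix w \<noteq> {} \<and>
       path \<beta> \<and> pathstart \<beta> = x0 \<and> pathfinish \<beta> \<in> Fix w"
      by (intro exI[of _ w] exI[of _ \<beta>]) (auto simp: eq)
  qed
qed

lemma fix_relators_carrier: "fix_relators S x0 \<alpha> \<theta> \<subseteq> carrier \<Gamma>"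
proof
  fix g assume "g \<in> fix_relators S x0 \<alpha> \<theta>"
  then obtain w \<beta> where *: "g = vertex_elem (\<beta> +++ (word_act w \<circ> reversepath \<beta>)) w"
    "w \<in> carrier (free_group S)" "path \<beta>" "pathstart \<beta> = x0" "pathfinish \<beta> \<in> Fix w"
    unfolding fix_relators_eq by blast
  then show "g \<in> carrier \<Gamma>"
    using mor_fix_loop[of \<beta> w] by (simp add: vertex_elem_in_carrier carrier_free_group)
qed

lemma fix_kernel_normal: "fix_kernel S x0 \<alpha> \<theta> \<lhd> \<Gamma>"
  unfolding fix_kernel_def by (intro normal_closure_normal group_pi1_semidirect fix_relators_carrier)

lemma fix_kernel_mono: "\<theta> \<le> \<theta>' \<Longrightarrow> fix_kernel S x0 \<alpha> \<theta> \<subseteq> fix_kernel S x0 \<alpha> \<theta>'"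
  unfolding fix_kernel_def fix_relators_def
  by (intro normal_closure_mono Collect_mono impI; elim exE conjE)
     (intro exI conjI; (assumption | linarith))

lemma vertex_elem_reduce: "mor x0 w x0 \<gamma> \<Longrightarrow> vertex_elem \<gamma> (reduce w) = vertex_elem \<gamma> w"
  by (subst vertex_elem_eq_iff) (auto simp: mor_def reduce_lists word_act_reduce)

text \<open>A word displacing some point very little has a fixed point nearby, so a short closed
  chain at a large scale is one of the relators.\<close>

lemma closed_chain_in_fix_kernel:
  assumes "m \<le> 4 * \<theta>"
  shows "\<exists>T>0. \<forall>t\<ge>T. \<forall>x g. chain t m x x g \<longrightarrow> g \<in> fix_kernel S x0 \<alpha> \<theta>"
proof -
  obtain \<epsilon>1 where \<epsilon>1: "\<epsilon>1 > 0" "\<And>(z::'x) p q. path p \<Longrightarrow> path q \<Longrightarrow> pathstart p = pathstart q \<Longrightarrow>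
     pathfinish p = pathfinish q \<Longrightarrow> path_image p \<subseteq> cball z \<epsilon>1 \<Longrightarrow> path_image q \<subseteq> cball z \<epsilon>1 \<Longrightarrow> htp p q"
    using small_paths_homotopic by metis
  obtain \<delta>1 where \<delta>1: "\<delta>1 > 0" "\<And>w x y. w \<in> words \<Longrightarrow> length w \<le> m \<Longrightarrow> dist x y \<le> \<delta>1 \<Longrightarrow>
      dist (word_act w x) (word_act w y) \<le> \<epsilon>1 / 2"
    using uniform_word_act[of "\<epsilon>1 / 2" m] \<epsilon>1(1) by auto
  \<comment> \<open>With \<open>y\<close> within \<epsilon>2 of \<open>x\<close>, the geodesic
    \<open>\<beta>\<close> and its image under \<open>w\<close>, which also contains
    \<open>y\<close>, both stay within \<epsilon>1 of \<open>x\<close>.\<close>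
  define \<epsilon>2 where "\<epsilon>2 = min \<delta>1 (\<epsilon>1 / 2)"
  have \<epsilon>2: "\<epsilon>2 > 0" "\<epsilon>2 \<le> \<delta>1" "\<epsilon>2 \<le> \<epsilon>1 / 2" using \<epsilon>1 \<delta>1 by (auto simp: \<epsilon>2_def)
  obtain \<delta>2 where \<delta>2: "\<delta>2 > 0" "\<And>w x. w \<in> words \<Longrightarrow> length w \<le> m \<Longrightarrow> dist x (word_act w x) \<le> \<delta>2 \<Longrightarrow>
      \<exists>y\<in>Fix w. dist x y \<le> \<epsilon>2"
    using fixed_point_near[OF \<epsilon>2(1), of m] by metis
  define \<epsilon>3 where "\<epsilon>3 = min \<epsilon>1 \<delta>2"
  have \<epsilon>3: "\<epsilon>3 > 0" "\<epsilon>3 \<le> \<epsilon>1" "\<epsilon>3 \<le> \<delta>2" using \<epsilon>1 \<delta>2 by (auto simp: \<epsilon>3_def)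
  obtain T where T: "T > 0" "\<And>t x y g. t \<ge> T \<Longrightarrow> chain t m x y g \<Longrightarrow>
    \<exists>\<gamma> w. mor x w y \<gamma> \<and> length w \<le> m \<and> g = elem \<gamma> w y \<and> path_image \<gamma> \<subseteq> cball x \<epsilon>3"
    using chain_displacement[OF \<epsilon>3(1), of m] by metis
  have "g \<in> fix_kernel S x0 \<alpha> \<theta>" if ch: "t \<ge> T" "chain t m x x g" for t x g
  proof -
    obtain \<gamma> w where \<gamma>: "mor x w x \<gamma>" "length w \<le> m" "g = elem \<gamma> w x" "path_image \<gamma> \<subseteq> cball x \<epsilon>3"
      using T(2)[OF ch] by blast
    note m = morD[OF \<gamma>(1)]
    have "word_act w x \<in> path_image \<gamma>" using m(3) by (metis pathfinish_in_path_image)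
    then have "dist x (word_act w x) \<le> \<delta>2" using \<gamma>(4) \<epsilon>3 by fastforce
    then obtain y where y: "y \<in> Fix w" "dist x y \<le> \<epsilon>2" using \<delta>2(2) \<gamma> m by blast
    obtain \<beta> where \<beta>: "path \<beta>" "pathstart \<beta> = x" "pathfinish \<beta> = y"
      "\<And>a b. a \<in> path_image \<beta> \<Longrightarrow> b \<in> path_image \<beta> \<Longrightarrow> dist a b \<le> dist x y"
      by (rule geodesic_path[OF geodesic]) blast
    let ?\<gamma>' = "\<beta> +++ (word_act w \<circ> reversepath \<beta>)"
    have m': "mor x w x ?\<gamma>'" using mor_fix_loop[of \<beta> w] \<beta> y m by simp
    have "dist x p \<le> \<epsilon>1" if "p \<in> path_image \<beta>" for p
      using \<beta>(4)[OF _ that, of x] \<beta>(2) y(2) \<epsilon>2(3) \<epsilon>1(1) pathstart_in_path_image[of \<beta>] by fastforce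
    moreover have "dist x (word_act w p) \<le> \<epsilon>1" if "p \<in> path_image \<beta>" for p
    proof -
      have "dist p y \<le> \<delta>1"
        using \<beta>(4)[OF that, of y] \<beta>(3) y(2) \<epsilon>2 pathfinish_in_path_image[of \<beta>] by fastforce
      then have "dist (word_act w p) (word_act w y) \<le> \<epsilon>1 / 2" using \<delta>1(2) m \<gamma>(2) by blast
      then have "dist y (word_act w p) \<le> \<epsilon>1 / 2" using y(1) by (simp add: Fix_def dist_commute)
      then show ?thesis using y(2) \<epsilon>2(3) dist_triangle[of x "word_act w p" y] by linarith
    qed
    ultimately have "path_image ?\<gamma>' \<subseteq> cball x \<epsilon>1"
      using \<beta> y by (auto simp: path_image_join path_image_compose pathstart_compose Fix_def)
    moreover have "path_image \<gamma> \<subseteq> cball x \<epsilon>1" using \<gamma>(4) \<epsilon>3(2) by auto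
    ultimately have "htp \<gamma> ?\<gamma>'"
      using m morD[OF m'] by (intro \<epsilon>1(2)[of _ _ x]) auto
    from path_class_eq[OF this] have g: "g = elem ?\<gamma>' w x"
      unfolding \<gamma>(3) by (intro elem_cong[OF \<gamma>(1) m']) auto
    \<comment> \<open>Relators are based at \<open>x0\<close>: the base path that
      \<open>elem\<close> puts in front becomes part of the conjugating path.\<close>
    let ?\<beta>' = "base_path x +++ \<beta>"
    have \<beta>': "path ?\<beta>'" "pathstart ?\<beta>' = x0" "pathfinish ?\<beta>' = y" using \<beta> base_path by auto
    have m'': "mor x0 w x0 (?\<beta>' +++ (word_act w \<circ> reversepath ?\<beta>'))"
      using mor_fix_loop[of ?\<beta>' w] \<beta>' y m by simp
    have "g = vertex_elem (?\<beta>' +++ (word_act w \<circ> reversepath ?\<beta>')) w"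
      unfolding g elem_def using m'' mor_elem[OF m'] \<beta> y m base_path path_word_act
      by (subst vertex_elem_eq_iff) (auto simp: class_simps Fix_def)
    \<comment> \<open>Relators carry reduced words, and reduction does not lengthen
      \<open>w\<close>.\<close>
    also have "\<dots> = vertex_elem (?\<beta>' +++ (word_act (reduce w) \<circ> reversepath ?\<beta>')) (reduce w)"
      using vertex_elem_reduce[OF m''] m by (simp add: word_act_reduce)
    also have "\<dots> \<in> fix_relators S x0 \<alpha> \<theta>"
    proof -
      have 1: "reduce w \<in> carrier (free_group S)" using m(4) by simp
      have 2: "length (reduce w) \<le> 4 * \<theta>" using length_reduce[of w] \<gamma>(2) assms by linarith
      have 3: "pathfinish ?\<beta>' \<in> Fix (reduce w)"
        unfolding \<beta>'(3) using y(1) m(4) by (simp add: Fix_def word_act_reduce)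
      show ?thesis
        unfolding fix_relators_eq mem_Collect_eq using 1 2 \<beta>'(1,2) 3
        by (intro exI[of _ "reduce w"] exI[of _ ?\<beta>'] conjI) (assumption | rule refl)+
    qed
    finally show ?thesis unfolding fix_kernel_def by (rule subsetD[OF normal_closure_incl])
  qed
  then show ?thesis using T(1) by blast
qed

end

section \<open>Monodromy of local cocycles\<close>

text \<open>\<open>c x y\<close> is the transition from \<open>x\<close> to \<open>y\<close> in a
  flat bundle with structure group \<open>H\<close>. The cocycle rule is imposed only on triples of
  pairwise close points; distant pairs may carry any value in \<open>H\<close>.\<close>

locale local_cocycle = group H for H (structure) +
  fixes \<eta> :: real and c :: "'x::metric_space \<Rightarrow> 'x \<Rightarrow> 'a"
  assumes \<eta>_pos: "\<eta> > 0"
    and c_closed [simp]: "c x y \<in> carrier H"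
    and c_mult: "dist x y \<le> \<eta> \<Longrightarrow> dist y z \<le> \<eta> \<Longrightarrow> dist x z \<le> \<eta> \<Longrightarrow> c x y \<otimes> c y z = c x z"
begin

lemma c_refl [simp]: "c x x = \<one>"
  using c_mult[of x x x] \<eta>_pos by (metis c_closed dist_self less_imp_le l_cancel_one')

text \<open>Transport \<open>c\<close> from a centre \<open>p0\<close> along straight segments, cut
  into \<open>N\<close> pieces. For nearby end points the two segments bound a ladder of small
  squares, and the cocycle rule moves the transport across one square at a time. A general normed
  space serves both the unit interval and the unit square.\<close>

lemma trivialization:
  fixes K :: "'v::real_normed_vector set" and h :: "'v \<Rightarrow> 'x"
  assumes K: "convex K" "compact K" and h: "continuous_on K h"
  shows "\<exists>\<phi> \<delta>. \<delta> > 0 \<and> (\<forall>p\<in>K. \<phi> p \<in> carrier H) \<and>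
    (\<forall>p\<in>K. \<forall>q\<in>K. dist p q < \<delta> \<longrightarrow> \<phi> q = \<phi> p \<otimes> c (h p) (h q))"
proof (cases "K = {}")
  case True
  then show ?thesis by (intro exI[of _ "\<lambda>_. \<one>"] exI[of _ 1]) auto
next
  case False
  then obtain p0 where p0: "p0 \<in> K" by blast
  obtain \<delta> where \<delta>: "\<delta> > 0" "\<And>p q. p \<in> K \<Longrightarrow> q \<in> K \<Longrightarrow> dist p q < \<delta> \<Longrightarrow> dist (h p) (h q) \<le> \<eta>"
    using compact_uniformly_continuous[OF h K(2)] \<eta>_pos unfolding uniformly_continuous_on_def
    by (metis less_imp_le dist_commute)
  obtain B where B: "\<And>q. q \<in> K \<Longrightarrow> dist p0 q \<le> B"
    using compact_imp_bounded[OF K(2)] bounded_any_center[of K p0] by auto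
  \<comment> \<open>One \<open>N\<close> for all segments, with pieces shorter than \<delta> / 2. As
    the rungs are also shorter than \<delta> / 2, the diagonals of the ladder stay below
    \<delta>.\<close>
  obtain N :: nat where N: "real N * (\<delta> / 2) > B" "N > 0"
  proof -
    obtain N where "B / (\<delta> / 2) < real N" using reals_Archimedean2 by blast
    then have "B < real (Suc N) * (\<delta> / 2)"
      using \<delta>(1) by (simp add: field_simps)
    then show thesis using that by blast
  qed
  define pt where "pt q i = p0 + (real i / real N) *\<^sub>R (q - p0)" for q i
  have pt_K: "pt q i \<in> K" if "q \<in> K" "i \<le> N" for q i
  proof -
    have "pt q i = (1 - real i / real N) *\<^sub>R p0 + (real i / real N) *\<^sub>R q"
      by (simp add: pt_def algebra_simps)
    then show ?thesis using K(1) p0 that N by (auto intro!: convexD)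
  qed
  have d1: "dist (pt p i) (pt q i) \<le> dist p q" if "i \<le> N" for p q i
  proof -
    have "pt p i - pt q i = (real i / real N) *\<^sub>R (p - q)" by (simp add: pt_def algebra_simps)
    then have "dist (pt p i) (pt q i) = (real i / real N) * dist p q" by (simp add: dist_norm)
    also have "\<dots> \<le> dist p q" using that N by (intro mult_left_le_one_le) auto
    finally show ?thesis .
  qed
  have d2: "dist (pt q i) (pt q (Suc i)) < \<delta> / 2" if "q \<in> K" for q i
  proof -
    have "pt q (Suc i) - pt q i = (1 / real N) *\<^sub>R (q - p0)"
      using N by (simp add: pt_def add_divide_distrib scaleR_add_left)
    then have "dist (pt q (Suc i)) (pt q i) = dist p0 q / real N"
      by (simp add: dist_norm norm_minus_commute)
    also have "\<dots> < \<delta> / 2" using B[OF that] N by (simp add: field_simps)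
    finally show ?thesis by (simp add: dist_commute)
  qed
  define L where "L q = rec_nat \<one> (\<lambda>i e. e \<otimes> c (h (pt q i)) (h (pt q (Suc i))))" for q
  have L0: "L q 0 = \<one>" and LS: "L q (Suc i) = L q i \<otimes> c (h (pt q i)) (h (pt q (Suc i)))" for q i
    by (simp_all add: L_def)
  have L_closed: "L q i \<in> carrier H" for q i by (induction i) (simp_all add: L0 LS)
  have L_step: "L q i = L p i \<otimes> c (h (pt p i)) (h (pt q i))"
    if pq: "p \<in> K" "q \<in> K" "dist p q < \<delta> / 2" and "i \<le> N" for p q i
    using \<open>i \<le> N\<close>
  proof (induction i)
    case 0
    then show ?case by (simp add: L0 pt_def)
  next
    case (Suc i)
    let ?p = "pt p i" and ?q = "pt q i" and ?p' = "pt p (Suc i)" and ?q' = "pt q (Suc i)"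
    have mem: "?p \<in> K" "?q \<in> K" "?p' \<in> K" "?q' \<in> K" using pt_K pq Suc.prems by auto
    have d: "dist ?p ?q < \<delta> / 2" "dist ?p' ?q' < \<delta> / 2" "dist ?p ?p' < \<delta> / 2" "dist ?q ?q' < \<delta> / 2"
      using d1[of i p q] d1[of "Suc i" p q] d2 pq Suc.prems by auto
    have "dist ?p ?q' < \<delta>" using dist_triangle[of ?p ?q' ?q] d by linarith
    then have hd: "dist (h ?p) (h ?q) \<le> \<eta>" "dist (h ?q) (h ?q') \<le> \<eta>" "dist (h ?p) (h ?q') \<le> \<eta>"
       "dist (h ?p) (h ?p') \<le> \<eta>" "dist (h ?p') (h ?q') \<le> \<eta>"
      using mem d \<delta>(1) by (auto intro!: \<delta>(2))
    have "L q (Suc i) = L p i \<otimes> (c (h ?p) (h ?q) \<otimes> c (h ?q) (h ?q'))"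
      using Suc by (simp add: LS m_assoc L_closed)
    \<comment> \<open>Both products equal \<open>c\<close> along the diagonal of the square.\<close>
    also have "\<dots> = L p i \<otimes> (c (h ?p) (h ?p') \<otimes> c (h ?p') (h ?q'))"
      using hd by (simp add: c_mult)
    also have "\<dots> = L p (Suc i) \<otimes> c (h ?p') (h ?q')" by (simp add: LS m_assoc L_closed)
    finally show ?case .
  qed
  have pt_N: "pt q N = q" for q using N by (simp add: pt_def)
  show ?thesis
  proof (rule exI[of _ "\<lambda>q. L q N"], rule exI[of _ "\<delta> / 2"], intro conjI ballI impI)
    fix p q assume "p \<in> K" "q \<in> K" "dist p q < \<delta> / 2"
    from L_step[OF this le_refl] show "L q N = L p N \<otimes> c (h p) (h q)" by (simp only: pt_N)
  qed (simp_all add: \<delta>(1) L_closed)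
qed

text \<open>A horizontal lift of \<gamma> in the bundle given by \<open>c\<close>. Read in the
  coordinates at the points of \<gamma>, it is not locally constant but changes by the
  transitions.\<close>

definition is_lift :: "(real \<Rightarrow> 'x) \<Rightarrow> (real \<Rightarrow> 'a) \<Rightarrow> bool" where
  "is_lift \<gamma> \<phi> \<longleftrightarrow> (\<forall>s\<in>{0..1}. \<phi> s \<in> carrier H) \<and>
     (\<exists>\<delta>>0. \<forall>s\<in>{0..1}. \<forall>s'\<in>{0..1}. dist s s' < \<delta> \<longrightarrow> \<phi> s' = \<phi> s \<otimes> c (\<gamma> s) (\<gamma> s'))"

definition holonomy :: "(real \<Rightarrow> 'x) \<Rightarrow> 'a" where
  "holonomy \<gamma> = (SOME d. \<exists>\<phi>. is_lift \<gamma> \<phi> \<and> d = inv \<phi> 0 \<otimes> \<phi> 1)"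

lemma is_liftI:
  "(\<And>s. s \<in> {0..1} \<Longrightarrow> \<phi> s \<in> carrier H) \<Longrightarrow> \<delta> > 0 \<Longrightarrow>
   (\<And>s s'. s \<in> {0..1} \<Longrightarrow> s' \<in> {0..1} \<Longrightarrow> dist s s' < \<delta> \<Longrightarrow> \<phi> s' = \<phi> s \<otimes> c (\<gamma> s) (\<gamma> s')) \<Longrightarrow> is_lift \<gamma> \<phi>"
  unfolding is_lift_def by blast

lemma is_liftE:
  assumes "is_lift \<gamma> \<phi>"
  obtains \<delta> where "\<delta> > 0"
    "\<And>s s'. s \<in> {0..1} \<Longrightarrow> s' \<in> {0..1} \<Longrightarrow> dist s s' < \<delta> \<Longrightarrow> \<phi> s' = \<phi> s \<otimes> c (\<gamma> s) (\<gamma> s')"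
  using assms unfolding is_lift_def by blast

lemma is_lift_closed: "is_lift \<gamma> \<phi> \<Longrightarrow> s \<in> {0..1} \<Longrightarrow> \<phi> s \<in> carrier H"
  by (simp add: is_lift_def)

lemma is_lift_exists: "path \<gamma> \<Longrightarrow> \<exists>\<phi>. is_lift \<gamma> \<phi>"
  using trivialization[of "{0..1::real}" \<gamma>] unfolding is_lift_def path_def by auto

lemma constant_unit_interval:
  fixes \<psi> :: "real \<Rightarrow> 'z"
  assumes "\<delta> > 0" "\<And>s s'. s \<in> {0..1} \<Longrightarrow> s' \<in> {0..1} \<Longrightarrow> dist s s' < \<delta> \<Longrightarrow> \<psi> s' = \<psi> s"
  shows "\<psi> 1 = \<psi> 0"
proof (rule connected_induction_simple[of "{0..1}" 0 1 "\<lambda>s. \<psi> s = \<psi> 0"])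
  fix a :: real assume a: "a \<in> {0..1}"
  show "\<exists>T. openin (top_of_set {0..1}) T \<and> a \<in> T \<and> (\<forall>x\<in>T. \<forall>y\<in>T. \<psi> x = \<psi> 0 \<longrightarrow> \<psi> y = \<psi> 0)"
  proof (rule exI[of _ "{0..1} \<inter> ball a \<delta>"], intro conjI ballI impI)
    show "openin (top_of_set {0..1}) ({0..1} \<inter> ball a \<delta>)" by (rule openin_open_Int) simp
    show "a \<in> {0..1} \<inter> ball a \<delta>" using a assms(1) by simp
    fix x y assume "x \<in> {0..1} \<inter> ball a \<delta>" "y \<in> {0..1} \<inter> ball a \<delta>" "\<psi> x = \<psi> 0"
    then show "\<psi> y = \<psi> 0" using assms(2)[OF a, of x] assms(2)[OF a, of y] by simp
  qed
qed auto

text \<open>Two lifts of the same path differ by a constant left factor, because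
  \<open>\<phi> s \<otimes> inv \<psi> s\<close> is locally constant in \<open>s\<close>. So the
  choice made in \<open>holonomy\<close> is immaterial.\<close>

lemma holonomy_eq:
  assumes \<phi>: "is_lift \<gamma> \<phi>"
  shows "holonomy \<gamma> = inv \<phi> 0 \<otimes> \<phi> 1"
proof -
  have "\<exists>d \<phi>. is_lift \<gamma> \<phi> \<and> d = inv \<phi> 0 \<otimes> \<phi> 1" using \<phi> by blast
  from someI_ex[OF this] obtain \<psi> where \<psi>: "is_lift \<gamma> \<psi>" "holonomy \<gamma> = inv \<psi> 0 \<otimes> \<psi> 1"
    unfolding holonomy_def by blast
  obtain \<delta>1 where 1: "\<delta>1 > 0"
    "\<And>s s'. s \<in> {0..1} \<Longrightarrow> s' \<in> {0..1} \<Longrightarrow> dist s s' < \<delta>1 \<Longrightarrow> \<phi> s' = \<phi> s \<otimes> c (\<gamma> s) (\<gamma> s')"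
    using is_liftE[OF \<phi>] by blast
  obtain \<delta>2 where 2: "\<delta>2 > 0"
    "\<And>s s'. s \<in> {0..1} \<Longrightarrow> s' \<in> {0..1} \<Longrightarrow> dist s s' < \<delta>2 \<Longrightarrow> \<psi> s' = \<psi> s \<otimes> c (\<gamma> s) (\<gamma> s')"
    using is_liftE[OF \<psi>(1)] by blast
  have "(\<lambda>s. \<phi> s \<otimes> inv \<psi> s) 1 = (\<lambda>s. \<phi> s \<otimes> inv \<psi> s) 0"
  proof (rule constant_unit_interval)
    show "min \<delta>1 \<delta>2 > 0" using 1(1) 2(1) by simp
    fix s s' :: real assume s: "s \<in> {0..1}" "s' \<in> {0..1}" "dist s s' < min \<delta>1 \<delta>2"
    then have "\<phi> s' = \<phi> s \<otimes> c (\<gamma> s) (\<gamma> s')" "\<psi> s' = \<psi> s \<otimes> c (\<gamma> s) (\<gamma> s')"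
      using 1(2)[of s s'] 2(2)[of s s'] by auto
    then show "\<phi> s' \<otimes> inv \<psi> s' = \<phi> s \<otimes> inv \<psi> s"
      using is_lift_closed[OF \<phi> s(1)] is_lift_closed[OF \<psi>(1) s(1)]
      by (simp add: inv_mult_group m_assoc inv_solve_left flip: m_assoc[of "c _ _" "inv c _ _"])
  qed
  moreover have "\<phi> 0 \<in> carrier H" "\<phi> 1 \<in> carrier H" "\<psi> 0 \<in> carrier H" "\<psi> 1 \<in> carrier H"
    using is_lift_closed \<phi> \<psi>(1) by auto
  ultimately show ?thesis
    unfolding \<psi>(2) by (metis inv_closed inv_solve_left inv_solve_right m_assoc m_closed)
qed

lemma holonomy_closed [simp]: "path \<gamma> \<Longrightarrow> holonomy \<gamma> \<in> carrier H"
  using is_lift_exists[of \<gamma>] by (auto simp: holonomy_eq is_lift_closed)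

text \<open>A trivialization over the square of the homotopy restricts to lifts of both paths on two
  opposite sides. It is constant on the other two, where the homotopy rests at the end
  points.\<close>

lemma holonomy_htp:
  assumes "htp \<gamma> \<delta>"
  shows "holonomy \<gamma> = holonomy \<delta>"
proof -
  obtain h :: "real \<times> real \<Rightarrow> 'x" where h: "continuous_on ({0..1} \<times> {0..1}) h" "\<forall>x\<in>{0..1}. h (0, x) = \<gamma> x"
    "\<forall>x\<in>{0..1}. h (1, x) = \<delta> x" "\<forall>s\<in>{0..1}. h (s, 0) = \<gamma> 0 \<and> h (s, 1) = \<gamma> 1"
    using assms unfolding homotopic_paths by (auto simp: pathstart_def pathfinish_def)
  have "convex ({0..1::real} \<times> {0..1::real})" "compact ({0..1::real} \<times> {0..1::real})"
    by (auto intro: convex_Times compact_Times)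
  from trivialization[OF this h(1)] obtain \<phi> e where \<phi>': "e > 0"
    "\<forall>p\<in>{0..1} \<times> {0..1}. \<phi> p \<in> carrier H"
    "\<forall>p\<in>{0..1} \<times> {0..1}. \<forall>q\<in>{0..1} \<times> {0..1}. dist p q < e \<longrightarrow> \<phi> q = \<phi> p \<otimes> c (h p) (h q)"
    by (elim exE conjE)
  note \<phi> = \<phi>'(1) bspec[OF \<phi>'(2)] mp[OF bspec[OF bspec[OF \<phi>'(3)]]]
  have d: "dist (u, v) (u, v') = dist v v'" "dist (u, v) (u', v) = dist u u'" for u v u' v' :: real
    by (simp_all add: dist_Pair_Pair)
  have "is_lift \<gamma> (\<lambda>s. \<phi> (0, s))"
    using \<phi>(2) \<phi>(3)[of "(0, _)" "(0, _)"] h(2) by (intro is_liftI[OF _ \<phi>(1)]) (auto simp: d)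
  moreover have "is_lift \<delta> (\<lambda>s. \<phi> (1, s))"
    using \<phi>(2) \<phi>(3)[of "(1, _)" "(1, _)"] h(3) by (intro is_liftI[OF _ \<phi>(1)]) (auto simp: d)
  moreover have "(\<lambda>s. \<phi> (s, 0)) 1 = (\<lambda>s. \<phi> (s, 0)) 0"
    using \<phi>(2) \<phi>(3)[of "(_, 0)" "(_, 0)"] h(4) by (intro constant_unit_interval[OF \<phi>(1)]) (auto simp: d)
  moreover have "(\<lambda>s. \<phi> (s, 1)) 1 = (\<lambda>s. \<phi> (s, 1)) 0"
    using \<phi>(2) \<phi>(3)[of "(_, 1)" "(_, 1)"] h(4) by (intro constant_unit_interval[OF \<phi>(1)]) (auto simp: d)
  ultimately show ?thesis by (simp add: holonomy_eq)
qed

lemma holonomy_join: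
  assumes "path \<gamma>" "path \<delta>" "pathfinish \<gamma> = pathstart \<delta>"
  shows "holonomy (\<gamma> +++ \<delta>) = holonomy \<gamma> \<otimes> holonomy \<delta>"
proof -
  obtain \<phi> where \<phi>: "is_lift (\<gamma> +++ \<delta>) \<phi>" using is_lift_exists[of "\<gamma> +++ \<delta>"] assms by auto
  obtain e where e: "e > 0"
    "\<And>s s'. s \<in> {0..1} \<Longrightarrow> s' \<in> {0..1} \<Longrightarrow> dist s s' < e \<Longrightarrow> \<phi> s' = \<phi> s \<otimes> c ((\<gamma> +++ \<delta>) s) ((\<gamma> +++ \<delta>) s')"
    using is_liftE[OF \<phi>] by blast
  have j1: "(\<gamma> +++ \<delta>) (s / 2) = \<gamma> s" if "s \<in> {0..1}" for s
    using that by (simp add: joinpaths_def)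
  have j2: "(\<gamma> +++ \<delta>) (1 / 2 + s / 2) = \<delta> s" if "s \<in> {0..1}" for s
    using that assms(3) by (auto simp: joinpaths_def pathstart_def pathfinish_def field_simps)
  have "is_lift \<gamma> (\<lambda>s. \<phi> (s / 2))"
  proof (rule is_liftI[OF _ e(1)])
    fix s s' :: real assume "s \<in> {0..1}" "s' \<in> {0..1}" "dist s s' < e"
    then show "\<phi> (s' / 2) = \<phi> (s / 2) \<otimes> c (\<gamma> s) (\<gamma> s')"
      using e(2)[of "s / 2" "s' / 2"] j1[of s] j1[of s'] by (auto simp: dist_real_def)
  qed (use is_lift_closed[OF \<phi>] in auto)
  moreover have "is_lift \<delta> (\<lambda>s. \<phi> (1 / 2 + s / 2))"
  proof (rule is_liftI[OF _ e(1)])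
    fix s s' :: real assume "s \<in> {0..1}" "s' \<in> {0..1}" "dist s s' < e"
    then show "\<phi> (1 / 2 + s' / 2) = \<phi> (1 / 2 + s / 2) \<otimes> c (\<delta> s) (\<delta> s')"
      using e(2)[of "1 / 2 + s / 2" "1 / 2 + s' / 2"] j2[of s] j2[of s'] by (auto simp: dist_real_def)
  qed (use is_lift_closed[OF \<phi>] in auto)
  moreover have "\<phi> 0 \<in> carrier H" "\<phi> (1 / 2) \<in> carrier H" "\<phi> 1 \<in> carrier H"
    using is_lift_closed[OF \<phi>] by auto
  ultimately show ?thesis
    using \<phi> by (simp add: holonomy_eq m_assoc)
qed

text \<open>For a path of diameter at most \<eta>, the transitions from its starting point already
  form a lift.\<close>

lemma holonomy_small:
  assumes "path \<gamma>" "\<And>p q. p \<in> path_image \<gamma> \<Longrightarrow> q \<in> path_image \<gamma> \<Longrightarrow> dist p q \<le> \<eta>"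
  shows "holonomy \<gamma> = c (pathstart \<gamma>) (pathfinish \<gamma>)"
proof -
  have "is_lift \<gamma> (\<lambda>s. c (\<gamma> 0) (\<gamma> s))"
    using assms(2) by (intro is_liftI[of _ 1]) (auto simp: path_image_def c_mult)
  then show ?thesis by (simp add: holonomy_eq pathstart_def pathfinish_def)
qed

text \<open>\<open>J\<close> is a gauge transformation from \<open>c\<close> to its pullback along
  \<open>h\<close>: it turns a lift \<open>\<phi>\<close> of \<gamma> into the lift
  \<open>\<phi> s \<otimes> inv J (\<gamma> s)\<close> of \<open>h \<circ> \<gamma>\<close>. The
  conclusion has the shape of \<open>j_D\<close>.\<close>

lemma holonomy_compose:
  assumes \<gamma>: "path \<gamma>" and h: "continuous_on UNIV h"
    and J: "\<And>y. J y \<in> carrier H"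
    and c: "\<And>y z. dist y z \<le> \<eta> \<Longrightarrow> dist (h y) (h z) \<le> \<eta> \<Longrightarrow> J y \<otimes> c y z = c (h y) (h z) \<otimes> J z"
  shows "holonomy (h \<circ> \<gamma>) \<otimes> J (pathfinish \<gamma>) = J (pathstart \<gamma>) \<otimes> holonomy \<gamma>"
proof -
  obtain \<phi> where \<phi>: "is_lift \<gamma> \<phi>" using is_lift_exists[OF \<gamma>] by blast
  obtain e where e: "e > 0"
    "\<And>s s'. s \<in> {0..1} \<Longrightarrow> s' \<in> {0..1} \<Longrightarrow> dist s s' < e \<Longrightarrow> \<phi> s' = \<phi> s \<otimes> c (\<gamma> s) (\<gamma> s')"
    using is_liftE[OF \<phi>] by blast
  have u: "\<exists>d>0. \<forall>s\<in>{0..1}. \<forall>s'\<in>{0..1}. dist s s' < d \<longrightarrow> dist (p s) (p s') \<le> \<eta>" if p: "path p"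
    for p :: "real \<Rightarrow> 'x"
  proof -
    have "uniformly_continuous_on {0..1} p"
      using p unfolding path_def by (rule compact_uniformly_continuous) simp
    then show ?thesis
      using \<eta>_pos unfolding uniformly_continuous_on_def by (meson less_imp_le dist_commute_lessI)
  qed
  have h\<gamma>: "path (h \<circ> \<gamma>)" using \<gamma> h by (intro path_continuous_image) (auto intro: continuous_on_subset)
  obtain d1 where d1: "d1 > 0" "\<And>s s'. s \<in> {0..1} \<Longrightarrow> s' \<in> {0..1} \<Longrightarrow> dist s s' < d1 \<Longrightarrow> dist (\<gamma> s) (\<gamma> s') \<le> \<eta>"
    using u[OF \<gamma>] by blast
  obtain d2 where d2: "d2 > 0" "\<And>s s'. s \<in> {0..1} \<Longrightarrow> s' \<in> {0..1} \<Longrightarrow> dist s s' < d2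
    \<Longrightarrow> dist (h (\<gamma> s)) (h (\<gamma> s')) \<le> \<eta>"
    using u[OF h\<gamma>] by auto
  have "is_lift (h \<circ> \<gamma>) (\<lambda>s. \<phi> s \<otimes> inv J (\<gamma> s))"
  proof (rule is_liftI)
    show "min e (min d1 d2) > 0" using e d1 d2 by simp
    fix s s' :: real assume s: "s \<in> {0..1}" "s' \<in> {0..1}" "dist s s' < min e (min d1 d2)"
    have \<phi>s: "\<phi> s \<in> carrier H" using is_lift_closed[OF \<phi>] s by simp
    have "J (\<gamma> s) \<otimes> c (\<gamma> s) (\<gamma> s') = c (h (\<gamma> s)) (h (\<gamma> s')) \<otimes> J (\<gamma> s')"
      using s d1 d2 by (intro c) auto
    then have "c (\<gamma> s) (\<gamma> s') \<otimes> inv J (\<gamma> s') = inv J (\<gamma> s) \<otimes> c (h (\<gamma> s)) (h (\<gamma> s'))"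
      using J by (metis c_closed inv_closed inv_solve_left inv_solve_right m_assoc m_closed)
    then show "\<phi> s' \<otimes> inv J (\<gamma> s') = \<phi> s \<otimes> inv J (\<gamma> s) \<otimes> c ((h \<circ> \<gamma>) s) ((h \<circ> \<gamma>) s')"
      using e(2)[OF s(1,2)] s(3) \<phi>s J by (simp add: m_assoc)
  qed (use is_lift_closed[OF \<phi>] J in auto)
  moreover have "\<phi> 0 \<in> carrier H" "\<phi> 1 \<in> carrier H" using is_lift_closed[OF \<phi>] by auto
  ultimately show ?thesis
    using \<phi> J by (simp add: holonomy_eq inv_mult_group m_assoc pathstart_def pathfinish_def)
qed

end

section \<open>Comparing the two groups at one scale\<close>

declare one_FactGroup [simp del] mult_FactGroup [simp del]

definition short_relators :: "('g, 'b) monoid_scheme \<Rightarrow> nat \<Rightarrow> (nat \<Rightarrow> 'g) \<Rightarrow> nat \<Rightarrow> nat word set" where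
  "short_relators G n a r = {u \<in> carrier (free_group {..<n}). length u \<le> r \<and> word_val G a u = \<one>\<^bsub>G\<^esub>}"

definition short_kernel :: "('g, 'b) monoid_scheme \<Rightarrow> nat \<Rightarrow> (nat \<Rightarrow> 'g) \<Rightarrow> nat \<Rightarrow> nat word set" where
  "short_kernel G n a r = normal_closure (free_group {..<n}) (short_relators G n a r)"

lemma short_kernel_normal: "short_kernel G n a r \<lhd> free_group {..<n}"
  unfolding short_kernel_def
  by (intro normal_closure_normal group_free_group) (auto simp: short_relators_def)

lemma short_relators_subset: "short_relators G n a r \<subseteq> short_kernel G n a r"
  unfolding short_kernel_def by (rule normal_closure_incl)

text \<open>The data of a coarse equivalence between \<open>\<Lambda> / N\<close> and \<open>X\<close> at scale \<open>t\<close>, in terms of words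
  and chains: \<open>f\<close> and \<open>q\<close> are the two quasi-isometries, and \<open>M\<close> bounds everything.\<close>

locale comparison = warped S x0 \<alpha> + group \<Lambda>
  for S :: "('x::metric_space \<Rightarrow> 'x) set" and x0 \<alpha> and \<Lambda> :: "'g monoid" (structure) +
  fixes n :: nat and a :: "nat \<Rightarrow> 'g" and N :: "'g set" and t :: real and M :: nat
    and f :: "'g set \<Rightarrow> 'x" and q :: "'x \<Rightarrow> 'g set"
  assumes a: "a \<in> {..<n} \<rightarrow> carrier \<Lambda>"
    and N: "N \<lhd> \<Lambda>" and t: "t > 0"
    and f_step: "\<And>v i. v \<in> rcosets N \<Longrightarrow> i < n \<Longrightarrow> \<exists>e. chain t M (f v) (f (v #> a i)) e"
    and q_mem: "\<And>x. q x \<in> rcosets N"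
    and fq: "\<And>x. \<exists>e. chain t M x (f (q x)) e"
    and q_small: "\<And>x y. dist x y \<le> 1 / t \<Longrightarrow>
      \<exists>u\<in>lists ({..<n} \<times> UNIV). length u \<le> M \<and> q y = q x #> word_val \<Lambda> a u"
    and q_jump: "\<And>l y. l \<in> S \<times> UNIV \<Longrightarrow>
      \<exists>u\<in>lists ({..<n} \<times> UNIV). length u \<le> M \<and> q y = q (letter_act l y) #> word_val \<Lambda> a u"
    and qf: "\<And>v. v \<in> rcosets N \<Longrightarrow>
      \<exists>u\<in>lists ({..<n} \<times> UNIV). length u \<le> M \<and> q (f v) = v #> word_val \<Lambda> a u"
begin

abbreviation "V \<equiv> rcosets N"
abbreviation "F \<equiv> free_group {..<n}"
abbreviation "W \<equiv> lists ({..<n} \<times> (UNIV :: bool set))"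
abbreviation "ev \<equiv> word_val \<Lambda> a"
abbreviation "lv \<equiv> letter_val \<Lambda> a"

sublocale ev: free_eval \<Lambda> "{..<n}" a
  by unfold_locales (fact a)

sublocale F: group F by (rule group_free_group)

sublocale \<Gamma>: group \<Gamma> by (rule group_pi1_semidirect)

sublocale N: normal N \<Lambda> by (rule N)

subsection \<open>From words to the group of the warped system\<close>

text \<open>The chains of different edges are chosen independently; consistency around circuits only
  appears modulo the kernels.\<close>

definition edge :: "'g set \<Rightarrow> nat \<Rightarrow> (real \<Rightarrow> 'x) set \<times> ('x \<Rightarrow> 'x) word" where
  "edge v i = (SOME e. chain t M (f v) (f (v #> a i)) e)"

text \<open>A letter \<open>(i, False)\<close> at \<open>v\<close> runs backwards along the edge
  that ends in \<open>v\<close>. With this choice a cancelling pair contributes exactly the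
  identity, without passing to a quotient.\<close>

fun letter_edge :: "'g set \<Rightarrow> nat \<times> bool \<Rightarrow> (real \<Rightarrow> 'x) set \<times> ('x \<Rightarrow> 'x) word" where
  "letter_edge v (i, b) = (if b then edge v i else inv\<^bsub>\<Gamma>\<^esub> edge (v #> inv a i) i)"

text \<open>Reads a word along the Cayley graph from the vertex \<open>v\<close>. This is a cocycle
  for the right action of words on the cosets, and a homomorphism on the words that fix
  \<open>v\<close>, that is, whose value lies in \<open>N\<close>.\<close>

fun E :: "'g set \<Rightarrow> nat word \<Rightarrow> (real \<Rightarrow> 'x) set \<times> ('x \<Rightarrow> 'x) word" where
  "E v [] = \<one>\<^bsub>\<Gamma>\<^esub>"
| "E v (l # u) = letter_edge v l \<otimes>\<^bsub>\<Gamma>\<^esub> E (v #> lv l) u"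

lemma edge_chain: "v \<in> V \<Longrightarrow> i < n \<Longrightarrow> chain t M (f v) (f (v #> a i)) (edge v i)"
  unfolding edge_def by (rule someI_ex) (rule f_step)

lemma letter_edge_chain:
  assumes "v \<in> V" "l \<in> {..<n} \<times> UNIV"
  shows "chain t M (f v) (f (v #> lv l)) (letter_edge v l)"
proof -
  obtain i b where l: "l = (i, b)" "i < n" using assms(2) by (cases l) auto
  have ai: "a i \<in> carrier \<Lambda>" using a l by auto
  show ?thesis
  proof (cases b)
    case False
    have "v #> inv a i #> a i = v" using assms ai by (simp add: N.rcosets_act_mult)
    then show ?thesis
      using False l chain_reverse[OF edge_chain[of "v #> inv a i" i]] assms ai by simp
  qed (use l edge_chain assms in simp)
qed

lemma letter_edge_closed [simp]: "v \<in> V \<Longrightarrow> l \<in> {..<n} \<times> UNIV \<Longrightarrow> letter_edge v l \<in> carrier \<Gamma>"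
  using chain_closed[OF letter_edge_chain] .

lemma letter_edge_inv:
  assumes "v \<in> V" "l \<in> {..<n} \<times> UNIV"
  shows "letter_edge v l \<otimes>\<^bsub>\<Gamma>\<^esub> letter_edge (v #> lv l) (letter_inv l) = \<one>\<^bsub>\<Gamma>\<^esub>"
proof -
  obtain i b where l: "l = (i, b)" "i < n" using assms(2) by (cases l) auto
  have ai: "a i \<in> carrier \<Lambda>" using a l by auto
  have "edge v i \<in> carrier \<Gamma>" "edge (v #> inv a i) i \<in> carrier \<Gamma>"
    using assms l ai edge_chain[THEN chain_closed] by auto
  then show ?thesis using l assms ai by (auto simp: N.rcosets_act_mult)
qed

lemma E_chain: "v \<in> V \<Longrightarrow> u \<in> W \<Longrightarrow> chain t (length u * M) (f v) (f (v #> ev u)) (E v u)"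
proof (induction u arbitrary: v)
  case Nil
  then show ?case using chain_nil by simp
next
  case (Cons l u)
  then have l: "l \<in> {..<n} \<times> UNIV" and u: "u \<in> W" by auto
  have "chain t (length u * M) (f (v #> lv l)) (f (v #> lv l #> ev u)) (E (v #> lv l) u)"
    using Cons l u by (intro Cons.IH) (simp_all del: letter_val.simps)
  from chain_append[OF letter_edge_chain[OF Cons.prems(1) l] this] show ?case
    using Cons.prems l u by (simp add: N.rcosets_act_mult del: letter_val.simps letter_edge.simps)
qed

lemma E_closed [simp]: "v \<in> V \<Longrightarrow> u \<in> W \<Longrightarrow> E v u \<in> carrier \<Gamma>"
  using chain_closed[OF E_chain] .

lemma E_append:
  "v \<in> V \<Longrightarrow> u \<in> W \<Longrightarrow> u' \<in> W \<Longrightarrow> E v (u @ u') = E v u \<otimes>\<^bsub>\<Gamma>\<^esub> E (v #> ev u) u'"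
  by (induction u arbitrary: v)
     (simp_all add: \<Gamma>.m_assoc N.rcosets_act_mult del: letter_val.simps letter_edge.simps)

lemma E_reduce:
  assumes v: "v \<in> V" and u: "u \<in> W"
  shows "E v (reduce u) = E v u"
proof -
  \<comment> \<open>The invariant is the function of all starting vertices at once, as a letter
    moves the start of the remaining word. Outside \<open>V\<close> it is normalized so that
    extensionality applies.\<close>
  define k where "k u v = (if v \<in> V then E v u else undefined)" for u v
  have k: "k u v = E v u" if "v \<in> V" for u v using that by (simp add: k_def)
  have kI: "k u = k u'" if "\<And>v. v \<in> V \<Longrightarrow> E v u = E v u'" for u u'
    by (rule ext) (simp add: k_def that)
  have "k (reduce u) = k u"
  proof (rule reduce_invariant[where A = "{..<n}", OF _ _ u])
    fix l :: "nat \<times> bool" and u assume l: "l \<in> {..<n} \<times> UNIV" and u: "u \<in> W"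
    have "E v (l # letter_inv l # u) = E v u" if "v \<in> V" for v
      using that l u ev.letter_val_inv[OF l] letter_edge_inv[OF that l]
      by (simp add: N.rcosets_act_mult flip: \<Gamma>.m_assoc del: letter_val.simps letter_edge.simps
        letter_inv.simps)
    then show "k (l # letter_inv l # u) = k u" by (rule kI)
  next
    fix l :: "nat \<times> bool" and u u' assume *: "l \<in> {..<n} \<times> UNIV" "k u = k u'"
    have "E v (l # u) = E v (l # u')" if "v \<in> V" for v
    proof -
      have v': "v #> lv l \<in> V" using that *(1) by (simp del: letter_val.simps)
      have "E (v #> lv l) u = E (v #> lv l) u'" using fun_cong[OF *(2), of "v #> lv l"]
        by (simp only: k[OF v'])
      then show ?thesis by simp
    qed
    then show "k (l # u) = k (l # u')" by (rule kI)
  qed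
  then have "k (reduce u) v = k u v" by (rule fun_cong)
  then show ?thesis by (simp only: k[OF v])
qed

lemma E_inv:
  assumes v: "v \<in> V" and u: "u \<in> W"
  shows "E (v #> ev u) (word_inv u) = inv\<^bsub>\<Gamma>\<^esub> E v u"
proof -
  have W: "word_inv u \<in> W" using u by (simp only: word_inv_lists)
  have v': "v #> ev u \<in> V" using v u by simp
  have "E v u \<otimes>\<^bsub>\<Gamma>\<^esub> E (v #> ev u) (word_inv u) = E v (reduce (u @ word_inv u))"
    using E_append[OF v u W] E_reduce[OF v, of "u @ word_inv u"] u W by (simp del: reduce_word_inv)
  then have "E v u \<otimes>\<^bsub>\<Gamma>\<^esub> E (v #> ev u) (word_inv u) = \<one>\<^bsub>\<Gamma>\<^esub>" by simp
  from \<Gamma>.inv_comm[OF this E_closed[OF v u] E_closed[OF v' W]]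
  show ?thesis by (rule \<Gamma>.inv_equality[symmetric, OF _ E_closed[OF v u] E_closed[OF v' W]])
qed

lemma E_short_kernel:
  assumes K: "\<And>x e. chain t (r * M) x x e \<Longrightarrow> e \<in> K" and "K \<lhd> \<Gamma>"
    and u: "u \<in> short_kernel \<Lambda> n a r" and v: "v \<in> V"
  shows "E v u \<in> K"
proof -
  interpret K: normal K \<Gamma> by fact
  \<comment> \<open>All \<open>v\<close> are required because conjugation by \<open>x\<close> moves
    the vertex to \<open>v #> ev x\<close>; triviality in \<Lambda> makes the word closed there, so
    the two contributions of \<open>x\<close> are inverse to each other.\<close>
  let ?Z = "{u \<in> carrier F. ev u = \<one> \<and> (\<forall>v\<in>V. E v u \<in> K)}"
  have W: "u \<in> W" if "u \<in> carrier F" for u using that by (simp add: carrier_free_group)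
  have "?Z \<lhd> F"
    unfolding F.normal_inv_iff
  proof (intro conjI ballI)
    show "subgroup ?Z F"
    proof (rule F.subgroupI)
      show "?Z \<noteq> {}" by (intro ex_in_conv[THEN iffD1] exI[of _ "[]"]) (auto simp: carrier_free_group)
      show "inv\<^bsub>F\<^esub> u \<in> ?Z" if "u \<in> ?Z" for u
      proof -
        have u: "u \<in> carrier F" "u \<in> W" "ev u = \<one>" using that W by auto
        have "E v (word_inv u) \<in> K" if "v \<in> V" for v
          using E_inv[of v u] u that \<open>u \<in> ?Z\<close> by simp
        then show ?thesis
          using u by (simp add: inv_free_group ev.word_val_reduce ev.word_val_inv E_reduce)
      qed
      show "u \<otimes>\<^bsub>F\<^esub> w \<in> ?Z" if "u \<in> ?Z" "w \<in> ?Z" for u w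
      proof -
        have "u \<in> W" "w \<in> W" using that W by auto
        then show ?thesis using that
          by (simp add: E_reduce E_append ev.word_val_reduce ev.word_val_append)
      qed
    qed auto
    show "x \<otimes>\<^bsub>F\<^esub> u \<otimes>\<^bsub>F\<^esub> inv\<^bsub>F\<^esub> x \<in> ?Z" if x: "x \<in> carrier F" and "u \<in> ?Z" for x u
    proof -
      have u: "u \<in> carrier F" "u \<in> W" "ev u = \<one>" "x \<in> W" using that W by auto
      have eq: "x \<otimes>\<^bsub>F\<^esub> u \<otimes>\<^bsub>F\<^esub> inv\<^bsub>F\<^esub> x = reduce (x @ u @ word_inv x)"
        using x by (simp add: inv_free_group)
      have "E v (x @ u @ word_inv x) \<in> K" if "v \<in> V" for v
      proof -
        have "E v (x @ u @ word_inv x) = E v x \<otimes>\<^bsub>\<Gamma>\<^esub> E (v #> ev x) u \<otimes>\<^bsub>\<Gamma>\<^esub> inv\<^bsub>\<Gamma>\<^esub> E v x"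
          using that u by (simp add: E_append E_inv \<Gamma>.m_assoc)
        then show ?thesis
          using K.inv_op_closed2[of "E v x" "E (v #> ev x) u"] that u \<open>u \<in> ?Z\<close> by simp
      qed
      then show ?thesis
        unfolding eq using u
        by (simp add: E_reduce ev.word_val_reduce ev.word_val_append ev.word_val_inv)
    qed
  qed
  moreover have "short_relators \<Lambda> n a r \<subseteq> ?Z"
  proof
    fix u assume u: "u \<in> short_relators \<Lambda> n a r"
    then have *: "u \<in> W" "length u * M \<le> r * M" "ev u = \<one>" "u \<in> carrier F"
      using W by (auto simp: short_relators_def)
    have "E v u \<in> K" if "v \<in> V" for v
      using E_chain[OF that *(1)] that * by (intro K chain_pad[OF _ *(2) t]) simp
    then show "u \<in> ?Z" using * by simp
  qed
  ultimately have "short_kernel \<Lambda> n a r \<subseteq> ?Z"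
    unfolding short_kernel_def by (rule normal_closure_least)
  then show ?thesis using u v by blast
qed

subsection \<open>From the group of the warped system to words\<close>

text \<open>The default \<open>[]\<close> keeps every value a word over the generators, so that the
  cocycle built from it is defined for all pairs of points.\<close>

definition step_word :: "'x \<Rightarrow> 'x \<Rightarrow> nat word" where
  "step_word x y =
     (if \<exists>u\<in>W. length u \<le> M \<and> q y = q x #> ev u
      then SOME u. u \<in> W \<and> length u \<le> M \<and> q y = q x #> ev u else [])"

lemma step_word_props:
  assumes "\<exists>u\<in>W. length u \<le> M \<and> q y = q x #> ev u"
  shows "step_word x y \<in> W" "length (step_word x y) \<le> M" "q y = q x #> ev (step_word x y)"
proof -
  have "\<exists>u. u \<in> W \<and> length u \<le> M \<and> q y = q x #> ev u" using assms by blast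
  from someI_ex[OF this]
  show "step_word x y \<in> W" "length (step_word x y) \<le> M" "q y = q x #> ev (step_word x y)"
    using assms by (auto simp: step_word_def)
qed

lemma step_word_W [simp]: "step_word x y \<in> W"
  using step_word_props(1) by (cases "\<exists>u\<in>W. length u \<le> M \<and> q y = q x #> ev u") (auto simp: step_word_def)

lemmas step_word_small = step_word_props[OF q_small]
lemmas step_word_jump = step_word_props[OF q_jump]

end

text \<open>The three lower bounds on \<open>\<rho>\<close> are the lengths of the closed words that have to be
  trivial: around the square spanned by two nearby points and a jump, around an edge \<open>v\<close>, \<open>v a\<close>
  and its image under \<open>q \<circ> f\<close>, and along a relator of \<open>K\<^sub>\<theta>\<close>.\<close>

locale comparison_short = comparison S x0 \<alpha> \<Lambda> n a N t M f q
  for S :: "('x::metric_space \<Rightarrow> 'x) set" and x0 \<alpha> and \<Lambda> :: "'g monoid" (structure)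
    and n a N t M f q +
  fixes \<rho> \<theta> :: nat
  assumes short: "\<And>u. u \<in> W \<Longrightarrow> length u \<le> \<rho> \<Longrightarrow> ev u \<in> N \<Longrightarrow> ev u = \<one>\<^bsub>\<Lambda>\<^esub>"
    and \<rho>1: "4 * M \<le> \<rho>" and \<rho>2: "M * M + 2 * M + 1 \<le> \<rho>" and \<rho>3: "4 * \<theta> * M \<le> \<rho>"
begin

abbreviation "R \<equiv> short_kernel \<Lambda> n a \<rho>"

sublocale R: normal R F by (rule short_kernel_normal)

abbreviation "H \<equiv> F Mod R"

sublocale H: group H by (rule R.factorgroup_is_group)

definition cl :: "nat word \<Rightarrow> nat word set" where
  "cl u = R #>\<^bsub>F\<^esub> reduce u"

lemma cl_closed [simp]: "u \<in> W \<Longrightarrow> cl u \<in> carrier H"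
  by (auto simp: cl_def carrier_FactGroup)

lemma cl_append: "u \<in> W \<Longrightarrow> u' \<in> W \<Longrightarrow> cl (u @ u') = cl u \<otimes>\<^bsub>H\<^esub> cl u'"
  unfolding cl_def mult_FactGroup by (subst R.rcos_sum) auto

lemma cl_Nil [simp]: "cl [] = \<one>\<^bsub>H\<^esub>"
  using F.coset_mult_one[OF R.subset] by (simp add: cl_def one_FactGroup)

lemma cl_eq_one_iff: "u \<in> W \<Longrightarrow> cl u = \<one>\<^bsub>H\<^esub> \<longleftrightarrow> reduce u \<in> R"
  by (simp add: cl_def one_FactGroup R.rcos_eq_self_iff)

lemma Nil_in_R [simp]: "[] \<in> R"
  using R.one_closed by simp

lemma cl_inv: "u \<in> W \<Longrightarrow> inv\<^bsub>H\<^esub> cl u = cl (word_inv u)"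
  by (rule H.inv_equality) (simp_all add: cl_append[symmetric] cl_eq_one_iff)

text \<open>The point where residuality enters: by \<open>short\<close>, a word of length at most
  \<open>\<rho>\<close> that closes up in the quotient is trivial in \<Lambda>, so its reduction is
  among the relators that generate \<open>R\<close>.\<close>

lemma cl_closed_word:
  assumes u: "u \<in> W" "length u \<le> \<rho>" and v: "v \<in> V" "v #> ev u = v"
  shows "cl u = \<one>\<^bsub>H\<^esub>"
proof -
  have "ev u \<in> N" using N.rcosets_stabilizer v u by simp
  then have "ev u = \<one>" using short u by blast
  then have "reduce u \<in> short_relators \<Lambda> n a \<rho>"
    using u length_reduce[of u] by (simp add: short_relators_def ev.word_val_reduce)
  then show ?thesis using subsetD[OF short_relators_subset] u by (simp add: cl_eq_one_iff)
qed

lemma cl_eqI: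
  assumes "u \<in> W" "u' \<in> W" "length u + length u' \<le> \<rho>" "v \<in> V" "v #> ev u = v #> ev u'"
  shows "cl u = cl u'"
proof -
  have 1: "v #> ev (u @ word_inv u') = v #> ev u #> inv ev u'"
    using assms(1,2,4) by (simp add: ev.word_val_append ev.word_val_inv N.rcosets_act_mult)
  have 2: "v #> ev u' #> inv ev u' = v" using assms(1,2,4) by (simp add: N.rcosets_act_mult)
  have "cl (u @ word_inv u') = \<one>\<^bsub>H\<^esub>"
  proof (rule cl_closed_word[OF _ _ assms(4)])
    show "v #> ev (u @ word_inv u') = v" unfolding 1 assms(5) by (rule 2)
  qed (use assms(1-3) in auto)
  then have "cl u \<otimes>\<^bsub>H\<^esub> inv\<^bsub>H\<^esub> cl u' = \<one>\<^bsub>H\<^esub>" using assms by (simp add: cl_append cl_inv)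
  then show ?thesis using assms by (metis H.inv_closed H.inv_equality H.inv_inv cl_closed)
qed

text \<open>Two routes from \<open>q x\<close> to \<open>q z\<close>, of total length at most
  \<open>3 * M\<close>.\<close>

lemma cl_step_mult:
  assumes "q z = q x #> ev (step_word x z)" "length (step_word x z) \<le> M"
    "q y = q x #> ev (step_word x y)" "length (step_word x y) \<le> M"
    "q z = q y #> ev (step_word y z)" "length (step_word y z) \<le> M"
  shows "cl (step_word x y) \<otimes>\<^bsub>H\<^esub> cl (step_word y z) = cl (step_word x z)"
  unfolding cl_append[OF step_word_W step_word_W, symmetric]
proof (rule cl_eqI[of _ _ "q x"])
  show "q x #> ev (step_word x y @ step_word y z) = q x #> ev (step_word x z)"
    using assms q_mem by (simp add: ev.word_val_append flip: N.rcosets_act_mult)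
qed (use assms \<rho>1 q_mem in auto)

sublocale C: local_cocycle H "1 / t" "\<lambda>x y. cl (step_word x y)"
proof
  show "1 / t > 0" using t by simp
  fix x y z :: 'x assume "dist x y \<le> 1 / t" "dist y z \<le> 1 / t" "dist x z \<le> 1 / t"
  then show "cl (step_word x y) \<otimes>\<^bsub>H\<^esub> cl (step_word y z) = cl (step_word x z)"
    by (intro cl_step_mult step_word_small)
qed simp

definition jump_val :: "('x \<Rightarrow> 'x) \<times> bool \<Rightarrow> 'x \<Rightarrow> nat word set" where
  "jump_val l y = cl (step_word (letter_act l y) y)"

sublocale T: warped_target S x0 \<alpha> H C.holonomy jump_val
proof
  show "path \<gamma> \<Longrightarrow> C.holonomy \<gamma> \<in> carrier H" for \<gamma> by simp
  show "htp \<gamma> \<delta> \<Longrightarrow> C.holonomy \<gamma> = C.holonomy \<delta>" for \<gamma> \<delta> by (rule C.holonomy_htp)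
  show "C.holonomy (\<gamma> +++ \<delta>) = C.holonomy \<gamma> \<otimes>\<^bsub>H\<^esub> C.holonomy \<delta>"
    if "path \<gamma>" "path \<delta>" "pathfinish \<gamma> = pathstart \<delta>" for \<gamma> \<delta>
    using that by (rule C.holonomy_join)
  fix l :: "('x \<Rightarrow> 'x) \<times> bool" assume l: "l \<in> S \<times> UNIV"
  show "jump_val l x \<in> carrier H" for x by (simp add: jump_val_def)
  show "jump_val l (letter_act (letter_inv l) x) \<otimes>\<^bsub>H\<^esub> jump_val (letter_inv l) x = \<one>\<^bsub>H\<^esub>" for x
  proof -
    have l': "letter_inv l \<in> S \<times> UNIV" using l by simp
    let ?y = "letter_act (letter_inv l) x"
    have 1: "q x = q ?y #> ev (step_word ?y x)" "length (step_word ?y x) \<le> M"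
      using step_word_jump[OF l', of x] by auto
    have 2: "q ?y = q x #> ev (step_word x ?y)" "length (step_word x ?y) \<le> M"
      using step_word_jump[OF l, of ?y] letter_act_inv[OF l, of x] by auto
    \<comment> \<open>The degenerate step word from \<open>x\<close> to itself closes the triangle
      of a jump and its inverse; its class is trivial by the cocycle rule.\<close>
    have 3: "q x = q x #> ev (step_word x x)" "length (step_word x x) \<le> M"
      using step_word_small[of x x] t by auto
    show ?thesis
      unfolding jump_val_def letter_act_inv[OF l] cl_step_mult[OF 3 2 1] by simp
  qed
  show "C.holonomy (letter_act l \<circ> \<gamma>) \<otimes>\<^bsub>H\<^esub> jump_val l (pathfinish \<gamma>)
    = jump_val l (pathstart \<gamma>) \<otimes>\<^bsub>H\<^esub> C.holonomy \<gamma>"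
    if "path \<gamma>" for \<gamma>
  proof (rule C.holonomy_compose[OF that continuous_letter_act[OF l]])
    show "jump_val l y \<in> carrier H" for y by (simp add: jump_val_def)
    fix y z :: 'x assume d: "dist y z \<le> 1 / t" "dist (letter_act l y) (letter_act l z) \<le> 1 / t"
    note 1 = step_word_small[OF d(1)] step_word_small[OF d(2)] step_word_jump[OF l, of y]
      step_word_jump[OF l, of z]
    show "jump_val l y \<otimes>\<^bsub>H\<^esub> cl (step_word y z)
      = cl (step_word (letter_act l y) (letter_act l z)) \<otimes>\<^bsub>H\<^esub> jump_val l z"
      unfolding jump_val_def cl_append[OF step_word_W step_word_W, symmetric]
    proof (rule cl_eqI[of _ _ "q (letter_act l y)"])
      have "q (letter_act l y) #> ev (step_word (letter_act l y) y @ step_word y z) = q z"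
        using 1 q_mem by (simp add: ev.word_val_append flip: N.rcosets_act_mult)
      moreover have "q (letter_act l y) #> ev (step_word (letter_act l y) (letter_act l z) @
        step_word (letter_act l z) z) = q z"
        using 1 q_mem by (simp add: ev.word_val_append flip: N.rcosets_act_mult)
      ultimately show "q (letter_act l y) #> ev (step_word (letter_act l y) y @ step_word y z) =
         q (letter_act l y) #> ev (step_word (letter_act l y) (letter_act l z) @ step_word
           (letter_act l z) z)" by simp
    qed (use 1 \<rho>1 q_mem in auto)
  qed
qed

section \<open>The images of jumps, relators and chains under \<open>\<Psi>\<close>\<close>

abbreviation \<Psi> where "\<Psi> \<equiv> T.lift"

text \<open>Besides the value in \<open>H\<close> a representing word is kept: its length and its
  end points are what \<open>cl_closed_word\<close> asks for once \<open>y\<close> is a fixed point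
  of \<open>w\<close>.\<close>

lemma jw_word:
  "w \<in> words \<Longrightarrow> \<exists>u\<in>W. length u \<le> length w * M \<and> T.jw w y = cl u \<and> q y = q (word_act w y) #> ev u"
proof (induction w)
  case Nil
  then show ?case using q_mem by (intro bexI[of _ "[]"]) auto
next
  case (Cons l w)
  then obtain u where u: "u \<in> W" "length u \<le> length w * M" "T.jw w y = cl u"
    "q y = q (word_act w y) #> ev u"
    by auto
  have l: "l \<in> S \<times> UNIV" using Cons.prems by simp
  let ?s = "step_word (letter_act l (word_act w y)) (word_act w y)"
  note s = step_word_jump[OF l, of "word_act w y"]
  have "q (letter_act l (word_act w y)) #> ev (?s @ u) = q y"
    using s u q_mem by (simp add: ev.word_val_append flip: N.rcosets_act_mult)
  moreover have "T.jw (l # w) y = cl (?s @ u)"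
    using u by (simp add: cl_append jump_val_def[of l "word_act w y"])
  ultimately show ?case
    using s(2) u by (intro bexI[of _ "?s @ u"]) (simp_all del: letter_act.simps T.jw.simps)
qed

text \<open>A relator maps to a conjugate, by the holonomy of its path, of the value of
  \<open>w\<close> at the fixed point. The word representing that value is closed in the quotient
  and has length at most \<open>4 * \<theta> * M\<close>, hence at most
  \<open>\<rho>\<close>.\<close>

lemma \<Psi>_fix_kernel:
  assumes "g \<in> fix_kernel S x0 \<alpha> \<theta>"
  shows "\<Psi> g = \<one>\<^bsub>H\<^esub>"
proof -
  interpret h: group_hom \<Gamma> H \<Psi>
    by (unfold_locales) (rule T.lift_hom)
  have "fix_relators S x0 \<alpha> \<theta> \<subseteq> kernel \<Gamma> H \<Psi>"
  proof
    fix g assume g: "g \<in> fix_relators S x0 \<alpha> \<theta>"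
    then obtain w \<beta> where *: "g = vertex_elem (\<beta> +++ (word_act w \<circ> reversepath \<beta>)) w"
      "w \<in> carrier (free_group S)" "length w \<le> 4 * \<theta>" "path \<beta>" "pathstart \<beta> = x0" "pathfinish \<beta> \<in> Fix w"
      unfolding fix_relators_eq by blast
    have w: "w \<in> words" using *(2) by (simp add: carrier_free_group)
    let ?y = "pathfinish \<beta>"
    have fixed: "word_act w ?y = ?y" using *(6) by (simp add: Fix_def)
    obtain u where u: "u \<in> W" "length u \<le> length w * M" "T.jw w ?y = cl u" "q ?y = q ?y #> ev u"
      using jw_word[OF w, of ?y] fixed by auto
    have "length w * M \<le> 4 * \<theta> * M" using *(3) by (rule mult_le_mono1)
    then have "length u \<le> \<rho>" using u(2) \<rho>3 by linarith
    then have one: "T.jw w ?y = \<one>\<^bsub>H\<^esub>"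
      unfolding u(3) using u q_mem by (intro cl_closed_word[of _ "q ?y"]) auto
    have m: "mor x0 w x0 (\<beta> +++ (word_act w \<circ> reversepath \<beta>))"
      using mor_fix_loop[of \<beta> w] * w by simp
    have p: "path (word_act w \<circ> reversepath \<beta>)" using * w by (simp add: path_word_act)
    have "\<Psi> g = C.holonomy \<beta> \<otimes>\<^bsub>H\<^esub> (C.holonomy (word_act w \<circ> reversepath \<beta>) \<otimes>\<^bsub>H\<^esub> T.jw w (pathfinish
      (reversepath \<beta>)))"
      unfolding *(1) T.lift_vertex_elem[OF m] using * w p fixed
      by (simp add: C.holonomy_join pathstart_compose H.m_assoc)
    also have "\<dots> = C.holonomy \<beta> \<otimes>\<^bsub>H\<^esub> (T.jw w ?y \<otimes>\<^bsub>H\<^esub> inv\<^bsub>H\<^esub> C.holonomy \<beta>)"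
      using * w by (subst T.jw_D) (simp_all add: T.D_reversepath)
    also have "\<dots> = \<one>\<^bsub>H\<^esub>" using one * by simp
    finally show "g \<in> kernel \<Gamma> H \<Psi>" using g fix_relators_carrier by (auto simp: kernel_def)
  qed
  then have "fix_kernel S x0 \<alpha> \<theta> \<subseteq> kernel \<Gamma> H \<Psi>"
    unfolding fix_kernel_def by (intro normal_closure_least h.normal_kernel)
  then show ?thesis using assms by (auto simp: kernel_def)
qed

abbreviation \<beta> where "\<beta> x \<equiv> C.holonomy (base_path x)"

text \<open>The base-path factors at intermediate points telescope, while small paths and jumps
  contribute their step words. The end points of \<open>u\<close> are recorded so that it can be
  compared with other routes.\<close>

lemma \<Psi>_chain:
  assumes "chain t m x y e"
  shows "\<exists>u\<in>W. length u \<le> m * M \<and> q y = q x #> ev u \<and> \<Psi> e = \<beta> x \<otimes>\<^bsub>H\<^esub> cl u \<otimes>\<^bsub>H\<^esub> inv\<^bsub>H\<^esub> \<beta> y"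
  using assms
proof (induction rule: chain.induct)
  case (chain_nil x)
  have "\<Psi> \<one>\<^bsub>\<Gamma>\<^esub> = \<one>\<^bsub>H\<^esub>" using hom_one[OF T.lift_hom] \<Gamma>.is_group H.is_group by blast
  then show ?case using q_mem base_path by (intro bexI[of _ "[]"]) auto
next
  case (chain_path \<gamma> m z e)
  then obtain u where u: "u \<in> W" "length u \<le> m * M" "q z = q (pathfinish \<gamma>) #> ev u"
    "\<Psi> e = \<beta> (pathfinish \<gamma>) \<otimes>\<^bsub>H\<^esub> cl u \<otimes>\<^bsub>H\<^esub> inv\<^bsub>H\<^esub> \<beta> z" by blast
  let ?s = "step_word (pathstart \<gamma>) (pathfinish \<gamma>)"
  have \<gamma>: "path \<gamma>" "\<And>p q. p \<in> path_image \<gamma> \<Longrightarrow> q \<in> path_image \<gamma> \<Longrightarrow> dist p q \<le> 1 / t"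
    using chain_path(1) by (auto simp: small_path_def)
  note s = step_word_small[OF \<gamma>(2)[OF pathstart_in_path_image pathfinish_in_path_image]]
  have "\<Psi> (path_elem \<gamma> \<otimes>\<^bsub>\<Gamma>\<^esub> e) = \<Psi> (path_elem \<gamma>) \<otimes>\<^bsub>H\<^esub> \<Psi> e"
    using hom_mult[OF T.lift_hom] \<gamma>(1) chain_closed[OF chain_path(2)] by simp
  also have "\<Psi> (path_elem \<gamma>) = \<beta> (pathstart \<gamma>) \<otimes>\<^bsub>H\<^esub> (cl ?s \<otimes>\<^bsub>H\<^esub> inv\<^bsub>H\<^esub> \<beta> (pathfinish \<gamma>))"
    using T.lift_path_elem[OF \<gamma>(1)] C.holonomy_small[OF \<gamma>] by simp
  finally have "\<Psi> (path_elem \<gamma> \<otimes>\<^bsub>\<Gamma>\<^esub> e) = \<beta> (pathstart \<gamma>) \<otimes>\<^bsub>H\<^esub> cl (?s @ u) \<otimes>\<^bsub>H\<^esub> inv\<^bsub>H\<^esub> \<beta> z"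
    using u base_path
    by (simp add: cl_append H.m_assoc)
  then show ?case
    using s u q_mem by (intro bexI[of _ "?s @ u"]) (auto simp: ev.word_val_append simp flip:
      N.rcosets_act_mult)
next
  case (chain_jump l m y z e)
  then obtain u where u: "u \<in> W" "length u \<le> m * M" "q z = q y #> ev u"
    "\<Psi> e = \<beta> y \<otimes>\<^bsub>H\<^esub> cl u \<otimes>\<^bsub>H\<^esub> inv\<^bsub>H\<^esub> \<beta> z" by blast
  let ?s = "step_word (letter_act l y) y"
  note s = step_word_jump[OF chain_jump(1), of y]
  have "\<Psi> (jump_elem l y \<otimes>\<^bsub>\<Gamma>\<^esub> e) = \<Psi> (jump_elem l y) \<otimes>\<^bsub>H\<^esub> \<Psi> e"
    using hom_mult[OF T.lift_hom] chain_jump(1) chain_closed[OF chain_jump(2)] by simp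
  also have "\<Psi> (jump_elem l y) = \<beta> (letter_act l y) \<otimes>\<^bsub>H\<^esub> (cl ?s \<otimes>\<^bsub>H\<^esub> inv\<^bsub>H\<^esub> \<beta> y)"
    using T.lift_jump_elem[OF chain_jump(1)] by (simp add: jump_val_def)
  finally have "\<Psi> (jump_elem l y \<otimes>\<^bsub>\<Gamma>\<^esub> e) = \<beta> (letter_act l y) \<otimes>\<^bsub>H\<^esub> cl (?s @ u) \<otimes>\<^bsub>H\<^esub> inv\<^bsub>H\<^esub> \<beta> z"
    using u base_path
    by (simp add: cl_append H.m_assoc)
  then show ?case
    using s u q_mem
    by (intro bexI[of _ "?s @ u"]) (auto simp: ev.word_val_append simp flip: N.rcosets_act_mult simp
      del: letter_act.simps)
qed

text \<open>Along an edge of \<open>\<Lambda> / N\<close>, \<open>\<Psi>\<close> inverts \<^const>\<open>edge\<close> up to the words joining \<open>v\<close> to \<open>q (f v)\<close>.\<close>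

definition qf_word :: "'g set \<Rightarrow> nat word" where
  "qf_word v = (SOME u. u \<in> W \<and> length u \<le> M \<and> q (f v) = v #> ev u)"

lemma qf_word:
  assumes "v \<in> V"
  shows "qf_word v \<in> W" "length (qf_word v) \<le> M" "q (f v) = v #> ev (qf_word v)"
proof -
  have "\<exists>u. u \<in> W \<and> length u \<le> M \<and> q (f v) = v #> ev u" using qf[OF assms] by blast
  from someI_ex[OF this]
  show "qf_word v \<in> W" "length (qf_word v) \<le> M" "q (f v) = v #> ev (qf_word v)"
    by (simp_all add: qf_word_def)
qed

text \<open>The change of coordinates at \<open>v\<close> between \<open>\<Psi>\<close> after
  \<open>E\<close> and the class of words: the base path to \<open>f v\<close>, followed by the word
  from \<open>q (f v)\<close> back to \<open>v\<close>.\<close>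

definition frame :: "'g set \<Rightarrow> nat word set" where
  "frame v = \<beta> (f v) \<otimes>\<^bsub>H\<^esub> inv\<^bsub>H\<^esub> cl (qf_word v)"

lemma frame_closed [simp]: "v \<in> V \<Longrightarrow> frame v \<in> carrier H"
  using base_path qf_word(1) by (simp add: frame_def)

lemma \<Psi>_letter_edge:
  assumes v: "v \<in> V" and l: "l \<in> {..<n} \<times> UNIV"
  shows "\<Psi> (letter_edge v l) = frame v \<otimes>\<^bsub>H\<^esub> cl [l] \<otimes>\<^bsub>H\<^esub> inv\<^bsub>H\<^esub> frame (v #> lv l)"
proof -
  let ?v' = "v #> lv l" and ?l = "[l]"
  have lW: "?l \<in> W" and ll: "lv l \<in> carrier \<Lambda>" and v': "?v' \<in> V"
    using l v by (simp_all del: letter_val.simps)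
  note p = qf_word[OF v] and p' = qf_word[OF v']
  obtain u where u: "u \<in> W" "length u \<le> M * M" "q (f ?v') = q (f v) #> ev u"
    "\<Psi> (letter_edge v l) = \<beta> (f v) \<otimes>\<^bsub>H\<^esub> cl u \<otimes>\<^bsub>H\<^esub> inv\<^bsub>H\<^esub> \<beta> (f ?v')"
    using \<Psi>_chain[OF letter_edge_chain[OF v l]] by blast
  \<comment> \<open>Two routes from \<open>v\<close> to \<open>q (f ?v')\<close>: their lengths are
    at most \<open>M + M * M\<close> and \<open>1 + M\<close>, which is the origin of the second
    lower bound on \<open>\<rho>\<close>.\<close>
  have "cl (qf_word v @ u) = cl (?l @ qf_word ?v')"
  proof (rule cl_eqI[of _ _ v])
    have "v #> ev (qf_word v @ u) = q (f ?v')"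
      using p u v by (simp add: ev.word_val_append flip: N.rcosets_act_mult)
    also have "\<dots> = v #> ev (?l @ qf_word ?v')"
      using p' v lW ll unfolding p'(3) by (simp add: N.rcosets_act_mult del: letter_val.simps)
    finally show "v #> ev (qf_word v @ u) = v #> ev (?l @ qf_word ?v')" .
  qed (use p p' u lW \<rho>2 v in auto)
  then have eq: "cl (qf_word v) \<otimes>\<^bsub>H\<^esub> cl u = cl ?l \<otimes>\<^bsub>H\<^esub> cl (qf_word ?v')"
    using p p' u lW by (simp add: cl_append[symmetric])
  have "cl u = inv\<^bsub>H\<^esub> cl (qf_word v) \<otimes>\<^bsub>H\<^esub> (cl (qf_word v) \<otimes>\<^bsub>H\<^esub> cl u)"
    using p u by (simp add: H.m_assoc[symmetric])
  then have "cl u = inv\<^bsub>H\<^esub> cl (qf_word v) \<otimes>\<^bsub>H\<^esub> (cl ?l \<otimes>\<^bsub>H\<^esub> cl (qf_word ?v'))"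
    unfolding eq .
  then show ?thesis
    unfolding u(4) frame_def using p(1) p'(1) lW base_path
    by (simp add: H.m_assoc H.inv_mult_group)
qed

lemma \<Psi>_E:
  "v \<in> V \<Longrightarrow> u \<in> W \<Longrightarrow> \<Psi> (E v u) = frame v \<otimes>\<^bsub>H\<^esub> cl u \<otimes>\<^bsub>H\<^esub> inv\<^bsub>H\<^esub> frame (v #> ev u)"
proof (induction u arbitrary: v)
  case Nil
  have "\<Psi> \<one>\<^bsub>\<Gamma>\<^esub> = \<one>\<^bsub>H\<^esub>" using hom_one[OF T.lift_hom] \<Gamma>.is_group H.is_group by blast
  then show ?case using Nil by simp
next
  case (Cons l u)
  then have l: "l \<in> {..<n} \<times> UNIV" and u: "u \<in> W" by auto
  let ?v' = "v #> lv l"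
  have lW: "[l] \<in> W" and ll: "lv l \<in> carrier \<Lambda>" and v': "?v' \<in> V"
    using l Cons.prems(1) by (simp_all del: letter_val.simps)
  have v'': "?v' #> ev u = v #> ev (l # u)" "v #> ev (l # u) \<in> V"
    using Cons.prems(1) ll u by (simp_all add: N.rcosets_act_mult del: letter_val.simps)
  have "\<Psi> (E v (l # u)) = \<Psi> (letter_edge v l) \<otimes>\<^bsub>H\<^esub> \<Psi> (E ?v' u)"
    using hom_mult[OF T.lift_hom] letter_edge_closed[OF Cons.prems(1) l] E_closed[OF v' u]
    by (simp del: letter_val.simps letter_edge.simps)
  also have "\<dots> = (frame v \<otimes>\<^bsub>H\<^esub> cl [l] \<otimes>\<^bsub>H\<^esub> inv\<^bsub>H\<^esub> frame ?v') \<otimes>\<^bsub>H\<^esub> (frame ?v' \<otimes>\<^bsub>H\<^esub> cl u \<otimes>\<^bsub>H\<^esub> inv\<^bsub>H\<^esub>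
    frame (v #> ev (l # u)))"
    unfolding \<Psi>_letter_edge[OF Cons.prems(1) l] Cons.IH[OF v' u] v''(1) ..
  also have "\<dots> = frame v \<otimes>\<^bsub>H\<^esub> (cl [l] \<otimes>\<^bsub>H\<^esub> cl u) \<otimes>\<^bsub>H\<^esub> inv\<^bsub>H\<^esub> frame (v #> ev (l # u))"
    using Cons.prems(1) lW u v' v''(2)
    by (simp add: H.m_assoc del: word_val_Cons letter_val.simps)
  also have "cl [l] \<otimes>\<^bsub>H\<^esub> cl u = cl (l # u)" using cl_append[OF lW u] by simp
  finally show ?case .
qed

text \<open>A word with value in \<open>N\<close> returns to \<open>v\<close>, so the two frames in
  \<open>\<Psi>_E\<close> agree and \<open>E v u\<close> is sent to a conjugate of
  \<open>cl u\<close>. If that is trivial, so is \<open>cl u\<close>.\<close>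

lemma E_in_fix_kernel_imp:
  assumes v: "v \<in> V" and u: "u \<in> carrier F" "ev u \<in> N" and K: "E v u \<in> fix_kernel S x0 \<alpha> \<theta>"
  shows "u \<in> R"
proof -
  have W: "u \<in> W" and red: "reduce u = u" using u by (auto simp: carrier_free_group reduce_id)
  have vu: "v #> ev u = v" using N.rcosets_stabilizer v u W by simp
  have "\<one>\<^bsub>H\<^esub> = frame v \<otimes>\<^bsub>H\<^esub> cl u \<otimes>\<^bsub>H\<^esub> inv\<^bsub>H\<^esub> frame v"
    using \<Psi>_fix_kernel[OF K] \<Psi>_E[OF v W] by (simp add: vu)
  then have "inv\<^bsub>H\<^esub> frame v \<otimes>\<^bsub>H\<^esub> \<one>\<^bsub>H\<^esub> \<otimes>\<^bsub>H\<^esub> frame v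
    = inv\<^bsub>H\<^esub> frame v \<otimes>\<^bsub>H\<^esub> (frame v \<otimes>\<^bsub>H\<^esub> cl u \<otimes>\<^bsub>H\<^esub> inv\<^bsub>H\<^esub> frame v) \<otimes>\<^bsub>H\<^esub> frame v"
    by simp
  then have "cl u = \<one>\<^bsub>H\<^esub>"
    using v W by (simp add: H.m_assoc)
  then show ?thesis using W red by (simp add: cl_eq_one_iff)
qed

end

context comparison begin

subsection \<open>Surjectivity\<close>

text \<open>The square with corners \<open>x\<close>, \<open>y\<close>, \<open>f (q y)\<close> and
  \<open>f (q x)\<close>: one step, two chains \<open>b\<close> of \<open>M\<close> steps, and at
  most \<open>M * M\<close> steps along the word \<open>u\<close>. This circuit is dual to the one
  in \<open>\<Psi>_letter_edge\<close> and has the same constant.\<close>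

lemma chain_mod_closed:
  assumes K: "K \<lhd> \<Gamma>" and closed: "\<And>x e. chain t (M * M + 2 * M + 1) x x e \<Longrightarrow> e \<in> K"
    and b: "\<And>x. chain t M x (f (q x)) (b x)"
    and e: "chain t 1 x y e"
    and u: "u \<in> W" "length u \<le> M" "q y = q x #> ev u"
  shows "K #>\<^bsub>\<Gamma>\<^esub> (e \<otimes>\<^bsub>\<Gamma>\<^esub> b y) = K #>\<^bsub>\<Gamma>\<^esub> (b x \<otimes>\<^bsub>\<Gamma>\<^esub> E (q x) u)"
proof -
  interpret K: normal K \<Gamma> by fact
  have *: "chain t (length u * M) (f (q x)) (f (q y)) (E (q x) u)"
    using E_chain[OF q_mem u(1), of x] u(3) by simp
  have 1: "chain t (1 + M) x (f (q y)) (e \<otimes>\<^bsub>\<Gamma>\<^esub> b y)" by (rule chain_append[OF e b])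
  have 2: "chain t (M + length u * M) x (f (q y)) (b x \<otimes>\<^bsub>\<Gamma>\<^esub> E (q x) u)" by (rule chain_append[OF b *])
  have "chain t ((1 + M) + (M + length u * M)) x x ((e \<otimes>\<^bsub>\<Gamma>\<^esub> b y) \<otimes>\<^bsub>\<Gamma>\<^esub> inv\<^bsub>\<Gamma>\<^esub> (b x \<otimes>\<^bsub>\<Gamma>\<^esub> E (q x) u))"
    by (rule chain_append[OF 1 chain_reverse[OF 2]])
  moreover have "length u * M \<le> M * M" using u(2) by (rule mult_le_mono1)
  then have "(1 + M) + (M + length u * M) \<le> M * M + 2 * M + 1" by simp
  ultimately have "(e \<otimes>\<^bsub>\<Gamma>\<^esub> b y) \<otimes>\<^bsub>\<Gamma>\<^esub> inv\<^bsub>\<Gamma>\<^esub> (b x \<otimes>\<^bsub>\<Gamma>\<^esub> E (q x) u) \<in> K"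
    using closed chain_pad t by blast
  then show ?thesis using K.rcos_eq_iff chain_closed[OF 1] chain_closed[OF 2] by blast
qed

text \<open>Step by step, the chains \<open>b\<close> turn a chain into the word of its image under
  \<open>q\<close>, modulo \<open>K\<close>. Only one square at a time has to close up, so the
  length \<open>m\<close> of the chain is unrestricted.\<close>

lemma chain_mod_E:
  assumes K: "K \<lhd> \<Gamma>" and closed: "\<And>x e. chain t (M * M + 2 * M + 1) x x e \<Longrightarrow> e \<in> K"
    and b: "\<And>x. chain t M x (f (q x)) (b x)"
    and "chain t m x y e"
  shows "\<exists>u\<in>W. q y = q x #> ev u \<and> K #>\<^bsub>\<Gamma>\<^esub> (e \<otimes>\<^bsub>\<Gamma>\<^esub> b y) = K #>\<^bsub>\<Gamma>\<^esub> (b x \<otimes>\<^bsub>\<Gamma>\<^esub> E (q x) u)"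
proof -
  interpret K: normal K \<Gamma> by fact
  have b_closed: "b x \<in> carrier \<Gamma>" for x using chain_closed[OF b] .
  have step: "\<exists>u\<in>W. q z = q x #> ev u \<and> K #>\<^bsub>\<Gamma>\<^esub> ((s \<otimes>\<^bsub>\<Gamma>\<^esub> e) \<otimes>\<^bsub>\<Gamma>\<^esub> b z) = K #>\<^bsub>\<Gamma>\<^esub> (b x \<otimes>\<^bsub>\<Gamma>\<^esub> E (q x) u)"
    if s: "chain t 1 x y s" and w: "w \<in> W" "length w \<le> M" "q y = q x #> ev w"
      and e: "e \<in> carrier \<Gamma>" and u: "u \<in> W" "q z = q y #> ev u"
      "K #>\<^bsub>\<Gamma>\<^esub> (e \<otimes>\<^bsub>\<Gamma>\<^esub> b z) = K #>\<^bsub>\<Gamma>\<^esub> (b y \<otimes>\<^bsub>\<Gamma>\<^esub> E (q y) u)"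
    for x y z s w e u
  proof -
    have c: "s \<in> carrier \<Gamma>" "E (q y) u \<in> carrier \<Gamma>" "E (q x) w \<in> carrier \<Gamma>"
      using chain_closed[OF s] q_mem u(1) w(1) by auto
    have mod: "K #>\<^bsub>\<Gamma>\<^esub> (s \<otimes>\<^bsub>\<Gamma>\<^esub> b y) = K #>\<^bsub>\<Gamma>\<^esub> (b x \<otimes>\<^bsub>\<Gamma>\<^esub> E (q x) w)"
      by (rule chain_mod_closed[OF K _ b s w]) (erule closed)
    have "K #>\<^bsub>\<Gamma>\<^esub> ((s \<otimes>\<^bsub>\<Gamma>\<^esub> e) \<otimes>\<^bsub>\<Gamma>\<^esub> b z) = (K #>\<^bsub>\<Gamma>\<^esub> s) <#>\<^bsub>\<Gamma>\<^esub> (K #>\<^bsub>\<Gamma>\<^esub> (e \<otimes>\<^bsub>\<Gamma>\<^esub> b z))"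
      using c e b_closed by (simp add: K.rcos_sum \<Gamma>.m_assoc)
    also have "\<dots> = K #>\<^bsub>\<Gamma>\<^esub> ((s \<otimes>\<^bsub>\<Gamma>\<^esub> b y) \<otimes>\<^bsub>\<Gamma>\<^esub> E (q y) u)"
      unfolding u(3) using c b_closed by (simp add: K.rcos_sum \<Gamma>.m_assoc)
    also have "\<dots> = (K #>\<^bsub>\<Gamma>\<^esub> (s \<otimes>\<^bsub>\<Gamma>\<^esub> b y)) <#>\<^bsub>\<Gamma>\<^esub> (K #>\<^bsub>\<Gamma>\<^esub> E (q y) u)"
      using c b_closed by (simp add: K.rcos_sum)
    also have "\<dots> = K #>\<^bsub>\<Gamma>\<^esub> (b x \<otimes>\<^bsub>\<Gamma>\<^esub> (E (q x) w \<otimes>\<^bsub>\<Gamma>\<^esub> E (q y) u))"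
      unfolding mod using c b_closed by (simp add: K.rcos_sum \<Gamma>.m_assoc)
    also have "E (q x) w \<otimes>\<^bsub>\<Gamma>\<^esub> E (q y) u = E (q x) (w @ u)"
      unfolding w(3) by (rule E_append[OF q_mem w(1) u(1), symmetric])
    finally show ?thesis
      using u(1,2) w q_mem by (intro bexI[of _
        "w @ u"]) (simp_all add: ev.word_val_append flip: N.rcosets_act_mult)
  qed
  show ?thesis
    using assms(4)
  proof (induction rule: chain.induct)
    case (chain_nil x)
    show ?case using q_mem b_closed by (intro bexI[of _ "[]"]) auto
  next
    case (chain_path \<gamma> m z e)
    have "dist (pathstart \<gamma>) (pathfinish \<gamma>) \<le> 1 / t"
      using chain_path(1) pathstart_in_path_image pathfinish_in_path_image
      unfolding small_path_def by blast
    note w = step_word_small[OF this]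
    from chain_path(3) obtain u where "u \<in> W" "q z = q (pathfinish \<gamma>) #> ev u"
      "K #>\<^bsub>\<Gamma>\<^esub> (e \<otimes>\<^bsub>\<Gamma>\<^esub> b z) = K #>\<^bsub>\<Gamma>\<^esub> (b (pathfinish \<gamma>) \<otimes>\<^bsub>\<Gamma>\<^esub> E (q (pathfinish \<gamma>)) u)" by blast
    from step[OF chain_single_path[OF chain_path(1)] w chain_closed[OF chain_path(2)] this]
    show ?case .
  next
    case (chain_jump l m y z e)
    note w = step_word_jump[OF chain_jump(1), of y]
    from chain_jump(3) obtain u where "u \<in> W" "q z = q y #> ev u"
      "K #>\<^bsub>\<Gamma>\<^esub> (e \<otimes>\<^bsub>\<Gamma>\<^esub> b z) = K #>\<^bsub>\<Gamma>\<^esub> (b y \<otimes>\<^bsub>\<Gamma>\<^esub> E (q y) u)" by blast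
    from step[OF chain_single_jump[OF chain_jump(1)] w chain_closed[OF chain_jump(2)] this]
    show ?case .
  qed
qed

lemma E_surj_mod:
  assumes K: "K \<lhd> \<Gamma>" and closed: "\<And>x e. chain t (M * M + 2 * M + 1) x x e \<Longrightarrow> e \<in> K"
    and g: "g \<in> carrier \<Gamma>"
  shows "\<exists>u\<in>carrier F. ev u \<in> N \<and> K #>\<^bsub>\<Gamma>\<^esub> g = K #>\<^bsub>\<Gamma>\<^esub> E (q x0) u"
proof -
  interpret K: normal K \<Gamma> by fact
  obtain b where b: "\<And>x. chain t M x (f (q x)) (b x)" using fq by metis
  let ?b = "b x0"
  have b_closed: "?b \<in> carrier \<Gamma>" using chain_closed[OF b] .
  \<comment> \<open>Conjugating \<open>g\<close> by \<open>?b\<close> in advance makes the factors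
    \<open>?b\<close> of \<open>chain_mod_E\<close> cancel.\<close>
  let ?e = "?b \<otimes>\<^bsub>\<Gamma>\<^esub> g \<otimes>\<^bsub>\<Gamma>\<^esub> inv\<^bsub>\<Gamma>\<^esub> ?b"
  have "?e \<in> carrier \<Gamma>" using b_closed g by simp
  then obtain m where ch: "chain t m x0 x0 ?e" using chain_surj[OF t] by blast
  have "\<exists>u\<in>W. q x0 = q x0 #> ev u \<and> K #>\<^bsub>\<Gamma>\<^esub> (?e \<otimes>\<^bsub>\<Gamma>\<^esub> ?b) = K #>\<^bsub>\<Gamma>\<^esub> (?b \<otimes>\<^bsub>\<Gamma>\<^esub> E (q x0) u)"
    by (rule chain_mod_E[OF K _ b ch]) (erule closed)
  then obtain u where u: "u \<in> W" "q x0 = q x0 #> ev u"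
    "K #>\<^bsub>\<Gamma>\<^esub> (?e \<otimes>\<^bsub>\<Gamma>\<^esub> ?b) = K #>\<^bsub>\<Gamma>\<^esub> (?b \<otimes>\<^bsub>\<Gamma>\<^esub> E (q x0) u)" by blast
  have Ec: "E (q x0) u \<in> carrier \<Gamma>" using u q_mem by simp
  have 1: "?e \<otimes>\<^bsub>\<Gamma>\<^esub> ?b = ?b \<otimes>\<^bsub>\<Gamma>\<^esub> g" using b_closed g by (simp add: \<Gamma>.m_assoc)
  have 2: "(K #>\<^bsub>\<Gamma>\<^esub> inv\<^bsub>\<Gamma>\<^esub> ?b) <#>\<^bsub>\<Gamma>\<^esub> (K #>\<^bsub>\<Gamma>\<^esub> (?b \<otimes>\<^bsub>\<Gamma>\<^esub> h)) = K #>\<^bsub>\<Gamma>\<^esub> h"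
    if "h \<in> carrier \<Gamma>" for h
    using K.rcos_sum[of "inv\<^bsub>\<Gamma>\<^esub> ?b" "?b \<otimes>\<^bsub>\<Gamma>\<^esub> h"] b_closed that by simp
  have "K #>\<^bsub>\<Gamma>\<^esub> g = K #>\<^bsub>\<Gamma>\<^esub> E (q x0) u"
    using 2[OF g] 2[OF Ec] u(3) unfolding 1 by simp
  moreover have "ev (reduce u) \<in> N"
    using N.rcosets_stabilizer[OF q_mem, of "ev u" x0] u by (simp add: ev.word_val_reduce)
  ultimately show ?thesis
    using u q_mem by (intro bexI[of _ "reduce u"]) (simp_all add: E_reduce)
qed

end

section \<open>Box spaces\<close>

lemma residual_filtration_avoids:
  assumes "residual_filtration \<Lambda> N" "finite B" "\<one>\<^bsub>\<Lambda>\<^esub> \<notin> B"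
  shows "\<forall>\<^sub>F k in sequentially. N k \<inter> B = {}"
proof -
  have Suc: "N (Suc k) \<subseteq> N k" for k using assms(1) by (simp add: residual_filtration_def)
  have anti: "N j \<subseteq> N i" if "i \<le> j" for i j
    by (rule lift_Suc_antimono_le[of N, OF Suc that])
  have "\<forall>\<^sub>F k in sequentially. b \<notin> N k" if "b \<in> B" for b
  proof -
    have "b \<notin> (\<Inter>k. N k)" using assms that by (auto simp: residual_filtration_def)
    then obtain i where "b \<notin> N i" by auto
    then show ?thesis using anti by (intro eventually_sequentiallyI[of i]) blast
  qed
  then have "\<forall>\<^sub>F k in sequentially. \<forall>b\<in>B. b \<notin> N k"
    using assms(2) by (simp add: eventually_ball_finite_distrib)
  then show ?thesis by eventually_elim auto
qed

section \<open>Cayley graphs of the quotients in terms of words\<close>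

locale presented_group = group \<Lambda> for \<Lambda> :: "'g monoid" (structure) +
  fixes n :: nat and a :: "nat \<Rightarrow> 'g"
  assumes a: "a \<in> {..<n} \<rightarrow> carrier \<Lambda>" and gen: "generate \<Lambda> (a ` {..<n}) = carrier \<Lambda>"
begin

sublocale free_eval \<Lambda> "{..<n}" a
  by unfold_locales (fact a)

abbreviation "W \<equiv> lists ({..<n} \<times> (UNIV :: bool set))"

lemma word_val_surj:
  assumes "g \<in> carrier \<Lambda>"
  shows "\<exists>u\<in>W. word_val \<Lambda> a u = g"
proof -
  have "g \<in> generate \<Lambda> (a ` {..<n})" using assms gen by simp
  then show ?thesis
  proof (induction rule: generate.induct)
    case one
    show ?case by (intro bexI[of _ "[]"]) auto
  next
    case (incl h)
    then obtain i where "i < n" "h = a i" by auto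
    moreover from this have "a i \<in> carrier \<Lambda>" using a by auto
    ultimately show ?case by (intro bexI[of _ "[(i, True)]"]) auto
  next
    case (inv h)
    then obtain i where "i < n" "h = a i" by auto
    moreover from this have "a i \<in> carrier \<Lambda>" using a by auto
    ultimately show ?case by (intro bexI[of _ "[(i, False)]"]) auto
  next
    case (eng h1 h2)
    then obtain u v where "u \<in> W" "v \<in> W" "word_val \<Lambda> a u = h1" "word_val \<Lambda> a v = h2" by blast
    then show ?case by (intro bexI[of _ "u @ v"]) (auto simp: word_val_append)
  qed
qed

end

locale quotient_graph = presented_group \<Lambda> n a + normal N \<Lambda>
  for \<Lambda> :: "'g monoid" (structure) and n a N
begin

abbreviation "Q \<equiv> \<Lambda> Mod N"
abbreviation "AQ \<equiv> (\<lambda>g. N #> g) ` (a ` {..<n})"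
abbreviation "V \<equiv> rcosets N"

lemma carrier_Q: "carrier Q = V"
  by (auto simp: carrier_FactGroup RCOSETS_def)

lemma V_mult: "v \<in> V \<Longrightarrow> g \<in> carrier \<Lambda> \<Longrightarrow> v \<otimes>\<^bsub>Q\<^esub> (N #> g) = v #> g"
  using subset by (auto simp: RCOSETS_def mult_FactGroup rcos_sum coset_mult_assoc)

lemma Metric_space_Q: "Metric_space V (cayley_dist Q AQ)"
proof -
  interpret Q: group Q by (rule factorgroup_is_group)
  interpret h: group_hom \<Lambda> Q "\<lambda>g. N #> g"
    by unfold_locales (rule r_coset_hom_Mod)
  have A: "a ` {..<n} \<subseteq> carrier \<Lambda>" using a by auto
  have "generate Q AQ = carrier Q"
    using h.generate_img[OF A] by (simp add: gen carrier_FactGroup)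
  moreover have "AQ \<subseteq> carrier Q" using A by (auto simp: carrier_FactGroup)
  ultimately show ?thesis
    using Metric_space_cayley_dist[OF Q.is_group] by (simp add: carrier_Q)
qed

lemma mspace_box: "mspace (cayley_graph Q AQ) = V"
  and mdist_box: "mdist (cayley_graph Q AQ) = cayley_dist Q AQ"
  using Metric_space.mspace_metric[OF Metric_space_Q] Metric_space.mdist_metric[OF Metric_space_Q]
  by (simp_all add: cayley_graph_def carrier_Q)

lemma edge_iff:
  "(x, y) \<in> cayley_edges Q AQ \<longleftrightarrow> x \<in> V \<and> (\<exists>l\<in>{..<n} \<times> UNIV. y = x #> letter_val \<Lambda> a l)"
proof
  assume "(x, y) \<in> cayley_edges Q AQ"
  then obtain i where i: "i < n" "x \<in> V" "y \<in> V" "y = x #> a i \<or> x = y #> a i"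
    using a by (auto simp: cayley_edges_def carrier_Q V_mult Pi_iff)
  have ai: "a i \<in> carrier \<Lambda>" using a i by auto
  have "y = x #> inv a i" if "x = y #> a i" using that i ai by (simp add: rcosets_act_mult)
  then have "y = x #> letter_val \<Lambda> a (i, True) \<or> y = x #> letter_val \<Lambda> a (i, False)"
    using i(4) by auto
  then show "x \<in> V \<and> (\<exists>l\<in>{..<n} \<times> UNIV. y = x #> letter_val \<Lambda> a l)"
    using i by blast
next
  assume "x \<in> V \<and> (\<exists>l\<in>{..<n} \<times> UNIV. y = x #> letter_val \<Lambda> a l)"
  then obtain i b where i: "x \<in> V" "i < n" "y = x #> letter_val \<Lambda> a (i, b)" by auto
  have ai: "a i \<in> carrier \<Lambda>" using a i by auto
  have y: "y \<in> V" using i ai by simp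
  have "y = x #> a i \<or> x = y #> a i"
    using i ai by (cases b) (simp_all add: rcosets_act_mult)
  then have "y = x \<otimes>\<^bsub>Q\<^esub> (N #> a i) \<or> x = y \<otimes>\<^bsub>Q\<^esub> (N #> a i)"
    using i y ai by (simp only: V_mult)
  then show "(x, y) \<in> cayley_edges Q AQ"
    using i(1,2) y unfolding cayley_edges_def carrier_Q by blast
qed

lemma relpow_edges_iff:
  "x \<in> V \<Longrightarrow> (x, y) \<in> cayley_edges Q AQ ^^ m \<longleftrightarrow> (\<exists>u\<in>W. length u = m \<and> y = x #> word_val \<Lambda> a u)"
proof (induction m arbitrary: x)
  case 0
  then show ?case by auto
next
  case (Suc m)
  have "(x, y) \<in> cayley_edges Q AQ ^^ Suc m \<longleftrightarrow> (\<exists>z. (x, z) \<in> cayley_edges Q AQ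
    \<and> (z, y) \<in> cayley_edges Q AQ ^^ m)"
    by (meson relpow_Suc_D2 relpow_Suc_I2)
  also have "\<dots> \<longleftrightarrow> (\<exists>l\<in>{..<n} \<times> UNIV. (x #> letter_val \<Lambda> a l, y) \<in> cayley_edges Q AQ ^^ m)"
    using Suc.prems by (auto simp: edge_iff simp del: letter_val.simps)
  also have "\<dots> \<longleftrightarrow> (\<exists>l\<in>{..<n} \<times> UNIV. \<exists>u\<in>W. length u = m \<and> y = x #> word_val \<Lambda> a (l # u))"
    using Suc.prems Suc.IH by (intro bex_cong refl) (simp add: rcosets_act_mult del: letter_val.simps)
  also have "\<dots> \<longleftrightarrow> (\<exists>u\<in>W. length u = Suc m \<and> y = x #> word_val \<Lambda> a u)"
  proof
    assume "\<exists>l\<in>{..<n} \<times> UNIV. \<exists>u\<in>W. length u = m \<and> y = x #> word_val \<Lambda> a (l # u)"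
    then obtain l u where "l \<in> {..<n} \<times> UNIV" "u \<in> W" "length u = m" "y = x #> word_val \<Lambda> a (l # u)"
      by blast
    then show "\<exists>u\<in>W. length u = Suc m \<and> y = x #> word_val \<Lambda> a u" by (intro bexI[of _ "l # u"]) simp_all
  next
    assume "\<exists>u\<in>W. length u = Suc m \<and> y = x #> word_val \<Lambda> a u"
    then obtain u where u: "u \<in> W" "length u = Suc m" "y = x #> word_val \<Lambda> a u" by blast
    then obtain l v where "u = l # v" by (cases u) auto
    then show "\<exists>l\<in>{..<n} \<times> UNIV. \<exists>u\<in>W. length u = m \<and> y = x #> word_val \<Lambda> a (l # u)"
      using u by (intro bexI[of _ l] bexI[of _ v]) simp_all
  qed
  finally show ?case .
qed

text \<open>The dictionary from the graph metric to words. Connectedness, by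
  \<open>word_val_surj\<close>, ensures that the \<open>LEAST\<close> in \<open>cayley_dist\<close>
  is attained.\<close>

lemma cayley_dist_le_iff:
  assumes x: "x \<in> V" and y: "y \<in> V"
  shows "cayley_dist Q AQ x y \<le> real m \<longleftrightarrow> (\<exists>u\<in>W. length u \<le> m \<and> y = x #> word_val \<Lambda> a u)"
proof -
  obtain g h where gh: "g \<in> carrier \<Lambda>" "h \<in> carrier \<Lambda>" "x = N #> g" "y = N #> h"
    using x y by (auto simp: RCOSETS_def)
  obtain w where w: "w \<in> W" "word_val \<Lambda> a w = inv g \<otimes> h"
    using word_val_surj[of "inv g \<otimes> h"] gh by auto
  have "y = x #> word_val \<Lambda> a w"
    using gh w x y subset by (simp add: coset_mult_assoc flip: m_assoc)
  then have "(x, y) \<in> cayley_edges Q AQ ^^ length w" using relpow_edges_iff[OF x] w by blast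
  then have least: "(x, y) \<in> cayley_edges Q AQ ^^ (LEAST n. (x, y) \<in> cayley_edges Q AQ ^^ n)"
    by (rule LeastI)
  show ?thesis
  proof
    assume "cayley_dist Q AQ x y \<le> real m"
    then have "(LEAST n. (x, y) \<in> cayley_edges Q AQ ^^ n) \<le> m" by (simp add: cayley_dist_def)
    then show "\<exists>u\<in>W. length u \<le> m \<and> y = x #> word_val \<Lambda> a u"
      using least relpow_edges_iff[OF x] by metis
  next
    assume "\<exists>u\<in>W. length u \<le> m \<and> y = x #> word_val \<Lambda> a u"
    then obtain u where u: "u \<in> W" "length u \<le> m" "y = x #> word_val \<Lambda> a u" by blast
    then have "(x, y) \<in> cayley_edges Q AQ ^^ length u" using relpow_edges_iff[OF x] by blast
    then have "(LEAST n. (x, y) \<in> cayley_edges Q AQ ^^ n) \<le> length u" by (rule Least_le)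
    then show "cayley_dist Q AQ x y \<le> real m" using u by (simp add: cayley_dist_def)
  qed
qed

end

section \<open>From quasi-isometries to words and chains\<close>

lemma warped_space_simps:
  assumes "t > 0"
  shows "mspace (warped_space S t) = UNIV" "mdist (warped_space S t) = warped_dist S t"
    "warped_dist S t x y \<le> t * dist x y" "s \<in> S \<Longrightarrow> warped_dist S t x (s x) \<le> 1"
    "warped_dist S t x y = warped_dist S t y x"
proof -
  note w = warped_dist_greatest(1)[OF assms, of S]
  interpret Metric_space UNIV "warped_dist S t" using w by blast
  show "mspace (warped_space S t) = UNIV" "mdist (warped_space S t) = warped_dist S t"
    by (simp_all add: warped_space_def)
  show "warped_dist S t x y \<le> t * dist x y" "s \<in> S \<Longrightarrow> warped_dist S t x (s x) \<le> 1"
    "warped_dist S t x y = warped_dist S t y x"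
    using w commute by auto
qed

lemma (in warped) warped_dist_jump:
  assumes "t > 0" "l \<in> S \<times> UNIV"
  shows "warped_dist S t (letter_act l y) y \<le> 1"
proof -
  obtain s b where l: "l = (s, b)" "s \<in> S" using assms(2) by (cases l) auto
  show ?thesis
  proof (cases b)
    case True
    then show ?thesis using warped_space_simps(4)[OF assms(1) l(2), of y] warped_space_simps(5)[OF
      assms(1), of S "s y" y] l by simp
  next
    case False
    have "s (letter_act l y) = y" using letter_act_inv[of "(s, True)" y] l False by simp
    then show ?thesis using warped_space_simps(4)[OF assms(1) l(2), of "letter_act l y"] by simp
  qed
qed

section \<open>Uniform constants and growing scales along the box space\<close>

locale box_warped = warped S x0 \<alpha> + presented_group \<Lambda> n a
  for S :: "('x::metric_space \<Rightarrow> 'x) set" and x0 \<alpha> and \<Lambda> :: "'g monoid" (structure) and n a +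
  fixes N :: "nat \<Rightarrow> 'g set" and t :: "nat \<Rightarrow> real"
  assumes inf: "infinite (carrier \<Lambda>)" and res: "residual_filtration \<Lambda> N"
    and t1: "\<And>k. t k \<ge> 1"
    and ce: "coarsely_equivalent (box_space \<Lambda> (a ` {..<n}) N) (\<lambda>k. warped_space S (t k))"
begin

lemma N_normal: "N k \<lhd> \<Lambda>"
  using res by (simp add: residual_filtration_def)

lemma quotient_graph: "quotient_graph \<Lambda> n a (N k)"
  by (intro quotient_graph.intro presented_group_axioms N_normal)

lemma t_pos: "t k > 0"
  using t1[of k] by linarith

lemma quasi_isometries:
  obtains q f and C :: nat where
    "\<forall>k x. q k x \<in> rcosets N k"
    "\<forall>k. \<forall>v\<in>rcosets N k. \<forall>g\<in>rcosets N k.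
       warped_dist S (t k) (f k v) (f k g)
         \<le> real C * cayley_dist (\<Lambda> Mod N k) ((\<lambda>g. N k #> g) ` (a ` {..<n})) v g + real C"
    "\<forall>k x y. cayley_dist (\<Lambda> Mod N k) ((\<lambda>g. N k #> g) ` (a ` {..<n})) (q k x) (q k y)
      \<le> real C * warped_dist S (t k) x y + real C"
    "\<forall>k x. warped_dist S (t k) (f k (q k x)) x \<le> real C"
    "\<forall>k. \<forall>v\<in>rcosets N k. cayley_dist (\<Lambda> Mod N k) ((\<lambda>g. N k #> g) ` (a ` {..<n})) (q k (f k v)) v \<le> real C"
proof -
  let ?d = "\<lambda>k. cayley_dist (\<Lambda> Mod N k) ((\<lambda>g. N k #> g) ` (a ` {..<n}))"
  obtain L A f where qi: "\<And>k. quasi_isometry L A (box_space \<Lambda> (a ` {..<n}) N k) (warped_space S (t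
    k)) (f k)"
    using ce unfolding coarsely_equivalent_def by metis
  have box: "mspace (box_space \<Lambda> (a ` {..<n}) N k) = rcosets N k"
    "mdist (box_space \<Lambda> (a ` {..<n}) N k) = ?d k" for k
    using quotient_graph.mspace_box[OF quotient_graph] quotient_graph.mdist_box[OF quotient_graph]
    by (simp_all add: box_space_def)
  note wsp = warped_space_simps(1,2)[OF t_pos]
  have "\<exists>g. coarsely_lipschitz L A (warped_space S (t k)) (box_space \<Lambda> (a ` {..<n}) N k) g \<and>
      (\<forall>x. warped_dist S (t k) (f k (g x)) x \<le> A) \<and> (\<forall>v\<in>rcosets N k. ?d k (g (f k v)) v \<le> A)" for k
    using qi[of k] by (simp add: quasi_isometry_def box wsp)
  then obtain q where q: "\<And>k. coarsely_lipschitz L A (warped_space S (t k)) (box_space \<Lambda> (a `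
    {..<n}) N k) (q k)"
    "\<And>k x. warped_dist S (t k) (f k (q k x)) x \<le> A" "\<And>k v. v \<in> rcosets N k \<Longrightarrow> ?d k (q k (f k v)) v \<le> A"
    by metis
  have f: "coarsely_lipschitz L A (box_space \<Lambda> (a ` {..<n}) N k) (warped_space S (t k)) (f k)" for k
    using qi[of k] by (simp add: quasi_isometry_def)
  \<comment> \<open>A single natural number dominates both constants, whatever their signs.\<close>
  define C where "C = nat \<lceil>\<bar>L\<bar> + \<bar>A\<bar>\<rceil>"
  have C: "\<bar>L\<bar> + \<bar>A\<bar> \<le> real C" unfolding C_def by linarith
  have LC: "L * d + A \<le> real C * d + real C" if "d \<ge> 0" for d
  proof -
    have "L * d \<le> real C * d" using C that by (intro mult_right_mono) auto
    then show ?thesis using C by linarith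
  qed
  have d_nonneg: "?d k x y \<ge> 0" for k x y by (simp add: cayley_dist_def)
  have w_nonneg: "warped_dist S (t k) x y \<ge> 0" for k x y
    by (metis mdist_nonneg wsp(2))
  have q': "?d k (q k x) (q k y) \<le> real C * warped_dist S (t k) x y + real C" for k x y
  proof -
    have "?d k (q k x) (q k y) \<le> L * warped_dist S (t k) x y + A"
      using q(1)[of k] by (simp add: coarsely_lipschitz_def box wsp)
    then show ?thesis using LC[OF w_nonneg[of k x y]] by linarith
  qed
  have f': "warped_dist S (t k) (f k v) (f k g) \<le> real C * ?d k v g + real C"
    if "v \<in> rcosets N k" "g \<in> rcosets N k" for k v g
  proof -
    have "warped_dist S (t k) (f k v) (f k g) \<le> L * ?d k v g + A"
      using f[of k] that by (simp add: coarsely_lipschitz_def box wsp)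
    then show ?thesis using LC[OF d_nonneg[of k v g]] by linarith
  qed
  have qV: "q k x \<in> rcosets N k" for k x
    using q(1)[of k] by (auto simp: coarsely_lipschitz_def box wsp)
  have A: "A \<le> real C" using C by linarith
  show thesis
    by (rule that[of q f C]; intro allI ballI)
       (fact qV | erule (1) f' | fact q' | rule order_trans[OF q(2) A] | erule order_trans[OF q(3) A])+
qed

text \<open>Only the finitely many nontrivial values of short words have to be kept out of
  \<open>N k\<close>.\<close>

lemma short_words:
  "\<forall>\<^sub>F k in sequentially. \<forall>u\<in>W. length u \<le> \<rho> \<longrightarrow> word_val \<Lambda> a u \<in> N k \<longrightarrow> word_val \<Lambda> a u = \<one>"
proof -
  have "finite {u. set u \<subseteq> {..<n} \<times> (UNIV :: bool set) \<and> length u \<le> \<rho>}"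
    by (intro finite_lists_length_le) simp
  then have "finite (word_val \<Lambda> a ` {u. set u \<subseteq> {..<n} \<times> (UNIV :: bool set) \<and> length u \<le> \<rho>} - {\<one>})" by blast
  from residual_filtration_avoids[OF res this]
  show ?thesis by (rule eventually_mono) (auto simp: lists_eq_set)
qed

text \<open>If \<open>t k\<close> stayed bounded, the warped spaces and hence the quotients would
  have bounded diameter. But \<Lambda> is infinite: some \<open>h\<close> is not the value of a word
  of length at most \<open>B\<close>, and for large \<open>k\<close> its coset is still farther than
  \<open>B\<close> from the trivial one.\<close>

lemma t_at_top: "filterlim t at_top sequentially"
proof -
  obtain q f and C :: nat where Q: "\<forall>k x. q k x \<in> rcosets N k"
    "\<forall>k. \<forall>v\<in>rcosets N k. \<forall>g\<in>rcosets N k.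
       warped_dist S (t k) (f k v) (f k g)
         \<le> real C * cayley_dist (\<Lambda> Mod N k) ((\<lambda>g. N k #> g) ` (a ` {..<n})) v g + real C"
    "\<forall>k x y. cayley_dist (\<Lambda> Mod N k) ((\<lambda>g. N k #> g) ` (a ` {..<n})) (q k x) (q k y)
      \<le> real C * warped_dist S (t k) x y + real C"
    "\<forall>k x. warped_dist S (t k) (f k (q k x)) x \<le> real C"
    "\<forall>k. \<forall>v\<in>rcosets N k. cayley_dist (\<Lambda> Mod N k) ((\<lambda>g. N k #> g) ` (a ` {..<n})) (q k (f k v)) v \<le> real C"
    by (rule quasi_isometries)
  note q = Q(1,3,5)[rule_format]
  have "bounded (UNIV :: 'x set)" by (rule compact_imp_bounded[OF compact_space])
  then obtain D where D: "\<And>x y :: 'x. dist x y \<le> D"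
    unfolding bounded_two_points by blast
  have "\<forall>\<^sub>F k in sequentially. T \<le> t k" for T
  proof -
    \<comment> \<open>\<open>B\<close> bounds distances in the quotient when \<open>t k\<close> is
      at most \<open>\<bar>T\<bar>\<close>: \<open>C * (\<bar>T\<bar> * D) + C\<close> for the
      images under \<open>q\<close>, and \<open>C\<close> at each end to return from
      \<open>q (f v)\<close> to \<open>v\<close>.\<close>
    define B where "B = nat \<lceil>real C * (\<bar>T\<bar> * D) + 3 * real C\<rceil>"
    define P where "P = word_val \<Lambda> a ` {u. set u \<subseteq> {..<n} \<times> (UNIV :: bool set) \<and> length u \<le> B}"
    have P: "word_val \<Lambda> a u \<in> P" if "u \<in> W" "length u \<le> B" for u
      unfolding P_def using that by (intro imageI) (simp add: lists_eq_set)
    have P': "\<exists>u\<in>W. length u \<le> B \<and> g = word_val \<Lambda> a u" if "g \<in> P" for g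
      using that unfolding P_def by (auto simp: lists_eq_set)
    have fin: "finite P"
      unfolding P_def by (intro finite_imageI finite_lists_length_le) simp
    have "\<not> carrier \<Lambda> \<subseteq> P" using inf fin finite_subset by blast
    then obtain h where h: "h \<in> carrier \<Lambda>" "h \<notin> P" by blast
    \<comment> \<open>If \<open>N k\<close> avoids these elements, the coset of \<open>h\<close>
      differs from the cosets of all words of length at most \<open>B\<close>.\<close>
    let ?Z = "(\<lambda>g. h \<otimes> inv g) ` P"
    have "\<one> \<notin> ?Z"
    proof
      assume "\<one> \<in> ?Z"
      then obtain u where u: "u \<in> W" "length u \<le> B" "\<one> = h \<otimes> inv (word_val \<Lambda> a u)"
        using P' by (elim imageE) (metis)
      have g: "word_val \<Lambda> a u \<in> carrier \<Lambda>" using u by simp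
      then have "h = h \<otimes> inv (word_val \<Lambda> a u) \<otimes> word_val \<Lambda> a u" using h(1) by (simp add: m_assoc)
      then have "h = word_val \<Lambda> a u" unfolding u(3)[symmetric] using g by simp
      then show False using h(2) P[OF u(1,2)] by simp
    qed
    from residual_filtration_avoids[OF res finite_imageI[OF fin] this]
    show ?thesis
    proof eventually_elim
      case (elim k)
      interpret K: quotient_graph \<Lambda> n a "N k" by (rule quotient_graph)
      interpret KM: Metric_space "rcosets N k" "cayley_dist K.Q K.AQ" by (rule K.Metric_space_Q)
      show ?case
      proof (rule ccontr)
        assume "\<not> T \<le> t k"
        then have T: "t k \<le> \<bar>T\<bar>" by linarith
        let ?d = "cayley_dist K.Q K.AQ"
        let ?v = "N k #> \<one>" and ?w = "N k #> h"
        have V: "?v \<in> rcosets N k" "?w \<in> rcosets N k" using h(1) by (auto simp: RCOSETS_def)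
        note qV = q(1)[of k]
        have "D \<ge> 0" using D[of undefined undefined] by simp
        then have "t k * dist x y \<le> \<bar>T\<bar> * D" for x y :: 'x using T D[of x y] by (intro mult_mono) auto
        then have "warped_dist S (t k) x y \<le> \<bar>T\<bar> * D" for x y
          using warped_space_simps(3)[OF t_pos, of S k x y] by (meson order_trans)
        then have "real C * warped_dist S (t k) (f k ?v) (f k ?w) \<le> real C * (\<bar>T\<bar> * D)"
          by (intro mult_left_mono) auto
        then have 1: "?d (q k (f k ?v)) (q k (f k ?w)) \<le> real C * (\<bar>T\<bar> * D) + real C"
          using q(2)[of k "f k ?v" "f k ?w"] by linarith
        have "?d ?v ?w \<le> ?d ?v (q k (f k ?v)) + (?d (q k (f k ?v)) (q k (f k ?w)) + ?d (q k (f k ?w)) ?w)"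
          using KM.triangle[OF V(1) qV[of "f k ?v"] V(2)] KM.triangle[OF qV[of "f k ?v"] qV[of
            "f k ?w"] V(2)] by linarith
        also have "?d ?v (q k (f k ?v)) = ?d (q k (f k ?v)) ?v" by (rule KM.commute)
        finally have "?d ?v ?w \<le> real C * (\<bar>T\<bar> * D) + 3 * real C"
          using q(3)[OF V(1)] q(3)[OF V(2)] 1 by linarith
        also have "\<dots> \<le> real B" unfolding B_def by linarith
        finally have "\<exists>u\<in>W. length u \<le> B \<and> ?w = ?v #> word_val \<Lambda> a u"
          unfolding K.cayley_dist_le_iff[OF V] .
        then obtain u where u: "u \<in> W" "length u \<le> B" "?w = ?v #> word_val \<Lambda> a u" by (elim bexE conjE)
        then have "N k #> h = N k #> word_val \<Lambda> a u" using K.subset by (simp add: coset_mult_assoc)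
        then have "h \<otimes> inv (word_val \<Lambda> a u) \<in> N k" using h u K.rcos_eq_iff by simp
        then show False using elim P[OF u(1,2)] by blast
      qed
    qed
  qed
  then show ?thesis by (simp add: filterlim_at_top)
qed

lemma comparisons:
  obtains M f q where "\<forall>\<^sub>F k in sequentially. comparison S x0 \<alpha> \<Lambda> n a (N k) (t k) M (f k) (q k)"
proof -
  obtain q f and C :: nat where Q':
    "\<forall>k x. q k x \<in> rcosets N k"
    "\<forall>k. \<forall>v\<in>rcosets N k. \<forall>g\<in>rcosets N k.
       warped_dist S (t k) (f k v) (f k g)
         \<le> real C * cayley_dist (\<Lambda> Mod N k) ((\<lambda>g. N k #> g) ` (a ` {..<n})) v g + real C"
    "\<forall>k x y. cayley_dist (\<Lambda> Mod N k) ((\<lambda>g. N k #> g) ` (a ` {..<n})) (q k x) (q k y)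
      \<le> real C * warped_dist S (t k) x y + real C"
    "\<forall>k x. warped_dist S (t k) (f k (q k x)) x \<le> real C"
    "\<forall>k. \<forall>v\<in>rcosets N k. cayley_dist (\<Lambda> Mod N k) ((\<lambda>g. N k #> g) ` (a ` {..<n})) (q k (f k v)) v \<le> real C"
    by (rule quasi_isometries)
  note Q = Q'[rule_format]
  \<comment> \<open>Points at distance at most 1 have images at distance at most
    \<open>C + C\<close>; \<open>chain_of_warped_dist_le\<close> turns this distance into the number
    of steps \<open>M\<close>.\<close>
  let ?c = "2 * C"
  define M where "M = ?c + (?c + 1) * ?c"
  have M: "?c \<le> M" by (simp add: M_def)
  obtain T where T: "\<And>t. t \<ge> T \<Longrightarrow> jumping_geodesic S t" using ws by (auto simp: warped_system_def)
  have "comparison S x0 \<alpha> \<Lambda> n a (N k) (t k) M (f k) (q k)" if k: "t k \<ge> T" for k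
  proof -
    interpret K: quotient_graph \<Lambda> n a "N k" by (rule quotient_graph)
    interpret KM: Metric_space "rcosets N k" "cayley_dist K.Q K.AQ" by (rule K.Metric_space_Q)
    let ?d = "cayley_dist K.Q K.AQ"
    have chain: "\<exists>e. chain (t k) M x y e" if "warped_dist S (t k) x y \<le> real ?c" for x y
      unfolding M_def by (rule chain_of_warped_dist_le[OF T[OF k] t_pos that])
    have word: "\<exists>u\<in>W. length u \<le> M \<and> w = v #> word_val \<Lambda> a u"
      if "v \<in> rcosets N k" "w \<in> rcosets N k" "?d v w \<le> real ?c" for v w
      using K.cayley_dist_le_iff[OF that(1,2), of M] that(3) M by (smt (verit) of_nat_mono)
    have le1: "real C * d + real C \<le> real ?c" if "d \<le> 1" for d
      using mult_left_mono[OF that, of "real C"] by simp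
    show ?thesis
    proof (intro comparison.intro comparison_axioms.intro)
      show "warped S x0 \<alpha>" by (rule warped_axioms)
      show "group \<Lambda>" by (rule is_group)
      show "a \<in> {..<n} \<rightarrow> carrier \<Lambda>" by (rule a)
      show "N k \<lhd> \<Lambda>" by (rule N_normal)
      show "0 < t k" by (rule t_pos)
      show "q k x \<in> rcosets N k" for x by (rule Q(1))
      show "\<exists>e. chain (t k) M (f k v) (f k (v #> a i)) e" if v: "v \<in> rcosets N k" and i: "i < n" for v i
      proof (rule chain)
        have ai: "a i \<in> carrier \<Lambda>" using a i by auto
        have v': "v #> a i \<in> rcosets N k" using v ai by simp
        have "?d v (v #> a i) \<le> real 1"
          unfolding K.cayley_dist_le_iff[OF v v'] using i ai
          by (intro bexI[of _ "[(i, True)]"]) auto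
        then show "warped_dist S (t k) (f k v) (f k (v #> a i)) \<le> real ?c"
          using Q(2)[OF v v'] le1[of "?d v (v #> a i)"] by simp
      qed
      show "\<exists>e. chain (t k) M x (f k (q k x)) e" for x
      proof (rule chain)
        show "warped_dist S (t k) x (f k (q k x)) \<le> real ?c"
          using Q(4)[of k x] warped_space_simps(5)[OF t_pos, of S k x "f k (q k x)"] by simp
      qed
      show "\<exists>u\<in>W. length u \<le> M \<and> q k y = q k x #> word_val \<Lambda> a u" if "dist x y \<le> 1 / t k" for x y
      proof (rule word[OF Q(1) Q(1)])
        have "warped_dist S (t k) x y \<le> 1"
          using warped_space_simps(3)[OF t_pos, of S k x y] that t_pos[of k] by (simp add: field_simps)
        then show "?d (q k x) (q k y) \<le> real ?c" using Q(3)[of k x y] le1 by force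
      qed
      show "\<exists>u\<in>W. length u \<le> M \<and> q k y = q k (letter_act l y) #> word_val \<Lambda> a u" if "l \<in> S \<times> UNIV" for l y
      proof (rule word[OF Q(1) Q(1)])
        show "?d (q k (letter_act l y)) (q k y) \<le> real ?c"
          using Q(3)[of k "letter_act l y" y] le1[OF warped_dist_jump[OF t_pos that, of k y]] by linarith
      qed
      show "\<exists>u\<in>W. length u \<le> M \<and> q k (f k v) = v #> word_val \<Lambda> a u" if "v \<in> rcosets N k" for v
      proof (rule word[OF that Q(1)])
        show "?d v (q k (f k v)) \<le> real ?c" using Q(5)[OF that] KM.commute[of v "q k (f k v)"] by simp
      qed
    qed
  qed
  then have "\<forall>\<^sub>F k in sequentially. comparison S x0 \<alpha> \<Lambda> n a (N k) (t k) M (f k) (q k)"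
    using t_at_top unfolding filterlim_at_top by (meson eventually_mono)
  then show thesis by (rule that)
qed

end

section \<open>Stability and finite presentability\<close>

lemma (in group_hom) iso_of_equal_kernels:
  assumes "group H'" "h' \<in> hom G H'" "h ` carrier G = carrier H" "h' ` carrier G = carrier H'"
    and "\<And>x. x \<in> carrier G \<Longrightarrow> h x = \<one>\<^bsub>H\<^esub> \<longleftrightarrow> h' x = \<one>\<^bsub>H'\<^esub>"
  shows "H \<cong> H'"
proof -
  interpret h': group_hom G H' h'
    using assms by (intro group_hom.intro group_hom_axioms.intro) (auto simp: G.is_group)
  have "kernel G H h = kernel G H' h'" using assms(5) by (auto simp: kernel_def)
  then have "G Mod kernel G H h \<cong> H'" using h'.FactGroup_iso[OF assms(4)] by simp
  moreover have "H \<cong> G Mod kernel G H h"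
    by (rule group.iso_sym[OF normal.factorgroup_is_group[OF normal_kernel] FactGroup_iso[OF assms(3)]])
  ultimately show ?thesis by (rule iso_trans[rotated])
qed

subsection \<open>Finite presentability does not depend on the generators\<close>

lemma word_val_cong:
  assumes "w \<in> lists (B \<times> UNIV)" "\<And>b. b \<in> B \<Longrightarrow> c b = d b"
  shows "word_val M c w = word_val M d w"
  using assms(1) by (induction w) (auto simp: assms(2))

lemma hom_free_group_eqI:
  assumes "group M" "h1 \<in> hom (free_group B) M" "h2 \<in> hom (free_group B) M"
    and "w \<in> carrier (free_group B)" "\<And>b. b \<in> B \<Longrightarrow> h1 [(b, True)] = h2 [(b, True)]"
  shows "h1 w = h2 w"
  unfolding hom_free_group_eq[OF assms(1,2,4)] hom_free_group_eq[OF assms(1,3,4)]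
  using assms(4,5) by (intro word_val_cong[where B = B]) (auto simp: carrier_free_group)

text \<open>Given an abstract presentation over \<open>m\<close> letters, lifting the generators
  gives homomorphisms \<open>\<sigma>\<close> and \<open>\<xi>\<close> between the two free groups,
  compatible with the maps to \<Lambda>. A relator is sent into \<open>K\<close> by
  \<open>\<xi>\<close>, \<open>\<sigma>\<close> maps \<open>K\<close> into the short kernel, and
  \<open>\<sigma> \<circ> \<xi>\<close> is the identity modulo it. So the finitely many relators
  over one generating set bound those over the other.\<close>

lemma (in presented_group) finitely_presented_iff:
  "finitely_presented \<Lambda> \<longleftrightarrow>
   (\<exists>r. \<forall>u\<in>carrier (free_group {..<n}). word_val \<Lambda> a u = \<one> \<longrightarrow> u \<in> short_kernel \<Lambda> n a r)"
proof
  let ?F = "free_group {..<n}"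
  interpret F: group ?F by (rule group_free_group)
  assume "\<exists>r. \<forall>u\<in>carrier ?F. word_val \<Lambda> a u = \<one> \<longrightarrow> u \<in> short_kernel \<Lambda> n a r"
  then obtain r where r: "\<And>u. u \<in> carrier ?F \<Longrightarrow> word_val \<Lambda> a u = \<one> \<Longrightarrow> u \<in> short_kernel \<Lambda> n a r" by blast
  interpret h: group_hom ?F \<Lambda> "word_val \<Lambda> a"
    by unfold_locales (rule word_val_hom)
  have "short_kernel \<Lambda> n a r \<subseteq> kernel ?F \<Lambda> (word_val \<Lambda> a)"
    unfolding short_kernel_def
    by (intro normal_closure_least h.normal_kernel) (auto simp: short_relators_def kernel_def)
  then have ker: "kernel ?F \<Lambda> (word_val \<Lambda> a) = normal_closure ?F (short_relators \<Lambda> n a r)"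
    using r by (auto simp: kernel_def short_kernel_def)
  have "word_val \<Lambda> a ` carrier ?F = carrier \<Lambda>"
  proof (intro subset_antisym subsetI)
    fix g assume "g \<in> carrier \<Lambda>"
    then obtain u where "u \<in> W" "word_val \<Lambda> a u = g" using word_val_surj by blast
    then show "g \<in> word_val \<Lambda> a ` carrier ?F"
      by (intro image_eqI[of _ _ "reduce u"]) (auto simp: word_val_reduce)
  qed (use h.hom_closed in auto)
  from h.FactGroup_iso[OF this]
  have "\<Lambda> \<cong> ?F Mod normal_closure ?F (short_relators \<Lambda> n a r)"
    unfolding ker[symmetric] by (rule group.iso_sym[OF normal.factorgroup_is_group[OF h.normal_kernel]])
  moreover have "finite (short_relators \<Lambda> n a r)"
  proof (rule finite_subset)
    show "short_relators \<Lambda> n a r \<subseteq> {u. set u \<subseteq> {..<n} \<times> UNIV \<and> length u \<le> r}"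
      by (auto simp: short_relators_def carrier_free_group)
  qed (intro finite_lists_length_le, simp)
  moreover have "short_relators \<Lambda> n a r \<subseteq> carrier ?F" by (auto simp: short_relators_def)
  ultimately show "finitely_presented \<Lambda>" unfolding finitely_presented_def by blast
next
  let ?F = "free_group {..<n}"
  interpret F: group ?F by (rule group_free_group)
  assume "finitely_presented \<Lambda>"
  then obtain m Rel where Rel: "finite Rel" "Rel \<subseteq> carrier (free_group {..<m::nat})"
    and iso: "\<Lambda> \<cong> free_group {..<m} Mod normal_closure (free_group {..<m}) Rel"
    unfolding finitely_presented_def by blast
  define G where "G = free_group {..<m}"
  define K where "K = normal_closure G Rel"
  have G: "group G" unfolding G_def by (rule group_free_group)
  interpret G: group G by (rule G)
  interpret K: normal K G unfolding K_def using normal_closure_normal[OF G] Rel by (simp add: G_def)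
  interpret GK: group "G Mod K" by (rule K.factorgroup_is_group)
  have "G Mod K \<cong> \<Lambda>" using iso by (intro iso_sym) (simp add: G_def K_def)
  then obtain \<phi> where \<phi>: "\<phi> \<in> iso (G Mod K) \<Lambda>" by (auto simp: is_iso_def)
  define p where "p = (\<lambda>w. \<phi> (K #>\<^bsub>G\<^esub> w))"
  have \<phi>_hom: "\<phi> \<in> hom (G Mod K) \<Lambda>" using \<phi> by (simp add: iso_def)
  have "\<phi> \<circ> (\<lambda>w. K #>\<^bsub>G\<^esub> w) \<in> hom G \<Lambda>"
    by (rule Group.hom_compose[OF K.r_coset_hom_Mod \<phi>_hom])
  then have p_hom: "p \<in> hom G \<Lambda>" by (simp add: p_def comp_def)
  interpret \<phi>: group_hom "G Mod K" \<Lambda> \<phi> by unfold_locales (rule \<phi>_hom)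
  have p_one: "w \<in> K" if w: "w \<in> carrier G" "p w = \<one>" for w
  proof -
    have "K #>\<^bsub>G\<^esub> w \<in> carrier (G Mod K)" using w by (auto simp: carrier_FactGroup)
    moreover have "inj_on \<phi> (carrier (G Mod K))" using \<phi> by (simp add: iso_def bij_betw_def)
    moreover have "\<phi> (K #>\<^bsub>G\<^esub> w) = \<phi> \<one>\<^bsub>G Mod K\<^esub>" using w(2) \<phi>.hom_one by (simp add: p_def)
    ultimately have "K #>\<^bsub>G\<^esub> w = \<one>\<^bsub>G Mod K\<^esub>" using GK.one_closed by (meson inj_onD)
    then show ?thesis using K.rcos_eq_self_iff[OF w(1)] by (simp add: one_FactGroup)
  qed
  have p_surj: "\<exists>w\<in>carrier G. p w = g" if "g \<in> carrier \<Lambda>" for g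
  proof -
    have "g \<in> \<phi> ` carrier (G Mod K)" using \<phi> that by (auto simp: iso_def bij_betw_def)
    then show ?thesis by (auto simp: carrier_FactGroup p_def)
  qed
  have p_closed: "p w \<in> carrier \<Lambda>" if "w \<in> carrier G" for w using p_hom that by (rule hom_in_carrier)
  have gen_G: "[(j, True)] \<in> carrier G" if "j < m" for j
    using that by (simp add: G_def carrier_free_group reduced_def)
  have gen_F: "[(i, True)] \<in> carrier ?F" if "i < n" for i
    using that by (simp add: carrier_free_group reduced_def)
  have "\<exists>u. j < m \<longrightarrow> u \<in> carrier ?F \<and> word_val \<Lambda> a u = p [(j, True)]" for j
  proof (cases "j < m")
    case True
    then obtain u where "u \<in> W" "word_val \<Lambda> a u = p [(j, True)]"
      using word_val_surj[OF p_closed[OF gen_G]] by blast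
    then show ?thesis by (intro exI[of _ "reduce u"]) (simp add: word_val_reduce)
  qed auto
  then obtain y where y: "\<And>j. j < m \<Longrightarrow> y j \<in> carrier ?F" "\<And>j. j < m \<Longrightarrow> word_val \<Lambda> a (y j) = p [(j, True)]"
    by metis
  have "\<exists>w. i < n \<longrightarrow> w \<in> carrier G \<and> p w = a i" for i
    using p_surj[of "a i"] a by (cases "i < n") auto
  then obtain x where x: "\<And>i. i < n \<Longrightarrow> x i \<in> carrier G" "\<And>i. i < n \<Longrightarrow> p (x i) = a i"
    by metis
  interpret \<sigma>: free_eval ?F "{..<m}" y by unfold_locales (use y in auto)
  interpret \<xi>: free_eval G "{..<n}" x by unfold_locales (use x in auto)
  define \<sigma> where "\<sigma> = word_val ?F y"
  define \<xi> where "\<xi> = word_val G x"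
  have \<sigma>_hom: "\<sigma> \<in> hom G ?F" unfolding \<sigma>_def G_def by (rule \<sigma>.word_val_hom)
  have \<xi>_hom: "\<xi> \<in> hom ?F G" unfolding \<xi>_def by (rule \<xi>.word_val_hom)
  interpret \<sigma>h: group_hom G ?F \<sigma> by unfold_locales (rule \<sigma>_hom)
  interpret \<xi>h: group_hom ?F G \<xi> by unfold_locales (rule \<xi>_hom)
  interpret ev: group_hom ?F \<Lambda> "word_val \<Lambda> a" by unfold_locales (rule word_val_hom)
  have ev_\<sigma>: "word_val \<Lambda> a (\<sigma> w) = p w" if w: "w \<in> carrier G" for w
  proof -
    have "(word_val \<Lambda> a \<circ> \<sigma>) w = p w"
    proof (rule hom_free_group_eqI[OF is_group _ _ w[unfolded G_def]])
      show "word_val \<Lambda> a \<circ> \<sigma> \<in> hom (free_group {..<m}) \<Lambda>"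
        using Group.hom_compose[OF \<sigma>_hom word_val_hom] by (simp add: G_def)
      show "p \<in> hom (free_group {..<m}) \<Lambda>" using p_hom by (simp add: G_def)
    qed (use y in \<open>simp add: \<sigma>_def reduce_id carrier_free_group\<close>)
    then show ?thesis by simp
  qed
  \<comment> \<open>\<open>r\<close> has to cover the images of the finitely many relators and the
    words \<open>\<sigma> (x i)\<close> multiplied by the inverse of the letter \<open>i\<close>;
    the latter account for the \<open>+ 1\<close>.\<close>
  define L where "L = (\<lambda>w. length (\<sigma> w)) ` Rel \<union> (\<lambda>i. length (\<sigma> (x i)) + 1) ` {..<n}"
  have "finite L" using Rel by (simp add: L_def)
  then obtain r where r: "\<And>l. l \<in> L \<Longrightarrow> l \<le> r" using Max_ge by blast
  let ?R = "short_kernel \<Lambda> n a r"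
  interpret R: normal ?R ?F by (rule short_kernel_normal)
  interpret FR: group "?F Mod ?R" by (rule R.factorgroup_is_group)
  interpret \<pi>: group_hom ?F "?F Mod ?R" "\<lambda>u. ?R #>\<^bsub>?F\<^esub> u" by unfold_locales (rule R.r_coset_hom_Mod)
  have relI: "u \<in> ?R" if "u \<in> carrier ?F" "length u \<le> r" "word_val \<Lambda> a u = \<one>" for u
    using that by (intro subsetD[OF short_relators_subset]) (simp add: short_relators_def)
  have \<sigma>K: "\<sigma> w \<in> ?R" if "w \<in> K" for w
  proof -
    have c: "(\<lambda>u. ?R #>\<^bsub>?F\<^esub> u) \<circ> \<sigma> \<in> hom G (?F Mod ?R)"
      by (rule Group.hom_compose[OF \<sigma>_hom R.r_coset_hom_Mod])
    interpret c: group_hom G "?F Mod ?R" "(\<lambda>u. ?R #>\<^bsub>?F\<^esub> u) \<circ> \<sigma>" by unfold_locales (rule c)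
    have "Rel \<subseteq> kernel G (?F Mod ?R) ((\<lambda>u. ?R #>\<^bsub>?F\<^esub> u) \<circ> \<sigma>)"
    proof
      fix w assume w: "w \<in> Rel"
      then have wG: "w \<in> carrier G" "w \<in> K"
        using Rel subsetD[OF normal_closure_incl w, of G] by (auto simp: G_def K_def)
      have "p w = \<one>"
        using wG K.rcos_eq_self_iff[of w] \<phi>.hom_one by (simp add: p_def one_FactGroup)
      then have "\<sigma> w \<in> ?R"
        using w wG ev_\<sigma> r[of "length (\<sigma> w)"] by (intro relI) (auto simp: L_def)
      then show "w \<in> kernel G (?F Mod ?R) ((\<lambda>u. ?R #>\<^bsub>?F\<^esub> u) \<circ> \<sigma>)"
        using wG by (simp add: kernel_def one_FactGroup R.rcos_eq_self_iff)
    qed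
    then have "K \<subseteq> kernel G (?F Mod ?R) ((\<lambda>u. ?R #>\<^bsub>?F\<^esub> u) \<circ> \<sigma>)"
      unfolding K_def by (intro normal_closure_least c.normal_kernel[unfolded K_def])
    then show ?thesis
      using that by (auto simp: kernel_def one_FactGroup R.rcos_eq_self_iff)
  qed
  have \<sigma>\<xi>: "?R #>\<^bsub>?F\<^esub> \<sigma> (\<xi> u) = ?R #>\<^bsub>?F\<^esub> u" if u: "u \<in> carrier ?F" for u
  proof -
    have "((\<lambda>u. ?R #>\<^bsub>?F\<^esub> u) \<circ> (\<sigma> \<circ> \<xi>)) u = (\<lambda>u. ?R #>\<^bsub>?F\<^esub> u) u"
    proof (rule hom_free_group_eqI[OF FR.is_group _ R.r_coset_hom_Mod u])
      show "(\<lambda>u. ?R #>\<^bsub>?F\<^esub> u) \<circ> (\<sigma> \<circ> \<xi>) \<in> hom ?F (?F Mod ?R)"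
        by (rule Group.hom_compose[OF Group.hom_compose[OF \<xi>_hom \<sigma>_hom] R.r_coset_hom_Mod])
      fix i assume "i \<in> {..<n}"
      then have i: "i < n" by simp
      have \<xi>i: "\<xi> [(i, True)] = x i" using x i by (simp add: \<xi>_def)
      let ?z = "\<sigma> (x i) \<otimes>\<^bsub>?F\<^esub> inv\<^bsub>?F\<^esub> [(i, True)]"
      have \<sigma>x: "\<sigma> (x i) \<in> carrier ?F" using x i by simp
      have ai: "a i \<in> carrier \<Lambda>" using a i by auto
      have "?z \<in> ?R"
      proof (rule relI)
        show "?z \<in> carrier ?F" using \<sigma>x gen_F[OF i] F.inv_closed F.m_closed by blast
        have "?z = reduce (\<sigma> (x i) @ [(i, False)])"
          using gen_F[OF i] by (simp add: inv_free_group)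
        then have "length ?z \<le> length (\<sigma> (x i)) + 1"
          using length_reduce[of "\<sigma> (x i) @ [(i, False)]"] by simp
        then show "length ?z \<le> r" using r[of "length (\<sigma> (x i)) + 1"] i by (auto simp: L_def)
        have "word_val \<Lambda> a ?z = word_val \<Lambda> a (\<sigma> (x i)) \<otimes> inv (word_val \<Lambda> a [(i, True)])"
          using \<sigma>x gen_F[OF i] by (simp only: ev.hom_mult ev.hom_inv F.inv_closed)
        then show "word_val \<Lambda> a ?z = \<one>" using x i ai by (simp add: ev_\<sigma>)
      qed
      then show "((\<lambda>u. ?R #>\<^bsub>?F\<^esub> u) \<circ> (\<sigma> \<circ> \<xi>)) [(i, True)] = ?R #>\<^bsub>?F\<^esub> [(i, True)]"
        using R.rcos_eq_iff[OF \<sigma>x gen_F[OF i]] by (simp only: comp_def \<xi>i)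
    qed
    then show ?thesis by simp
  qed
  have "u \<in> ?R" if u: "u \<in> carrier ?F" "word_val \<Lambda> a u = \<one>" for u
  proof -
    have \<xi>u: "\<xi> u \<in> carrier G" using u by simp
    have "(p \<circ> \<xi>) u = word_val \<Lambda> a u"
    proof (rule hom_free_group_eqI[OF is_group Group.hom_compose[OF \<xi>_hom p_hom] word_val_hom u(1)])
      fix i assume "i \<in> {..<n}"
      moreover from this have "a i \<in> carrier \<Lambda>" using a by auto
      ultimately show "(p \<circ> \<xi>) [(i, True)] = word_val \<Lambda> a [(i, True)]" using x by (simp add: \<xi>_def)
    qed
    then have "\<xi> u \<in> K" using p_one[OF \<xi>u] u by simp
    then have "\<sigma> (\<xi> u) \<in> ?R" by (rule \<sigma>K)
    then have "?R #>\<^bsub>?F\<^esub> u = ?R" using \<sigma>\<xi>[OF u(1)] R.rcos_eq_self_iff[of "\<sigma> (\<xi> u)"] \<xi>u by simp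
    then show ?thesis using u by (simp add: R.rcos_eq_self_iff)
  qed
  then show "\<exists>r. \<forall>u\<in>carrier ?F. word_val \<Lambda> a u = \<one> \<longrightarrow> u \<in> short_kernel \<Lambda> n a r" by blast
qed

subsection \<open>Stability in terms of the relators\<close>

text \<open>Classes agree exactly when the elements agree at some later index. Applied at
  \<open>i\<close>, this turns injectivity and surjectivity of the canonical map into the two
  conditions on bonding maps; elements at an arbitrary index \<open>j\<close> are first pushed to
  \<open>max i j\<close>.\<close>

lemma direct_limit_iso:
  fixes I :: "'i::linorder set" and G :: "'i \<Rightarrow> 'a monoid"
  assumes groups: "\<And>i. i \<in> I \<Longrightarrow> group (G i)"
    and hom: "\<And>i j. i \<in> I \<Longrightarrow> j \<in> I \<Longrightarrow> i \<le> j \<Longrightarrow> f i j \<in> hom (G i) (G j)"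
    and id: "\<And>i x. i \<in> I \<Longrightarrow> x \<in> carrier (G i) \<Longrightarrow> f i i x = x"
    and comp: "\<And>i j k x. i \<in> I \<Longrightarrow> j \<in> I \<Longrightarrow> k \<in> I \<Longrightarrow> i \<le> j \<Longrightarrow> j \<le> k \<Longrightarrow> x \<in> carrier (G i) \<Longrightarrow>
      f j k (f i j x) = f i k x"
    and i: "i \<in> I"
  shows "direct_limit_map I G f i \<in> iso (G i) (direct_limit I G f) \<longleftrightarrow>
    (\<forall>j\<in>I. i \<le> j \<longrightarrow> inj_on (f i j) (carrier (G i)))
    \<and> (\<forall>j\<in>I. i \<le> j \<longrightarrow> (\<forall>y\<in>carrier (G j). \<exists>k\<in>I. j \<le> k \<and> f j k y \<in> f i k ` carrier (G i)))" (is
      "_ \<longleftrightarrow> ?inj \<and> ?surj")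
proof -
  let ?E = "direct_limit_rel I G f"
  let ?m = "direct_limit_map I G f"
  have closed: "f i j x \<in> carrier (G j)" if "i \<in> I" "j \<in> I" "i \<le> j" "x \<in> carrier (G i)" for i j x
    using hom[OF that(1-3)] that(4) by (rule hom_in_carrier)
  have maxI: "max j k \<in> I" if "j \<in> I" "k \<in> I" for j k using that by (simp add: max_def)
  have rel: "((j, x), (k, y)) \<in> ?E \<longleftrightarrow> j \<in> I \<and> k \<in> I \<and> x \<in> carrier (G j) \<and> y \<in> carrier (G k) \<and>
        (\<exists>l\<in>I. j \<le> l \<and> k \<le> l \<and> f j l x = f k l y)" for j x k y
    by (simp add: direct_limit_rel_def)
  have equiv: "equiv (SIGMA i:I. carrier (G i)) ?E"
  proof (rule equivI)
    show "?E \<subseteq> (SIGMA i:I. carrier (G i)) \<times> (SIGMA i:I. carrier (G i))" by (auto simp: direct_limit_rel_def)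
    show "refl_on (SIGMA i:I. carrier (G i)) ?E"
      by (rule refl_onI) (auto simp: rel)
    show "sym ?E" by (rule symI) (force simp: direct_limit_rel_def)
    show "trans ?E"
    proof (rule transI)
      fix p q r assume "(p, q) \<in> ?E" "(q, r) \<in> ?E"
      moreover obtain j x k y l z where [simp]: "p = (j, x)" "q = (k, y)" "r = (l, z)"
        by (cases p, cases q, cases r) auto
      ultimately obtain a b where *: "j \<in> I" "k \<in> I" "l \<in> I" "x \<in> carrier (G j)" "y \<in> carrier (G k)"
        "z \<in> carrier (G l)"
        "a \<in> I" "j \<le> a" "k \<le> a" "f j a x = f k a y" "b \<in> I" "k \<le> b" "l \<le> b" "f k b y = f l b z"
        by (auto simp: rel)
      let ?c = "max a b"
      have c: "?c \<in> I" using * maxI by blast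
      have c': "a \<le> ?c" "b \<le> ?c" by simp_all
      have "f j ?c x = f a ?c (f j a x)" by (rule comp[OF *(1,7) c *(8) c'(1) *(4), symmetric])
      also have "\<dots> = f a ?c (f k a y)" by (simp only: *(10))
      also have "\<dots> = f k ?c y" by (rule comp[OF *(2,7) c *(9) c'(1) *(5)])
      also have "\<dots> = f b ?c (f k b y)" by (rule comp[OF *(2,11) c *(12) c'(2) *(5), symmetric])
      also have "\<dots> = f b ?c (f l b z)" by (simp only: *(14))
      also have "\<dots> = f l ?c z" by (rule comp[OF *(3,11) c *(13) c'(2) *(6)])
      finally have "f j ?c x = f l ?c z" .
      moreover have "j \<le> ?c" "l \<le> ?c" using * by (auto simp: le_max_iff_disj)
      ultimately show "(p, r) \<in> ?E" using *(1,3,4,6) c by (auto simp: rel)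
    qed
  qed
  have m_eq: "?m j x = ?m k y \<longleftrightarrow> (\<exists>l\<in>I. j \<le> l \<and> k \<le> l \<and> f j l x = f k l y)"
    if "j \<in> I" "k \<in> I" "x \<in> carrier (G j)" "y \<in> carrier (G k)" for j k x y
    unfolding direct_limit_map_def
    using eq_equiv_class_iff[OF equiv, of "(j, x)" "(k, y)"] that by (simp add: rel)
  have m_step: "?m j x = ?m k (f j k x)" if "j \<in> I" "k \<in> I" "j \<le> k" "x \<in> carrier (G j)" for j k x
    using that closed by (subst m_eq) (auto simp: comp intro!: bexI[of _ k])
  have car: "carrier (direct_limit I G f) = {?m j x | j x. j \<in> I \<and> x \<in> carrier (G j)}"
    by (auto simp: direct_limit_def quotient_def direct_limit_map_def)
  have mult: "?m i x \<otimes>\<^bsub>direct_limit I G f\<^esub> ?m i y = ?m i (x \<otimes>\<^bsub>G i\<^esub> y)"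
    if x: "x \<in> carrier (G i)" and y: "y \<in> carrier (G i)" for x y
  proof -
    \<comment> \<open>Arbitrary representatives agree with \<open>x\<close> and \<open>y\<close>
      from \<open>max a b\<close> on, so the products are compared at that index.\<close>
    have *: "?m (max j k) (f j (max j k) x' \<otimes>\<^bsub>G (max j k)\<^esub> f k (max j k) y') = ?m i (x \<otimes>\<^bsub>G i\<^esub> y)"
      if mem: "(j, x') \<in> ?m i x" "(k, y') \<in> ?m i y" for j x' k y'
    proof -
      obtain a b where ab: "j \<in> I" "k \<in> I" "x' \<in> carrier (G j)" "y' \<in> carrier (G k)"
        "a \<in> I" "i \<le> a" "j \<le> a" "f i a x = f j a x'" "b \<in> I" "i \<le> b" "k \<le> b" "f i b y = f k b y'"
        using mem by (auto simp: direct_limit_map_def rel)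
      let ?l = "max j k" and ?c = "max a b"
      have c: "?c \<in> I" "?l \<in> I" "?l \<le> ?c" "i \<le> ?c" "j \<le> ?c" "k \<le> ?c"
        using ab maxI by (auto simp: le_max_iff_disj)
      interpret g: group "G ?l" by (rule groups[OF c(2)])
      have xy: "f j ?l x' \<in> carrier (G ?l)" "f k ?l y' \<in> carrier (G ?l)" using ab c closed by auto
      have "?m ?l (f j ?l x' \<otimes>\<^bsub>G ?l\<^esub> f k ?l y') = ?m ?c (f ?l ?c (f j ?l x' \<otimes>\<^bsub>G ?l\<^esub> f k ?l y'))"
        using xy c by (intro m_step) auto
      also have "f ?l ?c (f j ?l x' \<otimes>\<^bsub>G ?l\<^esub> f k ?l y') = f j ?c x' \<otimes>\<^bsub>G ?c\<^esub> f k ?c y'"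
        using hom_mult[OF hom[OF c(2,1,3)] xy] ab c by (simp add: comp)
      also have "f j ?c x' = f a ?c (f j a x')"
        by (rule comp[OF ab(1,5) c(1) ab(7) max.cobounded1 ab(3), symmetric])
      also have "\<dots> = f a ?c (f i a x)" by (simp only: ab(8))
      also have "\<dots> = f i ?c x" by (rule comp[OF i ab(5) c(1) ab(6) max.cobounded1 x])
      also have "f k ?c y' = f b ?c (f k b y')"
        by (rule comp[OF ab(2,9) c(1) ab(11) max.cobounded2 ab(4), symmetric])
      also have "\<dots> = f b ?c (f i b y)" by (simp only: ab(12))
      also have "\<dots> = f i ?c y" by (rule comp[OF i ab(9) c(1) ab(10) max.cobounded2 y])
      also have "f i ?c x \<otimes>\<^bsub>G ?c\<^esub> f i ?c y = f i ?c (x \<otimes>\<^bsub>G i\<^esub> y)"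
        using hom_mult[OF hom[OF i c(1,4)] x y] by simp
      also have "?m ?c (f i ?c (x \<otimes>\<^bsub>G i\<^esub> y)) = ?m i (x \<otimes>\<^bsub>G i\<^esub> y)"
        using i c x y groups[OF i] by (intro m_step[symmetric]) (auto simp: group.is_monoid monoid.m_closed)
      finally show ?thesis .
    qed
    have self: "(i, z) \<in> ?m i z" if "z \<in> carrier (G i)" for z
      using that i by (auto simp: direct_limit_map_def rel)
    have "?m i x \<otimes>\<^bsub>direct_limit I G f\<^esub> ?m i y = (\<Union>p\<in>?m i x. \<Union>r\<in>?m i y.
        ?m (max (fst p) (fst r)) (f (fst p) (max (fst p) (fst r)) (snd p) \<otimes>\<^bsub>G (max (fst p) (fst r))\<^esub>
          f (fst r) (max (fst p) (fst r)) (snd r)))"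
      by (simp add: direct_limit_def case_prod_unfold)
    also have "\<dots> = (\<Union>p\<in>?m i x. \<Union>r\<in>?m i y. ?m i (x \<otimes>\<^bsub>G i\<^esub> y))"
      using * by (intro SUP_cong refl) (auto simp del: UN_simps)
    also have "\<dots> = ?m i (x \<otimes>\<^bsub>G i\<^esub> y)" using self[OF x] self[OF y] by blast
    finally show ?thesis .
  qed
  have homm: "?m i \<in> hom (G i) (direct_limit I G f)"
    using i by (intro homI) (auto simp: car mult)
  have injm: "inj_on (?m i) (carrier (G i)) \<longleftrightarrow> ?inj"
    using i by (fastforce simp: inj_on_def m_eq)
  have surjm: "?m i ` carrier (G i) = carrier (direct_limit I G f) \<longleftrightarrow> ?surj"
  proof
    assume eq: "?m i ` carrier (G i) = carrier (direct_limit I G f)"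
    show ?surj
    proof (intro ballI impI)
      fix j y assume j: "j \<in> I" "i \<le> j" "y \<in> carrier (G j)"
      then have "?m j y \<in> ?m i ` carrier (G i)" unfolding eq car by blast
      then obtain x where x: "x \<in> carrier (G i)" "?m j y = ?m i x" by blast
      then show "\<exists>k\<in>I. j \<le> k \<and> f j k y \<in> f i k ` carrier (G i)"
        using m_eq[OF j(1) i j(3) x(1)] by blast
    qed
  next
    assume surj: ?surj
    have "?m j y \<in> ?m i ` carrier (G i)" if j: "j \<in> I" "y \<in> carrier (G j)" for j y
    proof -
      let ?l = "max i j"
      have l: "?l \<in> I" using maxI i j by blast
      have y': "f j ?l y \<in> carrier (G ?l)" using closed j l by simp
      obtain k x where k: "k \<in> I" "?l \<le> k" "x \<in> carrier (G i)" "f ?l k (f j ?l y) = f i k x"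
        using surj[rule_format, OF l max.cobounded1 y'] by blast
      then have "f j k y = f i k x" using j l by (simp add: comp)
      then have "?m j y = ?m i x" using m_eq[OF j(1) i j(2) k(3)] k by auto
      then show ?thesis using k(3) by blast
    qed
    then show "?m i ` carrier (G i) = carrier (direct_limit I G f)" using i by (auto simp: car)
  qed
  show ?thesis using homm injm surjm by (simp add: iso_def bij_betw_def)
qed

section \<open>The limit group and the increasing kernels\<close>

context warped begin

interpretation G: group \<Gamma> by (rule group_pi1_semidirect)

lemma warped_pi1_map_rcos:
  assumes "\<theta> \<le> \<theta>'" "g \<in> carrier \<Gamma>"
  shows "warped_pi1_map S x0 \<alpha> \<theta> \<theta>' (fix_kernel S x0 \<alpha> \<theta> #>\<^bsub>\<Gamma>\<^esub> g) = fix_kernel S x0 \<alpha> \<theta>' #>\<^bsub>\<Gamma>\<^esub> g"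
proof -
  let ?K = "fix_kernel S x0 \<alpha> \<theta>" and ?K' = "fix_kernel S x0 \<alpha> \<theta>'"
  interpret K: normal ?K \<Gamma> by (rule fix_kernel_normal)
  interpret K': normal ?K' \<Gamma> by (rule fix_kernel_normal)
  have sub: "?K \<subseteq> ?K'" by (rule fix_kernel_mono[OF assms(1)])
  have "?K' <#>\<^bsub>\<Gamma>\<^esub> ?K = ?K'"
  proof
    show "?K' <#>\<^bsub>\<Gamma>\<^esub> ?K \<subseteq> ?K'" using sub K'.m_closed by (auto simp: set_mult_def)
    show "?K' \<subseteq> ?K' <#>\<^bsub>\<Gamma>\<^esub> ?K"
    proof
      fix x assume x: "x \<in> ?K'"
      then have "x = x \<otimes>\<^bsub>\<Gamma>\<^esub> \<one>\<^bsub>\<Gamma>\<^esub>" by simp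
      then show "x \<in> ?K' <#>\<^bsub>\<Gamma>\<^esub> ?K" using x K.one_closed unfolding set_mult_def by blast
    qed
  qed
  then show ?thesis
    unfolding warped_pi1_map_def using G.setmult_rcos_assoc[OF K'.subset K.subset assms(2)] by simp
qed

text \<open>The bonding maps are quotient maps of one group, hence surjective. Only their
  injectivity is in question, and it says that the increasing kernels have stopped growing at
  \<open>\<theta>\<close>.\<close>

lemma direct_limit_map_iso_iff:
  assumes "\<theta> \<ge> 1"
  shows "direct_limit_map {1..} (warped_pi1 S x0 \<alpha>) (warped_pi1_map S x0 \<alpha>) \<theta>
      \<in> iso (warped_pi1 S x0 \<alpha> \<theta>) (warped_pi1_infinity S x0 \<alpha>) \<longleftrightarrow>
    (\<forall>\<theta>'\<ge>\<theta>. fix_kernel S x0 \<alpha> \<theta>' = fix_kernel S x0 \<alpha> \<theta>)"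
proof -
  let ?K = "fix_kernel S x0 \<alpha>" and ?P = "warped_pi1 S x0 \<alpha>" and ?f = "warped_pi1_map S x0 \<alpha>"
  have K: "?K \<theta> \<lhd> \<Gamma>" for \<theta> by (rule fix_kernel_normal)
  have car: "carrier (?P \<theta>) = (\<lambda>g. ?K \<theta> #>\<^bsub>\<Gamma>\<^esub> g) ` carrier \<Gamma>" for \<theta>
    by (simp add: warped_pi1_def carrier_FactGroup)
  have mult: "C \<otimes>\<^bsub>?P \<theta>\<^esub> D = C <#>\<^bsub>\<Gamma>\<^esub> D" for \<theta> C D by (simp add: warped_pi1_def mult_FactGroup)
  have iff: "direct_limit_map {1..} ?P ?f \<theta> \<in> iso (?P \<theta>) (direct_limit {1..} ?P ?f) \<longleftrightarrow>
    (\<forall>j\<in>{1..}. \<theta> \<le> j \<longrightarrow> inj_on (?f \<theta> j) (carrier (?P \<theta>)))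
    \<and> (\<forall>j\<in>{1..}. \<theta> \<le> j \<longrightarrow> (\<forall>y\<in>carrier (?P j). \<exists>k\<in>{1..}. j \<le> k \<and> ?f j k y \<in> ?f \<theta> k ` carrier (?P \<theta>)))"
  proof (rule direct_limit_iso)
    fix i j :: nat assume "i \<le> j"
    show "?f i j \<in> hom (?P i) (?P j)"
    proof (rule homI)
      fix C D assume "C \<in> carrier (?P i)" "D \<in> carrier (?P i)"
      then obtain g h where "g \<in> carrier \<Gamma>" "h \<in> carrier \<Gamma>" "C = ?K i #>\<^bsub>\<Gamma>\<^esub> g" "D = ?K i #>\<^bsub>\<Gamma>\<^esub> h"
        by (auto simp: car)
      then show "?f i j (C \<otimes>\<^bsub>?P i\<^esub> D) = ?f i j C \<otimes>\<^bsub>?P j\<^esub> ?f i j D"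
        using \<open>i \<le> j\<close> by (simp add: mult normal.rcos_sum[OF K] warped_pi1_map_rcos)
    qed (auto simp: car warped_pi1_map_rcos \<open>i \<le> j\<close>)
  next
    fix i :: nat and C assume "C \<in> carrier (?P i)"
    then show "?f i i C = C" by (auto simp: car warped_pi1_map_rcos)
  next
    fix i j k :: nat and C assume "i \<le> j" "j \<le> k" "C \<in> carrier (?P i)"
    then show "?f j k (?f i j C) = ?f i k C" by (auto simp: car warped_pi1_map_rcos)
  next
    show "group (?P i)" for i
      unfolding warped_pi1_def by (rule normal.factorgroup_is_group[OF K])
  qed (use assms in auto)
  have surj: "(\<forall>j\<in>{1..}. \<theta> \<le> j \<longrightarrow> (\<forall>y\<in>carrier (?P j). \<exists>k\<in>{1..}. j \<le> k \<and> ?f j k y \<in> ?f \<theta> k ` carrier (?P \<theta>)))"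
  proof (intro ballI impI)
    fix j y assume j: "j \<in> {1::nat..}" "\<theta> \<le> j" "y \<in> carrier (?P j)"
    then obtain g where g: "g \<in> carrier \<Gamma>" "y = ?K j #>\<^bsub>\<Gamma>\<^esub> g" by (auto simp: car)
    have "?f j j y = ?f \<theta> j (?K \<theta> #>\<^bsub>\<Gamma>\<^esub> g)" using j g by (simp add: warped_pi1_map_rcos)
    then show "\<exists>k\<in>{1..}. j \<le> k \<and> ?f j k y \<in> ?f \<theta> k ` carrier (?P \<theta>)"
      using j g by (intro bexI[of _ j]) (auto simp: car)
  qed
  have inj: "(\<forall>j\<in>{1..}. \<theta> \<le> j \<longrightarrow> inj_on (?f \<theta> j) (carrier (?P \<theta>))) \<longleftrightarrow> (\<forall>j\<ge>\<theta>. ?K j = ?K \<theta>)"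
  proof -
    have "inj_on (?f \<theta> j) (carrier (?P \<theta>)) \<longleftrightarrow> ?K j = ?K \<theta>" if j: "\<theta> \<le> j" for j
    proof
      assume inj: "inj_on (?f \<theta> j) (carrier (?P \<theta>))"
      have "g \<in> ?K \<theta>" if g: "g \<in> ?K j" for g
      proof -
        have gc: "g \<in> carrier \<Gamma>" using g normal.axioms(1)[OF K] subgroup.subset by blast
        have "?f \<theta> j (?K \<theta> #>\<^bsub>\<Gamma>\<^esub> g) = ?f \<theta> j (?K \<theta> #>\<^bsub>\<Gamma>\<^esub> \<one>\<^bsub>\<Gamma>\<^esub>)"
          using g gc j normal.rcos_eq_iff[OF K, of g "\<one>\<^bsub>\<Gamma>\<^esub>"] by (simp add: warped_pi1_map_rcos)
        then have "?K \<theta> #>\<^bsub>\<Gamma>\<^esub> g = ?K \<theta> #>\<^bsub>\<Gamma>\<^esub> \<one>\<^bsub>\<Gamma>\<^esub>"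
        proof (rule inj_onD[OF inj])
          show "?K \<theta> #>\<^bsub>\<Gamma>\<^esub> g \<in> carrier (?P \<theta>)" unfolding car using gc by (rule imageI)
          show "?K \<theta> #>\<^bsub>\<Gamma>\<^esub> \<one>\<^bsub>\<Gamma>\<^esub> \<in> carrier (?P \<theta>)" unfolding car using G.one_closed by (rule imageI)
        qed
        then show ?thesis using normal.rcos_eq_iff[OF K gc G.one_closed] gc by simp
      qed
      then show "?K j = ?K \<theta>" using fix_kernel_mono[OF j] by blast
    next
      assume eq: "?K j = ?K \<theta>"
      have f_id: "?f \<theta> j C = C" if C: "C \<in> carrier (?P \<theta>)" for C
      proof -
        obtain g where g: "g \<in> carrier \<Gamma>" "C = ?K \<theta> #>\<^bsub>\<Gamma>\<^esub> g" using C unfolding car by (elim imageE)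
        show ?thesis unfolding g(2) warped_pi1_map_rcos[OF j g(1)] eq by (rule refl)
      qed
      show "inj_on (?f \<theta> j) (carrier (?P \<theta>))"
      proof (rule inj_onI)
        fix C D assume C: "C \<in> carrier (?P \<theta>)" and D: "D \<in> carrier (?P \<theta>)" and "?f \<theta> j C = ?f \<theta> j D"
        then show "C = D" unfolding f_id[OF C] f_id[OF D] by (elim asm_rl)
      qed
    qed
    note inj_iff = this
    show ?thesis
    proof
      assume L: "\<forall>j\<in>{1..}. \<theta> \<le> j \<longrightarrow> inj_on (?f \<theta> j) (carrier (?P \<theta>))"
      show "\<forall>j\<ge>\<theta>. ?K j = ?K \<theta>"
      proof (intro allI impI)
        fix j assume j: "\<theta> \<le> j"
        then have "j \<in> {1..}" using assms by simp
        then show "?K j = ?K \<theta>" by (rule iffD1[OF inj_iff[OF j] mp[OF bspec[OF L] j]])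
      qed
    next
      assume R: "\<forall>j\<ge>\<theta>. ?K j = ?K \<theta>"
      show "\<forall>j\<in>{1..}. \<theta> \<le> j \<longrightarrow> inj_on (?f \<theta> j) (carrier (?P \<theta>))"
      proof (intro ballI impI)
        fix j assume j: "\<theta> \<le> j"
        show "inj_on (?f \<theta> j) (carrier (?P \<theta>))" by (rule iffD2[OF inj_iff[OF j] mp[OF spec[OF R] j]])
      qed
    qed
  qed
  show ?thesis
    unfolding warped_pi1_infinity_def iff
  proof (intro iffI conjI)
    show "\<forall>j\<ge>\<theta>. ?K j = ?K \<theta>"
      if "(\<forall>j\<in>{1..}. \<theta> \<le> j \<longrightarrow> inj_on (?f \<theta> j) (carrier (?P \<theta>))) \<and>
       (\<forall>j\<in>{1..}. \<theta> \<le> j \<longrightarrow> (\<forall>y\<in>carrier (?P j). \<exists>k\<in>{1..}. j \<le> k \<and> ?f j k y \<in> ?f \<theta> k ` carrier (?P \<theta>)))"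
      by (rule iffD1[OF inj conjunct1[OF that]])
  qed (rule iffD2[OF inj], assumption, rule surj)
qed

end

section \<open>Stability, finite presentability and the isomorphism\<close>

context box_warped begin

abbreviation "F \<equiv> free_group {..<n}"
abbreviation "ev \<equiv> word_val \<Lambda> a"
abbreviation "K \<equiv> fix_kernel S x0 \<alpha>"
abbreviation "R \<equiv> short_kernel \<Lambda> n a"

lemma eventually_closed_chain:
  assumes "m \<le> 4 * \<theta>"
  shows "\<forall>\<^sub>F k in sequentially. \<forall>x e. chain (t k) m x x e \<longrightarrow> e \<in> K \<theta>"
proof -
  obtain T where T: "\<forall>t\<ge>T. \<forall>x e. chain t m x x e \<longrightarrow> e \<in> K \<theta>"
    using closed_chain_in_fix_kernel[OF assms] by blast
  have "\<forall>\<^sub>F k in sequentially. T \<le> t k" using t_at_top unfolding filterlim_at_top by blast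
  then show ?thesis by (rule eventually_mono) (use T in blast)
qed

text \<open>Collects what the two implications use of \<open>E\<close>, read from the vertex
  \<open>q k x0\<close>. The order of quantifiers is the point: \<open>M\<close> is fixed first,
  \<open>\<rho>\<close> depends only on \<open>\<theta>\<close>, and how large \<open>k\<close> must
  be may depend on all of them.\<close>

lemma correspondence:
  obtains M :: nat and \<Phi> where
    "\<forall>\<^sub>F k in sequentially. \<forall>u\<in>carrier F. ev u \<in> N k \<longrightarrow> \<Phi> k u \<in> carrier \<Gamma> \<and>
       (\<forall>w\<in>carrier F. \<Phi> k (u \<otimes>\<^bsub>F\<^esub> w) = \<Phi> k u \<otimes>\<^bsub>\<Gamma>\<^esub> \<Phi> k w)"
    "\<forall>r \<theta>. r * M \<le> 4 * \<theta> \<longrightarrow> (\<forall>\<^sub>F k in sequentially. \<forall>u\<in>R r. \<Phi> k u \<in> K \<theta>)"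
    "\<forall>\<theta>. \<exists>\<rho>. \<forall>\<^sub>F k in sequentially. \<forall>u\<in>carrier F. ev u \<in> N k \<longrightarrow> \<Phi> k u \<in> K \<theta> \<longrightarrow> u \<in> R \<rho>"
    "\<forall>\<theta>. M * M + 2 * M + 1 \<le> 4 * \<theta> \<longrightarrow> (\<forall>\<^sub>F k in sequentially. \<forall>g\<in>carrier \<Gamma>.
       \<exists>u\<in>carrier F. ev u \<in> N k \<and> K \<theta> #>\<^bsub>\<Gamma>\<^esub> g = K \<theta> #>\<^bsub>\<Gamma>\<^esub> \<Phi> k u)"
proof -
  obtain M f q where comp: "\<forall>\<^sub>F k in sequentially. comparison S x0 \<alpha> \<Lambda> n a (N k) (t k) M (f k) (q k)"
    by (rule comparisons)
  define \<Phi> where "\<Phi> k u = comparison.E S x0 \<alpha> \<Lambda> a (t k) M (f k) (q k x0) u" for k u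
  show thesis
  proof (rule that[of \<Phi> M], goal_cases)
    case 1
    show ?case using comp
    proof eventually_elim
      case (elim k)
      interpret C: comparison S x0 \<alpha> \<Lambda> n a "N k" "t k" M "f k" "q k" by (rule elim)
      show ?case
      proof (intro ballI impI conjI)
        fix u assume u: "u \<in> carrier F" "ev u \<in> N k"
        then have uW: "u \<in> W" by (simp add: carrier_free_group)
        show "\<Phi> k u \<in> carrier \<Gamma>" unfolding \<Phi>_def using C.q_mem uW by (rule C.E_closed)
        fix w assume "w \<in> carrier F"
        then have wW: "w \<in> W" by (simp add: carrier_free_group)
        have "q k x0 #> ev u = q k x0" using C.N.rcosets_stabilizer[OF C.q_mem] u uW by simp
        then show "\<Phi> k (u \<otimes>\<^bsub>F\<^esub> w) = \<Phi> k u \<otimes>\<^bsub>\<Gamma>\<^esub> \<Phi> k w"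
          unfolding \<Phi>_def using C.E_append[OF C.q_mem uW wW] C.E_reduce[OF C.q_mem, of
            "u @ w"] uW wW by simp
      qed
    qed
  next
    case 2
    show ?case
    proof (intro allI impI)
      fix r \<theta> assume "r * M \<le> 4 * \<theta>"
      from comp eventually_closed_chain[OF this]
      show "\<forall>\<^sub>F k in sequentially. \<forall>u\<in>R r. \<Phi> k u \<in> K \<theta>"
      proof eventually_elim
        case (elim k)
        interpret C: comparison S x0 \<alpha> \<Lambda> n a "N k" "t k" M "f k" "q k" by (rule elim)
        show ?case
        proof
          fix u assume "u \<in> R r"
          show "\<Phi> k u \<in> K \<theta>"
            unfolding \<Phi>_def
            by (rule C.E_short_kernel[OF _ fix_kernel_normal \<open>u \<in> R r\<close> C.q_mem]) (use elim(2) in blast)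
        qed
      qed
    qed
  next
    case 3
    show ?case
    proof
      fix \<theta>
      \<comment> \<open>The sum meets the three lower bounds of \<open>comparison_short\<close> at
        once.\<close>
      define \<rho> where "\<rho> = 4 * M + (M * M + 2 * M + 1) + 4 * \<theta> * M"
      have \<rho>: "4 * M \<le> \<rho>" "M * M + 2 * M + 1 \<le> \<rho>" "4 * \<theta> * M \<le> \<rho>" by (simp_all add: \<rho>_def)
      from comp short_words[of \<rho>]
      have "\<forall>\<^sub>F k in sequentially. \<forall>u\<in>carrier F. ev u \<in> N k \<longrightarrow> \<Phi> k u \<in> K \<theta> \<longrightarrow> u \<in> R \<rho>"
      proof eventually_elim
        case (elim k)
        interpret C: comparison_short S x0 \<alpha> \<Lambda> n a "N k" "t k" M "f k" "q k" \<rho> \<theta>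
          using elim \<rho> by (intro comparison_short.intro comparison_short_axioms.intro) blast+
        show ?case
        proof (intro ballI impI)
          fix u assume u: "u \<in> carrier F" "ev u \<in> N k" "\<Phi> k u \<in> K \<theta>"
          show "u \<in> R \<rho>" by (rule C.E_in_fix_kernel_imp[OF C.q_mem u(1,2) u(3)[unfolded \<Phi>_def]])
        qed
      qed
      then show "\<exists>\<rho>. \<forall>\<^sub>F k in sequentially. \<forall>u\<in>carrier F. ev u \<in> N k \<longrightarrow> \<Phi> k u \<in> K \<theta> \<longrightarrow> u \<in> R \<rho>"
        by (rule exI)
    qed
  next
    case 4
    show ?case
    proof (intro allI impI)
      fix \<theta> assume "M * M + 2 * M + 1 \<le> 4 * \<theta>"
      from comp eventually_closed_chain[OF this]
      show "\<forall>\<^sub>F k in sequentially. \<forall>g\<in>carrier \<Gamma>.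
         \<exists>u\<in>carrier F. ev u \<in> N k \<and> K \<theta> #>\<^bsub>\<Gamma>\<^esub> g = K \<theta> #>\<^bsub>\<Gamma>\<^esub> \<Phi> k u"
      proof eventually_elim
        case (elim k)
        interpret C: comparison S x0 \<alpha> \<Lambda> n a "N k" "t k" M "f k" "q k" by (rule elim)
        show ?case
          unfolding \<Phi>_def by (intro ballI, rule C.E_surj_mod[OF fix_kernel_normal]) (use elim(2) in blast)+
      qed
    qed
  qed
qed

text \<open>\<open>\<rho>\<close> is fixed first, from \<open>\<theta>0\<close> alone. A relator of
  any length is sent into \<open>K \<theta>\<close> for some \<open>\<theta>\<close> depending on
  its length; by stability this is \<open>K \<theta>0\<close>, which puts the relator back into
  \<open>R \<rho>\<close>.\<close>

lemma stable_imp_relators_bounded: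
  assumes "\<forall>\<theta>\<ge>\<theta>0. K \<theta> = K \<theta>0"
  shows "\<exists>r. \<forall>u\<in>carrier F. ev u = \<one> \<longrightarrow> u \<in> R r"
proof -
  obtain M \<Phi> where
    P1: "\<forall>r \<theta>. r * M \<le> 4 * \<theta> \<longrightarrow> (\<forall>\<^sub>F k in sequentially. \<forall>u\<in>R r. \<Phi> k u \<in> K \<theta>)" and
    P2: "\<forall>\<theta>. \<exists>\<rho>. \<forall>\<^sub>F k in sequentially. \<forall>u\<in>carrier F. ev u \<in> N k \<longrightarrow> \<Phi> k u \<in> K \<theta> \<longrightarrow> u \<in> R \<rho>"
    by (rule correspondence)
  obtain \<rho> where \<rho>: "\<forall>\<^sub>F k in sequentially. \<forall>u\<in>carrier F. ev u \<in> N k \<longrightarrow> \<Phi> k u \<in> K \<theta>0 \<longrightarrow> u \<in> R \<rho>"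
    using P2 by blast
  have "u \<in> R \<rho>" if u: "u \<in> carrier F" "ev u = \<one>" for u
  proof -
    let ?\<theta> = "max \<theta>0 (length u * M)"
    have "length u * M \<le> 4 * ?\<theta>" by simp
    then have "\<forall>\<^sub>F k in sequentially. \<forall>w\<in>R (length u). \<Phi> k w \<in> K ?\<theta>" using P1 by blast
    then have "\<forall>\<^sub>F k in sequentially. u \<in> R \<rho>" using \<rho>
    proof eventually_elim
      case (elim k)
      have "u \<in> R (length u)"
        using u by (intro subsetD[OF short_relators_subset]) (simp add: short_relators_def)
      then have "\<Phi> k u \<in> K ?\<theta>" using elim(1) by blast
      moreover have "K ?\<theta> = K \<theta>0" by (rule assms[rule_format]) simp
      ultimately have "\<Phi> k u \<in> K \<theta>0" by simp
      moreover have "ev u \<in> N k"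
        unfolding u(2) using N_normal[of k] by (intro subgroup.one_closed normal_imp_subgroup)
      ultimately show ?case using elim(2) u(1) by blast
    qed
    \<comment> \<open>\<open>u \<in> R \<rho>\<close> does not involve \<open>k\<close>, so holding
      for large \<open>k\<close> it holds outright.\<close>
    then show ?thesis by simp
  qed
  then show ?thesis by blast
qed

text \<open>When \<open>R r\<close> contains all relators, then for each
  \<open>\<theta> \<ge> \<theta>0\<close> and large \<open>k\<close>, \<open>\<Phi> k u\<close> lies
  in \<open>K \<theta>\<close> exactly if \<open>u\<close> is trivial in \<Lambda>, a condition
  without \<open>\<theta>\<close>. Since \<open>\<Phi> k\<close> meets every coset of
  \<open>K \<theta>0\<close>, this forces \<open>K \<theta>\<close> down to
  \<open>K \<theta>0\<close>.\<close>

lemma relators_bounded_imp_stable: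
  assumes r: "\<forall>u\<in>carrier F. ev u = \<one> \<longrightarrow> u \<in> R r"
  shows "\<exists>\<theta>0\<ge>1. (\<forall>\<theta>\<ge>\<theta>0. K \<theta> = K \<theta>0) \<and>
    (\<forall>\<^sub>F k in sequentially. \<Lambda>\<lparr>carrier := N k\<rparr> \<cong> \<Gamma> Mod K \<theta>0)"
proof -
  obtain M \<Phi> where
    P0: "\<forall>\<^sub>F k in sequentially. \<forall>u\<in>carrier F. ev u \<in> N k \<longrightarrow> \<Phi> k u \<in> carrier \<Gamma> \<and>
       (\<forall>w\<in>carrier F. \<Phi> k (u \<otimes>\<^bsub>F\<^esub> w) = \<Phi> k u \<otimes>\<^bsub>\<Gamma>\<^esub> \<Phi> k w)" and
    P1: "\<forall>r \<theta>. r * M \<le> 4 * \<theta> \<longrightarrow> (\<forall>\<^sub>F k in sequentially. \<forall>u\<in>R r. \<Phi> k u \<in> K \<theta>)" and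
    P2: "\<forall>\<theta>. \<exists>\<rho>. \<forall>\<^sub>F k in sequentially. \<forall>u\<in>carrier F. ev u \<in> N k \<longrightarrow> \<Phi> k u \<in> K \<theta> \<longrightarrow> u \<in> R \<rho>" and
    P3: "\<forall>\<theta>. M * M + 2 * M + 1 \<le> 4 * \<theta> \<longrightarrow> (\<forall>\<^sub>F k in sequentially. \<forall>g\<in>carrier \<Gamma>.
       \<exists>u\<in>carrier F. ev u \<in> N k \<and> K \<theta> #>\<^bsub>\<Gamma>\<^esub> g = K \<theta> #>\<^bsub>\<Gamma>\<^esub> \<Phi> k u)"
    by (rule correspondence)
  interpret F: group F by (rule group_free_group)
  interpret G: group \<Gamma> by (rule group_pi1_semidirect)
  interpret h: group_hom F \<Lambda> ev by unfold_locales (rule word_val_hom)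
  have R_ev: "ev u = \<one>" if "u \<in> R \<rho>" for u \<rho>
  proof -
    have "R \<rho> \<subseteq> kernel F \<Lambda> ev"
      unfolding short_kernel_def
      by (intro normal_closure_least h.normal_kernel) (auto simp: short_relators_def kernel_def)
    then show ?thesis using that by (auto simp: kernel_def)
  qed
  \<comment> \<open>The first summand is for mapping \<open>R r\<close> into
    \<open>K \<theta>0\<close>, the second for surjectivity; the latter also makes
    \<open>\<theta>0\<close> positive.\<close>
  define \<theta>0 where "\<theta>0 = r * M + (M * M + 2 * M + 1)"
  have le: "x \<le> 4 * (x + y)" "y \<le> 4 * (x + y)" for x y :: nat by simp_all
  have \<theta>0: "\<theta>0 \<ge> 1" "r * M \<le> 4 * \<theta>0" "M * M + 2 * M + 1 \<le> 4 * \<theta>0"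
    unfolding \<theta>0_def by (simp, (rule le)+)
  have kernels: "\<forall>\<^sub>F k in sequentially. \<forall>u\<in>carrier F. ev u \<in> N k \<longrightarrow> (\<Phi> k u \<in> K \<theta> \<longleftrightarrow> ev u = \<one>)"
    if "\<theta> \<ge> \<theta>0" for \<theta>
  proof -
    obtain \<rho> where \<rho>: "\<forall>\<^sub>F k in sequentially. \<forall>u\<in>carrier F. ev u \<in> N k \<longrightarrow> \<Phi> k u \<in> K \<theta> \<longrightarrow> u \<in> R \<rho>"
      using P2 by blast
    have "r * M \<le> 4 * \<theta>" using that \<theta>0(2) by linarith
    then have "\<forall>\<^sub>F k in sequentially. \<forall>u\<in>R r. \<Phi> k u \<in> K \<theta>" using P1 by blast
    then show ?thesis using \<rho>
    proof eventually_elim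
      case (elim k)
      show ?case using elim r R_ev by blast
    qed
  qed
  note surj = P3[rule_format, OF \<theta>0(3)]
  have "K \<theta> = K \<theta>0" if \<theta>: "\<theta> \<ge> \<theta>0" for \<theta>
  proof -
    from P0 kernels[OF \<theta>] kernels[OF order_refl] surj
    have "\<forall>\<^sub>F k in sequentially. K \<theta> \<subseteq> K \<theta>0"
    proof eventually_elim
      case (elim k)
      show ?case
      proof
        fix g assume g: "g \<in> K \<theta>"
        interpret K: normal "K \<theta>" \<Gamma> by (rule fix_kernel_normal)
        interpret K0: normal "K \<theta>0" \<Gamma> by (rule fix_kernel_normal)
        have gc: "g \<in> carrier \<Gamma>" by (rule K.mem_carrier[OF g])
        obtain u where u: "u \<in> carrier F" "ev u \<in> N k" "K \<theta>0 #>\<^bsub>\<Gamma>\<^esub> g = K \<theta>0 #>\<^bsub>\<Gamma>\<^esub> \<Phi> k u"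
          using elim(4) gc by blast
        have \<Phi>u: "\<Phi> k u \<in> carrier \<Gamma>" using elim(1) u by blast
        have "\<Phi> k u \<otimes>\<^bsub>\<Gamma>\<^esub> inv\<^bsub>\<Gamma>\<^esub> g \<in> K \<theta>0"
          using iffD1[OF K0.rcos_eq_iff[OF \<Phi>u gc] u(3)[symmetric]] .
        then have "\<Phi> k u \<otimes>\<^bsub>\<Gamma>\<^esub> inv\<^bsub>\<Gamma>\<^esub> g \<in> K \<theta>" by (rule subsetD[OF fix_kernel_mono[OF \<theta>]])
        from K.m_closed[OF this g] have "\<Phi> k u \<in> K \<theta>" using \<Phi>u gc by (simp add: G.m_assoc)
        then have "\<Phi> k u \<in> K \<theta>0" using elim(2,3) u by blast
        then have "K \<theta>0 #>\<^bsub>\<Gamma>\<^esub> g = K \<theta>0" using u(3) K0.rcos_eq_self_iff[OF \<Phi>u] by simp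
        then show "g \<in> K \<theta>0" using K0.rcos_eq_self_iff[OF gc] by simp
      qed
    qed
    then have "K \<theta> \<subseteq> K \<theta>0" by simp
    then show ?thesis using fix_kernel_mono[OF \<theta>] by (rule subset_antisym)
  qed
  moreover from P0 kernels[OF order_refl] surj
  have "\<forall>\<^sub>F k in sequentially. \<Lambda>\<lparr>carrier := N k\<rparr> \<cong> \<Gamma> Mod K \<theta>0"
  proof eventually_elim
    case (elim k)
    interpret Nk: normal "N k" \<Lambda> by (rule N_normal)
    interpret K0: normal "K \<theta>0" \<Gamma> by (rule fix_kernel_normal)
    \<comment> \<open>The preimage of \<open>N k\<close> in the free group maps onto
      \<open>N k\<close> by \<open>ev\<close> and onto the quotient by \<open>K \<theta>0\<close>
      through \<open>\<Phi> k\<close>, with the same kernel.\<close>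
    let ?Z = "{u \<in> carrier F. ev u \<in> N k}" and ?L = "\<Lambda>\<lparr>carrier := N k\<rparr>"
    have Z: "subgroup ?Z F"
    proof (rule F.subgroupI)
      have "\<one>\<^bsub>F\<^esub> \<in> ?Z" using F.one_closed Nk.one_closed by (simp only: mem_Collect_eq h.hom_one)
      then show "?Z \<noteq> {}" by (intro notI) (simp only: empty_iff)
      show "inv\<^bsub>F\<^esub> u \<in> ?Z" if "u \<in> ?Z" for u
        using that h.hom_inv by (simp del: one_free_group mult_free_group)
      show "u \<otimes>\<^bsub>F\<^esub> w \<in> ?Z" if "u \<in> ?Z" "w \<in> ?Z" for u w
        using that F.m_closed[of u w] h.hom_mult[of u w] by (simp del: mult_free_group)
    qed auto
    have h1: "ev \<in> hom (F\<lparr>carrier := ?Z\<rparr>) ?L"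
      using h.hom_mult by (intro homI) (auto simp del: mult_free_group)
    have h2: "(\<lambda>u. K \<theta>0 #>\<^bsub>\<Gamma>\<^esub> \<Phi> k u) \<in> hom (F\<lparr>carrier := ?Z\<rparr>) (\<Gamma> Mod K \<theta>0)"
    proof (rule homI)
      fix u w assume "u \<in> carrier (F\<lparr>carrier := ?Z\<rparr>)" "w \<in> carrier (F\<lparr>carrier := ?Z\<rparr>)"
      then have u: "u \<in> carrier F" "ev u \<in> N k" and w: "w \<in> carrier F" "ev w \<in> N k" by auto
      have "\<Phi> k (u \<otimes>\<^bsub>F\<^esub> w) = \<Phi> k u \<otimes>\<^bsub>\<Gamma>\<^esub> \<Phi> k w" "\<Phi> k u \<in> carrier \<Gamma>" "\<Phi> k w \<in> carrier \<Gamma>"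
        using elim(1) u w by blast+
      then show "K \<theta>0 #>\<^bsub>\<Gamma>\<^esub> \<Phi> k (u \<otimes>\<^bsub>F\<lparr>carrier := ?Z\<rparr>\<^esub> w) =
          (K \<theta>0 #>\<^bsub>\<Gamma>\<^esub> \<Phi> k u) \<otimes>\<^bsub>\<Gamma> Mod K \<theta>0\<^esub> (K \<theta>0 #>\<^bsub>\<Gamma>\<^esub> \<Phi> k w)"
        by (simp add: mult_FactGroup K0.rcos_sum del: mult_free_group)
    next
      fix u assume "u \<in> carrier (F\<lparr>carrier := ?Z\<rparr>)"
      then have "\<Phi> k u \<in> carrier \<Gamma>" using elim(1) by simp
      then show "K \<theta>0 #>\<^bsub>\<Gamma>\<^esub> \<Phi> k u \<in> carrier (\<Gamma> Mod K \<theta>0)" unfolding carrier_FactGroup by (rule imageI)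
    qed
    interpret h1: group_hom "F\<lparr>carrier := ?Z\<rparr>" ?L ev
      using F.subgroup_imp_group[OF Z] subgroup_imp_group[OF normal_imp_subgroup[OF N_normal]] h1
      by (intro group_hom.intro group_hom_axioms.intro)
    show ?case
    proof (rule h1.iso_of_equal_kernels[OF K0.factorgroup_is_group h2])
      show "ev ` carrier (F\<lparr>carrier := ?Z\<rparr>) = carrier ?L"
      proof (intro subset_antisym subsetI)
        fix g assume g: "g \<in> carrier ?L"
        then have "g \<in> carrier \<Lambda>" using Nk.mem_carrier by simp
        then obtain u where u: "u \<in> W" "ev u = g" using word_val_surj by blast
        have "ev (reduce u) = g" using u by (simp add: word_val_reduce)
        moreover have "reduce u \<in> carrier F" using u by simp
        ultimately show "g \<in> ev ` carrier (F\<lparr>carrier := ?Z\<rparr>)" using g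
          by (intro image_eqI[of _ _ "reduce u"]) simp_all
      qed auto
      show "(\<lambda>u. K \<theta>0 #>\<^bsub>\<Gamma>\<^esub> \<Phi> k u) ` carrier (F\<lparr>carrier := ?Z\<rparr>) = carrier (\<Gamma> Mod K \<theta>0)"
      proof (intro subset_antisym subsetI)
        fix C assume "C \<in> carrier (\<Gamma> Mod K \<theta>0)"
        then obtain g where "g \<in> carrier \<Gamma>" "C = K \<theta>0 #>\<^bsub>\<Gamma>\<^esub> g" unfolding carrier_FactGroup by (elim imageE)
        then obtain u where "u \<in> carrier F" "ev u \<in> N k" "C = K \<theta>0 #>\<^bsub>\<Gamma>\<^esub> \<Phi> k u"
          using elim(3) by blast
        then show "C \<in> (\<lambda>u. K \<theta>0 #>\<^bsub>\<Gamma>\<^esub> \<Phi> k u) ` carrier (F\<lparr>carrier := ?Z\<rparr>)"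
          by (intro image_eqI[of _ _ u]) simp_all
      next
        fix C assume "C \<in> (\<lambda>u. K \<theta>0 #>\<^bsub>\<Gamma>\<^esub> \<Phi> k u) ` carrier (F\<lparr>carrier := ?Z\<rparr>)"
        then obtain u where "u \<in> carrier (F\<lparr>carrier := ?Z\<rparr>)" "C = K \<theta>0 #>\<^bsub>\<Gamma>\<^esub> \<Phi> k u" by (elim imageE)
        then show "C \<in> carrier (\<Gamma> Mod K \<theta>0)" using hom_in_carrier[OF h2] by simp
      qed
      fix u assume "u \<in> carrier (F\<lparr>carrier := ?Z\<rparr>)"
      then have u: "u \<in> carrier F" "ev u \<in> N k" by auto
      have "\<Phi> k u \<in> carrier \<Gamma>" using elim(1) u by blast
      then have "K \<theta>0 #>\<^bsub>\<Gamma>\<^esub> \<Phi> k u = \<one>\<^bsub>\<Gamma> Mod K \<theta>0\<^esub> \<longleftrightarrow> \<Phi> k u \<in> K \<theta>0"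
        by (simp add: one_FactGroup K0.rcos_eq_self_iff)
      also have "\<dots> \<longleftrightarrow> ev u = \<one>" using elim(2) u by blast
      finally show "ev u = \<one>\<^bsub>?L\<^esub> \<longleftrightarrow> K \<theta>0 #>\<^bsub>\<Gamma>\<^esub> \<Phi> k u = \<one>\<^bsub>\<Gamma> Mod K \<theta>0\<^esub>" by simp
    qed
  qed
  ultimately show ?thesis using \<theta>0(1) by blast
qed

lemma stable_iff: "stable_discrete_pi1 S x0 \<alpha> \<longleftrightarrow> (\<exists>\<theta>0\<ge>1. \<forall>\<theta>\<ge>\<theta>0. K \<theta> = K \<theta>0)"
  unfolding stable_discrete_pi1_def
proof (intro iffI; elim exE conjE)
  fix \<theta> assume "1 \<le> \<theta>"
    and "direct_limit_map {1..} (warped_pi1 S x0 \<alpha>) (warped_pi1_map S x0 \<alpha>) \<theta>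
      \<in> iso (warped_pi1 S x0 \<alpha> \<theta>) (warped_pi1_infinity S x0 \<alpha>)"
  then show "\<exists>\<theta>0\<ge>1. \<forall>\<theta>\<ge>\<theta>0. K \<theta> = K \<theta>0"
    using iffD1[OF direct_limit_map_iso_iff] by (intro exI[of _ \<theta>] conjI)
next
  fix \<theta> :: nat assume "1 \<le> \<theta>" "\<forall>\<theta>'\<ge>\<theta>. K \<theta>' = K \<theta>"
  then show "\<exists>\<theta>\<ge>1. direct_limit_map {1..} (warped_pi1 S x0 \<alpha>) (warped_pi1_map S x0 \<alpha>) \<theta>
      \<in> iso (warped_pi1 S x0 \<alpha> \<theta>) (warped_pi1_infinity S x0 \<alpha>)"
    using iffD2[OF direct_limit_map_iso_iff] by (intro exI[of _ \<theta>] conjI)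
qed

theorem stable_iff_finitely_presented:
  "(stable_discrete_pi1 S x0 \<alpha> \<longleftrightarrow> finitely_presented \<Lambda>) \<and>
    (finitely_presented \<Lambda> \<longrightarrow>
      (\<forall>\<^sub>F k in sequentially. \<Lambda>\<lparr>carrier := N k\<rparr> \<cong> warped_pi1_infinity S x0 \<alpha>))"
proof (intro conjI impI iffI)
  assume "stable_discrete_pi1 S x0 \<alpha>"
  then obtain \<theta>0 where "\<forall>\<theta>\<ge>\<theta>0. K \<theta> = K \<theta>0" unfolding stable_iff by (elim exE conjE)
  then show "finitely_presented \<Lambda>"
    unfolding finitely_presented_iff by (rule stable_imp_relators_bounded)
next
  assume "finitely_presented \<Lambda>"
  then obtain r where r: "\<forall>u\<in>carrier F. ev u = \<one> \<longrightarrow> u \<in> R r"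
    unfolding finitely_presented_iff by (elim exE)
  obtain \<theta>0 where \<theta>0: "\<theta>0 \<ge> 1" "\<forall>\<theta>\<ge>\<theta>0. K \<theta> = K \<theta>0"
    "\<forall>\<^sub>F k in sequentially. \<Lambda>\<lparr>carrier := N k\<rparr> \<cong> \<Gamma> Mod K \<theta>0"
    using relators_bounded_imp_stable[OF r] by (elim exE conjE)
  show "stable_discrete_pi1 S x0 \<alpha>" unfolding stable_iff using \<theta>0(1,2) by (intro exI[of _ \<theta>0] conjI)
  have iso: "\<Gamma> Mod K \<theta>0 \<cong> warped_pi1_infinity S x0 \<alpha>"
    using iffD2[OF direct_limit_map_iso_iff[OF \<theta>0(1)] \<theta>0(2)] unfolding warped_pi1_def by (rule is_isoI)
  show "\<forall>\<^sub>F k in sequentially. \<Lambda>\<lparr>carrier := N k\<rparr> \<cong> warped_pi1_infinity S x0 \<alpha>"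
    using \<theta>0(3) by (rule eventually_mono) (rule iso_trans[OF _ iso])
qed

end

theorem theorem9p2:
  fixes \<Lambda> :: "'g monoid" and A :: "'g set" and N :: "nat \<Rightarrow> 'g set"
    and S :: "('x::metric_space \<Rightarrow> 'x) set" and t :: "nat \<Rightarrow> real"
    and x0 :: 'x and \<alpha> :: "('x \<Rightarrow> 'x) \<Rightarrow> real \<Rightarrow> 'x"
  assumes "group \<Lambda>" and "infinite (carrier \<Lambda>)"
    and "finite A" and "A \<subseteq> carrier \<Lambda>" and "generate \<Lambda> A = carrier \<Lambda>"
    and "residual_filtration \<Lambda> N"
    and "warped_system S"
    and "\<And>s. s \<in> S \<Longrightarrow> path (\<alpha> s) \<and> pathstart (\<alpha> s) = x0 \<and> pathfinish (\<alpha> s) = s x0"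
    and "\<And>k. t k \<ge> 1"
    and "coarsely_equivalent (box_space \<Lambda> A N) (\<lambda>k. warped_space S (t k))"
  shows "(stable_discrete_pi1 S x0 \<alpha> \<longleftrightarrow> finitely_presented \<Lambda>) \<and>
    (finitely_presented \<Lambda> \<longrightarrow>
      (\<forall>\<^sub>F k in sequentially. \<Lambda>\<lparr>carrier := N k\<rparr> \<cong> warped_pi1_infinity S x0 \<alpha>))"
proof -
  \<comment> \<open>The generators are enumerated to match presentations, whose letters form an
    initial segment of the natural numbers.\<close>
  obtain a :: "nat \<Rightarrow> 'g" and n where an: "bij_betw a {..<n} A"
    using ex_bij_betw_nat_finite[OF assms(3)] by (auto simp: atLeast0LessThan)
  then have A: "a ` {..<n} = A" by (simp add: bij_betw_def)
  interpret box_warped S x0 \<alpha> \<Lambda> n a N t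
  proof (intro box_warped.intro warped.intro presented_group.intro presented_group_axioms.intro
    box_warped_axioms.intro)
    show "a \<in> {..<n} \<rightarrow> carrier \<Lambda>" using A assms(4) by auto
  qed (use assms A in simp_all)
  show ?thesis by (rule stable_iff_finitely_presented)
qed

end
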